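(* Let $d\ge1$ and $\lambda>0$. Suppose there exists some $h>0$ such that $f$ is analytic in the $d$-dimensional region $$D_{h,\epsilon}=\Big\{\mathbf{z}\in\mathbb{C}^d:\ \sum_{i=1}^d z_i^2\in N_{d,\,h^2+d\epsilon}\Big\},$$ where $\epsilon>0$ is an arbitrarily small fixed constant when $0<\lambda<1$, and $\epsilon=0$ when $\lambda\ge1$. Then the multivariate Gegenbauer coefficients $a_{\mathbf{k}}$ of $f$ satisfy $$|a_{\mathbf{k}}|\le\frac{\widehat{\mathcal{B}}_f\,L(\mathcal{E}_{\widehat{\boldsymbol{\rho}}})}{\pi^d\,\rho^{\|\mathbf{k}\|_2}}\prod_{\substack{1\le i\le d\\ k_i=0}}\overline{D}_{\widehat{\rho}_i}^{(\lambda)}\prod_{\substack{1\le j\le d\\ k_j\neq0}}k_j^{1-\lambda}D_{\widehat{\rho}_j}^{(\lambda)},$$ where $\rho=h+\sqrt{1+h^2}$, $$\widehat{\rho}_j=\sqrt{(c_jh)^2+\epsilon}+\sqrt{1+(c_jh)^2+\epsilon},\qquad c_j=\frac{k_j}{\|\mathbf{k}\|_2},\qquad j=1,\dots,d,$$ $\mathcal{E}_{\widehat{\boldsymbol{\rho}}}=\bigotimes_{j=1}^d\mathcal{E}_{\widehat{\rho}_j}$, and $\widehat{\mathcal{B}}_f=\max_{\mathbf{z}\in\mathcal{E}_{\widehat{\boldsymbol{\rho}}}}|f(\mathbf{z})|$.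
   Context: $\Omega_d=[-1,1]^d$, $\mathbf{k}=(k_1,\dots,k_d)\in\mathbb{N}_0^d$, $\|\mathbf{k}\|_2=(k_1^2+\dots+k_d^2)^{1/2}$. For $s,a>0$, $N_{s,a}\subseteq\mathbb{C}$ is the open region bounded by the ellipse with foci $0$ and $s$ and leftmost point $-a$. $C_n^{(\lambda)}$ is the Gegenbauer polynomial of degree $n$, orthogonal on $[-1,1]$ with respect to $\omega_\lambda(x)=(1-x^2)^{\lambda-1/2}$, normalized by $C_n^{(\lambda)}(1)=\frac{\Gamma(n+2\lambda)}{n!\,\Gamma(2\lambda)}$; $h_n^{(\lambda)}=\int_{-1}^1 C_n^{(\lambda)}(x)^2\omega_\lambda(x)\,dx$. With $C_{\mathbf{k}}^{(\lambda)}(\mathbf{x})=\prod_j C_{k_j}^{(\lambda)}(x_j)$, $\omega_\lambda(\mathbf{x})=\prod_j\omega_\lambda(x_j)$, $h_{\mathbf{k}}^{(\lambda)}=\prod_j h_{k_j}^{(\lambda)}$, the multivariate Gegenbauer coefficients of $f$ are $a_{\mathbf{k}}=\frac{1}{h_{\mathbf{k}}^{(\lambda)}}\int_{\Omega_d}f(\mathbf{x})C_{\mathbf{k}}^{(\lambda)}(\mathbf{x})\omega_\lambda(\mathbf{x})\,d\mathbf{x}$. $\mathcal{E}_\rho=\{z\in\mathbb{C}: z=\frac12(u+u^{-1}),\ |u|=\rho\}$ is the Bernstein ellipse, $L(\mathcal{E}_\rho)$ is the length of its circumference, and $L(\mathcal{E}_{\widehat{\boldsymbol{\rho}}})=\prod_j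 L(\mathcal{E}_{\widehat{\rho}_j})$. Constants: $\overline{D}_\rho^{(\lambda)}=\frac1\rho(1+\rho^{-2})^{\lambda-1}$ if $\lambda\ge1$ and $\frac1\rho(1-\rho^{-2})^{\lambda-1}$ if $0<\lambda<1$; $D_\rho^{(\lambda)}=\frac{\Gamma(\lambda)}{\rho}e^{1/12}(1+\rho^{-2})^{\lambda-1}$ if $\lambda\ge1$ and $\frac{\Gamma(\lambda)}{\rho}\exp\!\left(\frac1{12}+\frac{1-\lambda}{2\lambda}\right)(1-\rho^{-2})^{\lambda-1}$ if $0<\lambda<1$. Empty products equal $1$.
   Formalization: f is additionally assumed continuous on D_{h,ε} together with the poly-ellipse E_ρ̂, since E_ρ̂ can touch the boundary of the open region, where analyticity in D_{h,ε} alone does not define f or the maximum B̂_f. *)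

theory Defs
  imports "HOL-Analysis.Analysis" "HOL-Computational_Algebra.Polynomial"
begin

section \<open>Regions, ellipses and analyticity\<close>

definition cube :: "(real ^ 'd) set" where
  "cube = {x. \<forall>i. x $ i \<in> {-1..1}}"

text \<open>
  Points of the ellipse with foci \<open>0\<close>, \<open>s\<close> have constant sum of distances to the foci;
  the constant \<open>s + 2 * a\<close> is the value of that sum at the leftmost point \<open>- a\<close>.
\<close>

definition N_region :: "real \<Rightarrow> real \<Rightarrow> complex set" where
  "N_region s a = {z. cmod z + cmod (z - of_real s) < s + 2 * a}"

definition D_region :: "real \<Rightarrow> real \<Rightarrow> (complex ^ 'd) set" where
  "D_region h eps =
     {z. (\<Sum>i\<in>UNIV. (z $ i)\<^sup>2) \<in> N_region (real CARD('d)) (h\<^sup>2 + real CARD('d) * eps)}"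

text \<open>
  The analogue of \<open>analytic_on\<close> for several complex variables: every point has a neighbourhood
  on which \<open>f\<close> is complex differentiable, i.e. has a complex-linear Frechet derivative.
  (A \<open>has_derivative\<close> map is real-linear by definition, so homogeneity is all that is missing.)
\<close>

definition mv_analytic_on :: "(complex ^ 'd \<Rightarrow> complex) \<Rightarrow> (complex ^ 'd) set \<Rightarrow> bool" where
  "mv_analytic_on f S \<longleftrightarrow>
     (\<forall>z\<in>S. \<exists>e>0. \<forall>w\<in>ball z e. \<exists>f'.
        (f has_derivative f') (at w) \<and> (\<forall>c v. f' (c *s v) = c * f' v))"

definition bernstein_ellipse :: "real \<Rightarrow> complex set" where
  "bernstein_ellipse \<rho> = {z. \<exists>u. cmod u = \<rho> \<and> z = (u + inverse u) / 2}"

definition bernstein_curve :: "real \<Rightarrow> real \<Rightarrow> complex" where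
  "bernstein_curve \<rho> t =
     (let u = of_real \<rho> * exp (of_real t * \<i>) in (u + inverse u) / 2)"

text \<open>
  The length of the circumference is the arc length of \<open>bernstein_curve \<rho>\<close> over one period.
  For \<open>\<rho> = 1\<close> the ellipse degenerates to the segment \<open>[-1, 1]\<close>, traversed back and forth,
  so that the value is \<open>4\<close>, the limit of the perimeters as \<open>\<rho>\<close> tends to \<open>1\<close>.
\<close>

definition ellipse_length :: "real \<Rightarrow> real" where
  "ellipse_length \<rho> =
     integral {0..2 * pi} (\<lambda>t. norm (vector_derivative (bernstein_curve \<rho>) (at t)))"

definition poly_ellipse :: "real ^ 'd \<Rightarrow> (complex ^ 'd) set" where
  "poly_ellipse r = {z. \<forall>j. z $ j \<in> bernstein_ellipse (r $ j)}"

definition poly_ellipse_length :: "real ^ 'd \<Rightarrow> real" where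
  "poly_ellipse_length r = (\<Prod>j\<in>UNIV. ellipse_length (r $ j))"


section \<open>Gegenbauer polynomials and coefficients\<close>

definition gegenbauer_weight :: "real \<Rightarrow> real \<Rightarrow> real" where
  "gegenbauer_weight lam x = (1 - x\<^sup>2) powr (lam - 1 / 2)"

definition is_gegenbauer_family :: "real \<Rightarrow> (nat \<Rightarrow> real poly) \<Rightarrow> bool" where
  "is_gegenbauer_family lam C \<longleftrightarrow>
     (\<forall>n. degree (C n) = n) \<and>
     (\<forall>m n. m \<noteq> n \<longrightarrow>
        (LINT x:{-1..1}|lborel. poly (C m) x * poly (C n) x * gegenbauer_weight lam x) = 0) \<and>
     (\<forall>n. poly (C n) 1 = Gamma (real n + 2 * lam) / (fact n * Gamma (2 * lam)))"

definition gegenbauer :: "real \<Rightarrow> nat \<Rightarrow> real poly" where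
  "gegenbauer lam = (THE C. is_gegenbauer_family lam C)"

definition gegenbauer_h :: "real \<Rightarrow> nat \<Rightarrow> real" where
  "gegenbauer_h lam n =
     (LINT x:{-1..1}|lborel. (poly (gegenbauer lam n) x)\<^sup>2 * gegenbauer_weight lam x)"

definition mv_gegenbauer :: "real \<Rightarrow> nat ^ 'd \<Rightarrow> real ^ 'd \<Rightarrow> real" where
  "mv_gegenbauer lam k x = (\<Prod>j\<in>UNIV. poly (gegenbauer lam (k $ j)) (x $ j))"

definition mv_weight :: "real \<Rightarrow> real ^ 'd \<Rightarrow> real" where
  "mv_weight lam x = (\<Prod>j\<in>UNIV. gegenbauer_weight lam (x $ j))"

definition mv_gegenbauer_h :: "real \<Rightarrow> nat ^ 'd \<Rightarrow> real" where
  "mv_gegenbauer_h lam k = (\<Prod>j\<in>UNIV. gegenbauer_h lam (k $ j))"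

definition complex_vec :: "real ^ 'd \<Rightarrow> complex ^ 'd" where
  "complex_vec x = (\<chi> i. complex_of_real (x $ i))"

definition gegenbauer_coeff :: "real \<Rightarrow> (complex ^ 'd \<Rightarrow> complex) \<Rightarrow> nat ^ 'd \<Rightarrow> complex" where
  "gegenbauer_coeff lam f k =
     1 / of_real (mv_gegenbauer_h lam k) *
     (LINT x:cube|lborel. f (complex_vec x) * of_real (mv_gegenbauer lam k x) * of_real (mv_weight lam x))"


section \<open>Quantities in the coefficient bound\<close>

definition D_bar :: "real \<Rightarrow> real \<Rightarrow> real" where
  "D_bar lam \<rho> =
     (if lam \<ge> 1 then 1 / \<rho> * (1 + 1 / \<rho>\<^sup>2) powr (lam - 1)
      else 1 / \<rho> * (1 - 1 / \<rho>\<^sup>2) powr (lam - 1))"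

definition D_const :: "real \<Rightarrow> real \<Rightarrow> real" where
  "D_const lam \<rho> =
     (if lam \<ge> 1 then Gamma lam / \<rho> * exp (1 / 12) * (1 + 1 / \<rho>\<^sup>2) powr (lam - 1)
      else Gamma lam / \<rho> * exp (1 / 12 + (1 - lam) / (2 * lam)) * (1 - 1 / \<rho>\<^sup>2) powr (lam - 1))"

definition index_norm :: "nat ^ 'd \<Rightarrow> real" where
  "index_norm k = sqrt (\<Sum>j\<in>UNIV. (real (k $ j))\<^sup>2)"

text \<open>
  For the zero multi-index the ratios \<open>c\<^sub>j\<close> are \<open>0 / 0\<close>, which is \<open>0\<close> by the HOL convention.
\<close>

definition rho_hat :: "real \<Rightarrow> real \<Rightarrow> nat ^ 'd \<Rightarrow> real ^ 'd" where
  "rho_hat h eps k =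
     (\<chi> j. let c = real (k $ j) / index_norm k
           in sqrt ((c * h)\<^sup>2 + eps) + sqrt (1 + (c * h)\<^sup>2 + eps))"

text \<open>The supremum is a maximum when \<open>f\<close> is continuous on the compact set \<open>poly_ellipse r\<close>.\<close>

definition max_on_ellipse :: "(complex ^ 'd \<Rightarrow> complex) \<Rightarrow> real ^ 'd \<Rightarrow> real" where
  "max_on_ellipse f r = (SUP z\<in>poly_ellipse r. cmod (f z))"

end

theory Submission
  imports Defs "HOL-Complex_Analysis.Cauchy_Integral_Formula"
begin

text \<open>
  The Gegenbauer operator \<open>(1 - x\<^sup>2) y'' - (2\<lambda> + 1) x y'\<close> is self-adjoint for the weight and acts simply on the
  Chebyshev polynomials \<open>U\<^sub>m\<close>. Hence the Gegenbauer coefficients of \<open>U\<^sub>m\<close> satisfy a two-term recurrence and are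
  multiples of \<open>(1 - \<lambda>)\<^sub>j / j! B(n + j + 1, \<lambda>)\<close> when \<open>m = n + 2j\<close>, and \<open>0\<close> otherwise. Summing
  \<open>1 / (1 - 2xv + v\<^sup>2) = \<Sum> U\<^sub>m(x) v\<^sup>m\<close> and using Euler's integral, the \<open>n\<close>-th coefficient of the Cauchy kernel at
  \<open>z = (v + 1/v) / 2\<close> is at most \<open>2 |v|\<^sup>n\<^sup>+\<^sup>1 n! \<Gamma>(\<lambda>) / \<Gamma>(n + \<lambda>)\<close> times \<open>(1 \<plusminus> |v|\<^sup>2)\<^bsup>\<lambda>-1\<^esup>\<close>.

  Cauchy's formula on the Bernstein ellipse turns integration against the Gegenbauer density into
  integration against a kernel on the ellipse, one coordinate at a time. The factors \<open>k\<^sub>j\<^bsup>1-\<lambda>\<^esup>\<close> come from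
  log-convexity of \<open>\<Gamma>\<close>, the factor \<open>\<rho>\<close> to the power \<open>\<parallel>k\<parallel>\<close> from \<open>arsinh (c h) \<ge> c arsinh h\<close>. Where the polyellipse touches
  the boundary of the domain, \<open>f\<close> is replaced by its dilations \<open>f(s z)\<close>, \<open>s < 1\<close>, and \<open>s\<close> tends to \<open>1\<close>; where
  \<open>\<rho>\<^sub>i = 1\<close> (so \<open>k\<^sub>i = 0\<close>), the real variable is left alone and the length of the ellipse is at least \<open>\<pi> \<rho>\<^sub>i\<close>.
\<close>

section \<open>Gegenbauer polynomials\<close>

text \<open>With \<open>z = (v + 1/v) / 2\<close>, the factor \<open>1 / (z - x)\<close> of Cauchy's
  formula is \<open>2 v / (1 - 2 x v + v^2)\<close>, a multiple of the generating function of the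
  \<open>U_m\<close>. So only the Gegenbauer coefficients of the \<open>U_m\<close> are wanted, and
  f enters through its values on the ellipses alone. The radii come from squaring. The ellipse with
  foci -1, 1 and minor semi-axis \<open>sqrt b\<close> is mapped by squaring onto the ellipse with
  foci 0, 1 and leftmost point -b. A sum of d such points stays within the ellipse with foci 0, d
  whose leftmost point is minus the sum of the \<open>b_i\<close>. For
  \<open>b_i = (c_i h)^2 + eps\<close> this is the closure of the given region, as the
  \<open>c_i^2\<close> sum to at most 1. The obstacle is the degenerate ellipse of radius 1: there
  the Cauchy kernel is singular on the interval of integration, and
  \<open>(1 - |v|^2)^(lam - 1)\<close> blows up when lam < 1. A positive eps keeps all radii above
  1; for lam >= 1 the constants stay finite and the degenerate coordinates are treated
  apart.\<close>

lemma weight_integrable: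
  assumes "lam > 0"
  shows "set_integrable lborel {-1..1} (gegenbauer_weight lam)"
proof -
  have "((\<lambda>t. t powr (lam + 1/2 - 1) * (1 - t) powr (lam + 1/2 - 1)) has_integral Beta (lam + 1/2) (lam + 1/2)) {0..1}"
    using assms by (intro has_integral_Beta_real) auto
  \<comment> \<open>With t = (1 + x) / 2 one has 1 - x^2 = 4 t (1 - t), so the weight is a constant
    multiple of the Beta integrand with both parameters lam + 1/2.\<close>
  from has_integral_affinity[OF this[unfolded interval_cbox], of "1/2" "1/2"]
  have "(\<lambda>x. ((1 + x)/2) powr (lam - 1/2) * (1 - (1+x)/2) powr (lam - 1/2)) integrable_on ((\<lambda>x. 2 * x - 1) ` cbox 0 1)"
    by (auto simp: integrable_on_def field_simps)
  moreover have "(\<lambda>x. 2 * x - 1) ` cbox 0 1 = {-1..1::real}"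
    by (auto simp: image_iff intro!: bexI[of _ "(x+1)/2" for x] simp: field_simps)
  ultimately have "(\<lambda>x. ((1 + x)/2) powr (lam - 1/2) * (1 - (1+x)/2) powr (lam - 1/2)) integrable_on {-1..1}"
    by simp
  hence "(\<lambda>x. 4 powr (lam - 1/2) * (((1 + x)/2) powr (lam - 1/2) * (1 - (1+x)/2) powr (lam - 1/2))) integrable_on {-1..1}"
    by (rule integrable_on_mult_right)
  hence "gegenbauer_weight lam integrable_on {-1..1}"
  proof (rule integrable_eq)
    fix x :: real assume x: "x \<in> {-1..1}"
    have "4 powr (lam - 1/2) * (((1 + x)/2) powr (lam - 1/2) * (1 - (1+x)/2) powr (lam - 1/2))
        = (4 * ((1+x)/2 * (1 - (1+x)/2))) powr (lam - 1/2)"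
      by (simp only: powr_mult)
    also have "4 * ((1+x)/2 * (1 - (1+x)/2)) = 1 - x\<^sup>2"
      by (simp add: field_simps power2_eq_square)
    finally show "4 powr (lam - 1/2) * (((1 + x)/2) powr (lam - 1/2) * (1 - (1+x)/2) powr (lam - 1/2)) = gegenbauer_weight lam x"
      by (simp add: gegenbauer_weight_def)
  qed
  hence "gegenbauer_weight lam absolutely_integrable_on {-1..1}"
    by (rule nonnegative_absolutely_integrable_1) (auto simp: gegenbauer_weight_def)
  thus ?thesis
    unfolding set_integrable_def
    by (subst (asm) integrable_completion) (auto simp: gegenbauer_weight_def)
qed

lemma bounded_mult_weight_integrable:
  fixes g :: "real \<Rightarrow> 'a::{banach, second_countable_topology, real_normed_algebra_1}"
  assumes lam: "lam > 0" and [measurable]: "g \<in> borel_measurable borel"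
    and B: "\<And>x. x \<in> {-1..1} \<Longrightarrow> norm (g x) \<le> B"
  shows "set_integrable lborel {-1..1} (\<lambda>x. g x * of_real (gegenbauer_weight lam x))"
  unfolding set_integrable_def
proof (rule Bochner_Integration.integrable_bound)
  show "integrable lborel (\<lambda>x. B * (indicator {-1..1} x *\<^sub>R gegenbauer_weight lam x))"
    using weight_integrable[OF lam] unfolding set_integrable_def by (rule integrable_mult_right)
  have [measurable]: "gegenbauer_weight lam \<in> borel_measurable borel"
    unfolding gegenbauer_weight_def by measurable
  show "(\<lambda>x. indicator {-1..1} x *\<^sub>R (g x * of_real (gegenbauer_weight lam x))) \<in> borel_measurable lborel"
    by measurable
  show "AE x in lborel. norm (indicator {-1..1} x *\<^sub>R (g x * of_real (gegenbauer_weight lam x)))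
      \<le> norm (B * (indicator {-1..1} x *\<^sub>R gegenbauer_weight lam x))"
  proof (rule AE_I2)
    fix x :: real
    have "norm (g x * of_real (gegenbauer_weight lam x)) \<le> \<bar>B * gegenbauer_weight lam x\<bar>" if x: "x \<in> {-1..1}"
    proof -
      have "norm (g x * of_real (gegenbauer_weight lam x)) \<le> norm (g x) * \<bar>gegenbauer_weight lam x\<bar>"
        by (metis norm_mult_ineq norm_of_real)
      also have "\<dots> \<le> B * \<bar>gegenbauer_weight lam x\<bar>" by (intro mult_right_mono B x) auto
      finally show ?thesis by (simp add: gegenbauer_weight_def)
    qed
    thus "norm (indicator {-1..1} x *\<^sub>R (g x * of_real (gegenbauer_weight lam x)))
      \<le> norm (B * (indicator {-1..1} x *\<^sub>R gegenbauer_weight lam x))"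
      by (auto simp: indicator_def)
  qed
qed

lemma poly_weight_integrable:
  assumes "lam > 0"
  shows "set_integrable lborel {-1..1} (\<lambda>x. poly p x * gegenbauer_weight lam x)"
proof -
  have "continuous_on {-1..1} (poly p)" by (intro continuous_intros)
  hence "bounded (poly p ` {-1..1})"
    by (simp add: compact_continuous_image compact_imp_bounded)
  then obtain B where "\<And>x. x \<in> {-1..1} \<Longrightarrow> norm (poly p x) \<le> B" unfolding bounded_iff by blast
  moreover have "poly p \<in> borel_measurable borel"
    by (intro borel_measurable_continuous_onI continuous_intros)
  ultimately show ?thesis using bounded_mult_weight_integrable[OF assms, of "poly p" B] by simp
qed

section \<open>The weight functional and the self-adjoint Gegenbauer operator\<close>

definition weight_functional :: "real \<Rightarrow> real poly \<Rightarrow> real" where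
  "weight_functional lam p = (LINT x:{-1..1}|lborel. poly p x * gegenbauer_weight lam x)"

lemma weight_functional_add:
  "lam > 0 \<Longrightarrow> weight_functional lam (p + q) = weight_functional lam p + weight_functional lam q"
  unfolding weight_functional_def poly_add distrib_right
  by (intro set_integral_add poly_weight_integrable)

lemma weight_functional_smult [simp]:
  "weight_functional lam (smult c p) = c * weight_functional lam p"
  by (simp add: weight_functional_def mult.assoc)

lemma weight_functional_minus [simp]: "weight_functional lam (- p) = - weight_functional lam p"
  using weight_functional_smult[of lam "-1" p] by simp

lemma weight_functional_diff:
  "lam > 0 \<Longrightarrow> weight_functional lam (p - q) = weight_functional lam p - weight_functional lam q"
  using weight_functional_add[of lam p "- q"] by simp

lemma weight_functional_0 [simp]: "weight_functional lam 0 = 0"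
  by (simp add: weight_functional_def)

text \<open>The weight is positive on the open interval and p has finitely many roots; an integral
  equal to zero would therefore make the interval a null set.\<close>

lemma weight_functional_square_pos:
  assumes lam: "lam > 0" and p: "p \<noteq> 0"
  shows "weight_functional lam (p * p) > 0"
proof -
  have nonneg: "weight_functional lam (p * p) \<ge> 0"
    unfolding weight_functional_def set_lebesgue_integral_def
    by (intro Bochner_Integration.integral_nonneg) (auto simp: gegenbauer_weight_def)
  have "weight_functional lam (p * p) \<noteq> 0"
  proof
    assume "weight_functional lam (p * p) = 0"
    moreover have "integrable lborel (\<lambda>x. indicator {-1..1} x *\<^sub>R (poly (p * p) x * gegenbauer_weight lam x))"
      using poly_weight_integrable[OF lam, of "p * p"] by (simp add: set_integrable_def)
    ultimately have AE1: "AE x in lborel. indicator {-1..1} x *\<^sub>R (poly (p * p) x * gegenbauer_weight lam x) = 0"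
      unfolding weight_functional_def set_lebesgue_integral_def
      by (subst (asm) integral_nonneg_eq_0_iff_AE) (auto simp: gegenbauer_weight_def)
    have "finite {x. poly p x = 0}" using p by (rule poly_roots_finite)
    hence "countable {x. poly p x = 0}" by (rule countable_finite)
    hence "AE x in lborel. poly p x \<noteq> 0"
      using AE_not_in[of "{x. poly p x = 0}" lborel] countable_imp_null_set_lborel by auto
    with AE1 have "AE x in lborel. x \<notin> {-1<..<1::real}"
    proof eventually_elim
      case (elim x)
      show ?case
      proof
        assume "x \<in> {-1<..<1}"
        hence "(1 - x\<^sup>2) > 0" by (auto simp: abs_square_less_1)
        with elim \<open>x \<in> {-1<..<1}\<close> show False
          by (auto simp: gegenbauer_weight_def)
      qed
    qed
    hence "{-1<..<1::real} \<in> null_sets lborel"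
      by (subst AE_iff_null_sets) auto
    thus False by (auto simp: null_sets_def)
  qed
  with nonneg show ?thesis by simp
qed

definition gegenbauer_op :: "real \<Rightarrow> real poly \<Rightarrow> real poly" where
  "gegenbauer_op lam p = [:1, 0, -1:] * pderiv (pderiv p) - smult (2 * lam + 1) ([:0, 1:] * pderiv p)"

text \<open>In divergence form, weight times operator is the derivative of
  \<open>(1 - x^2)^(lam + 1/2) p'\<close>. The boundary term F vanishes at both endpoints, and the
  right-hand side is symmetric in p and q, which gives self-adjointness.\<close>

lemma gegenbauer_op_by_parts:
  assumes lam: "lam > 0"
  shows "weight_functional lam (gegenbauer_op lam p * q)
       = - weight_functional lam ([:1, 0, -1:] * pderiv p * pderiv q)"
proof -
  define F where "F = (\<lambda>x. (1 - x\<^sup>2) powr (lam + 1/2) * poly (pderiv p) x * poly q x)"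
  define r where "r = gegenbauer_op lam p * q + [:1, 0, -1:] * pderiv p * pderiv q"
  have "((\<lambda>x. poly r x * gegenbauer_weight lam x) has_integral (F 1 - F (-1))) {-1..1}"
  proof (rule fundamental_theorem_of_calculus_interior)
    \<comment> \<open>The version with derivatives in the interior only is used because for lam <
      1/2 the derivative of F may be unbounded at the endpoints, while F stays continuous
      there.\<close>
    show "continuous_on {-1..1} F"
      unfolding F_def using lam
      by (intro continuous_intros continuous_on_powr') (auto simp: abs_square_le_1)
    fix x :: real assume x: "x \<in> {-1<..<1}"
    hence pos: "1 - x\<^sup>2 > 0" by (auto simp: abs_square_less_1)
    have e: "(1 - x\<^sup>2) powr (lam + 1/2) = (1 - x\<^sup>2) * (1 - x\<^sup>2) powr (lam - 1/2)"
    proof -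
      have "(1 - x\<^sup>2) powr (lam + 1/2) = (1 - x\<^sup>2) powr (1 + (lam - 1/2))" by (rule arg_cong) simp
      also have "\<dots> = (1 - x\<^sup>2) * (1 - x\<^sup>2) powr (lam - 1/2)"
        using pos by (subst powr_add) auto
      finally show ?thesis .
    qed
    have d1: "((\<lambda>x. (1 - x\<^sup>2) powr (lam + 1/2)) has_real_derivative
       (lam + 1/2) * (1 - x\<^sup>2) powr (lam - 1/2) * (- 2 * x)) (at x)"
      using pos by (auto intro!: derivative_eq_intros)
    have "(F has_real_derivative (poly r x * gegenbauer_weight lam x)) (at x)"
      unfolding F_def
      by (rule DERIV_cong[OF DERIV_mult[OF DERIV_mult[OF d1 poly_DERIV] poly_DERIV]])
         (unfold e gegenbauer_weight_def, simp add: r_def gegenbauer_op_def algebra_simps power2_eq_square)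
    thus "(F has_vector_derivative (poly r x * gegenbauer_weight lam x)) (at x)"
      by (simp add: has_real_derivative_iff_has_vector_derivative)
  qed auto
  hence "integral {-1..1} (\<lambda>x. poly r x * gegenbauer_weight lam x) = 0"
    using lam by (auto simp: F_def)
  hence "weight_functional lam r = 0"
    unfolding weight_functional_def
    by (subst set_borel_integral_eq_integral) (use poly_weight_integrable[OF lam] in auto)
  thus ?thesis by (simp add: r_def weight_functional_add lam)
qed

lemma gegenbauer_op_selfadjoint:
  assumes "lam > 0"
  shows "weight_functional lam (gegenbauer_op lam p * q) = weight_functional lam (p * gegenbauer_op lam q)"
proof -
  have "[:1, 0, -1:] * pderiv p * pderiv q = [:1, 0, -1:] * pderiv q * pderiv p"
    by (simp only: mult_ac)
  thus ?thesis
    using gegenbauer_op_by_parts[OF assms, of p q] gegenbauer_op_by_parts[OF assms, of q p]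
    by (simp only: mult.commute[of p])
qed

section \<open>Explicit polynomials, expanded at the endpoint 1\<close>

definition gegenbauer_coeff_at_1 :: "real \<Rightarrow> nat \<Rightarrow> nat \<Rightarrow> real" where
  "gegenbauer_coeff_at_1 lam n i = pochhammer (2 * lam) n / fact n *
     (\<Prod>l<i. (real n - real l) * (real n + real l + 2 * lam) / ((real l + 1) * (2 * real l + 2 * lam + 1)))"

lemma gegenbauer_coeff_at_1_Suc:
  assumes "lam > 0"
  shows "(real i + 1) * (2 * real i + 2 * lam + 1) * gegenbauer_coeff_at_1 lam n (Suc i)
       = (real n - real i) * (real n + real i + 2 * lam) * gegenbauer_coeff_at_1 lam n i"
proof -
  have "2 * real i + 2 * lam + 1 \<noteq> 0" using assms by (simp add: add_pos_nonneg add_nonneg_pos less_imp_neq)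
  moreover have "real i + 1 \<noteq> 0" by simp
  ultimately show ?thesis
    unfolding gegenbauer_coeff_at_1_def prod.lessThan_Suc by (simp add: divide_simps)
qed

lemma gegenbauer_coeff_at_1_eq_0:
  assumes "i > n"
  shows "gegenbauer_coeff_at_1 lam n i = 0"
  unfolding gegenbauer_coeff_at_1_def using assms
  by (auto intro!: bexI[of _ n])

definition gegenbauer_at_1 :: "real \<Rightarrow> nat \<Rightarrow> real poly" where
  "gegenbauer_at_1 lam n = (\<Sum>i\<le>n. monom (gegenbauer_coeff_at_1 lam n i) i)"

lemma coeff_gegenbauer_at_1: "coeff (gegenbauer_at_1 lam n) i = gegenbauer_coeff_at_1 lam n i"
  unfolding gegenbauer_at_1_def
  by (cases "i \<le> n") (auto simp: coeff_sum coeff_monom if_distrib cong: if_cong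
        simp: gegenbauer_coeff_at_1_eq_0)

text \<open>The classical formula \<open>C_n(x) = (2 lam)_n / n! 2F1(-n, n + 2 lam; lam + 1/2; (1 -
  x) / 2)\<close>; the Taylor expansion at 1 makes the normalisation the constant
  coefficient.\<close>

definition gegenbauer_poly :: "real \<Rightarrow> nat \<Rightarrow> real poly" where
  "gegenbauer_poly lam n = pcompose (gegenbauer_at_1 lam n) [:-1, 1:]"

text \<open>This is the eigenvalue equation of \<open>gegenbauer_op\<close> after substituting x = 1
  + t, where 1 - x^2 = - 2 t - t^2. Comparing coefficients of t^i leaves exactly the two-term
  recurrence \<open>gegenbauer_coeff_at_1_Suc\<close>.\<close>

lemma gegenbauer_at_1_ode:
  assumes "lam > 0"
  shows "[:0, -2, -1:] * pderiv (pderiv (gegenbauer_at_1 lam n))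
     - smult (2 * lam + 1) ([:1, 1:] * pderiv (gegenbauer_at_1 lam n))
     = smult (- real n * (real n + 2 * lam)) (gegenbauer_at_1 lam n)" (is "?L = ?R")
proof (rule poly_eqI)
  fix i
  define y where "y = gegenbauer_coeff_at_1 lam n"
  have rec: "(real i + 1) * (2 * real i + 2 * lam + 1) * y (Suc i)
       = (real n - real i) * (real n + real i + 2 * lam) * y i" for i
    unfolding y_def by (rule gegenbauer_coeff_at_1_Suc[OF assms])
  have cf: "coeff (gegenbauer_at_1 lam n) i = y i" for i by (simp add: y_def coeff_gegenbauer_at_1)
  have "coeff ?L i = - ((real i + 1) * (2 * real i + 2 * lam + 1) * y (Suc i))
      - (real i * (real i - 1) + (2 * lam + 1) * real i) * y i"
  proof -
    consider "i = 0" | "i = 1" | j where "i = Suc (Suc j)"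
      by (metis One_nat_def not0_implies_Suc)
    thus ?thesis
      by cases (simp_all add: coeff_pderiv cf algebra_simps coeff_pCons eval_nat_numeral)
  qed
  also have "\<dots> = coeff ?R i"
    unfolding rec by (simp add: cf algebra_simps)
  finally show "coeff ?L i = coeff ?R i" .
qed

lemma gegenbauer_op_gegenbauer_poly:
  assumes "lam > 0"
  shows "gegenbauer_op lam (gegenbauer_poly lam n) = smult (- real n * (real n + 2 * lam)) (gegenbauer_poly lam n)"
proof (rule poly_eq_poly_eq_iff[THEN iffD1, OF ext])
  fix x :: real
  have "poly ([:0, -2, -1:] * pderiv (pderiv (gegenbauer_at_1 lam n))
     - smult (2 * lam + 1) ([:1, 1:] * pderiv (gegenbauer_at_1 lam n))) (x - 1)
     = poly (smult (- real n * (real n + 2 * lam)) (gegenbauer_at_1 lam n)) (x - 1)"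
    by (simp only: gegenbauer_at_1_ode[OF assms])
  thus "poly (gegenbauer_op lam (gegenbauer_poly lam n)) x =
        poly (smult (- real n * (real n + 2 * lam)) (gegenbauer_poly lam n)) x"
    by (simp add: gegenbauer_op_def gegenbauer_poly_def pderiv_pcompose poly_pcompose pderiv_pCons algebra_simps)
qed

text \<open>The two Pochhammer symbols in the numerator join to \<open>(2 lam)_(2n)\<close>, and the
  duplication formula splits off the \<open>(lam + 1/2)_n\<close> of the denominator.\<close>

lemma gegenbauer_coeff_at_1_lead:
  assumes "lam > 0"
  shows "gegenbauer_coeff_at_1 lam n n = 2 ^ n * pochhammer lam n / fact n"
proof -
  have p1: "(\<Prod>l<n. real n - real l) = fact n"
    by (simp add: fact_prod_rev of_nat_diff atLeast0LessThan)
  have p2: "(\<Prod>l<n. real n + real l + 2 * lam) = pochhammer (2 * lam + real n) n"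
    by (simp add: pochhammer_prod add_ac atLeast0LessThan)
  have p3: "(\<Prod>l<n. real l + 1) = (fact n :: real)"
    by (simp add: fact_prod_Suc add_ac atLeast0LessThan)
  have p4: "(\<Prod>l<n. 2 * real l + 2 * lam + 1) = 2 ^ n * pochhammer (lam + 1/2) n"
  proof -
    have "(\<Prod>l<n. 2 * real l + 2 * lam + 1) = (\<Prod>l<n. 2 * (lam + 1/2 + real l))"
      by (intro prod.cong) (auto simp: algebra_simps)
    also have "\<dots> = 2 ^ n * pochhammer (lam + 1/2) n"
      using prod.distrib[of "\<lambda>_. 2" "\<lambda>l. lam + 1/2 + real l" "{..<n}"]
      unfolding pochhammer_prod atLeast0LessThan by (simp only: prod_constant card_lessThan of_nat_id)
    finally show ?thesis .
  qed
  have nz: "pochhammer (lam + 1/2) n \<noteq> 0" using assms by (intro less_imp_neq[symmetric] pochhammer_pos) auto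
  have "gegenbauer_coeff_at_1 lam n n = pochhammer (2 * lam) n * pochhammer (2 * lam + real n) n / (fact n * 2 ^ n * pochhammer (lam + 1/2) n)"
    by (simp only: gegenbauer_coeff_at_1_def prod_dividef prod.distrib p1 p2 p3 p4) simp
  also have "pochhammer (2 * lam) n * pochhammer (2 * lam + real n) n = pochhammer (2 * lam) (2 * n)"
    by (simp only: pochhammer_product'[symmetric] mult_2[of n])
  also have "\<dots> = 2 ^ (2 * n) * pochhammer lam n * pochhammer (lam + 1/2) n"
    by (simp only: pochhammer_double of_nat_power of_nat_numeral)
  also have "\<dots> / (fact n * 2 ^ n * pochhammer (lam + 1/2) n) = 2 ^ n * pochhammer lam n / fact n"
    using nz by (simp add: mult_2 power_add)
  finally show ?thesis .
qed

lemma
  assumes "lam > 0"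
  shows degree_gegenbauer_poly: "degree (gegenbauer_poly lam n) = n"
    and lead_coeff_gegenbauer_poly: "coeff (gegenbauer_poly lam n) n = 2 ^ n * pochhammer lam n / fact n"
    and poly_gegenbauer_poly_1: "poly (gegenbauer_poly lam n) 1 = Gamma (real n + 2 * lam) / (fact n * Gamma (2 * lam))"
proof -
  have pos: "gegenbauer_coeff_at_1 lam n n \<noteq> 0"
    using assms pochhammer_pos[of lam n] by (simp add: gegenbauer_coeff_at_1_lead)
  have dg: "degree (gegenbauer_at_1 lam n) = n"
  proof (rule antisym)
    show "degree (gegenbauer_at_1 lam n) \<le> n"
      by (rule degree_le) (auto simp: coeff_gegenbauer_at_1 gegenbauer_coeff_at_1_eq_0)
    show "n \<le> degree (gegenbauer_at_1 lam n)"
      using pos by (intro le_degree) (simp add: coeff_gegenbauer_at_1)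
  qed
  show d: "degree (gegenbauer_poly lam n) = n"
    using degree_pcompose[of "gegenbauer_at_1 lam n" "[:-1, 1:]"] by (simp add: gegenbauer_poly_def dg)
  have "lead_coeff (gegenbauer_poly lam n) = lead_coeff (gegenbauer_at_1 lam n)"
    unfolding gegenbauer_poly_def by (subst lead_coeff_comp) auto
  thus "coeff (gegenbauer_poly lam n) n = 2 ^ n * pochhammer lam n / fact n"
    by (simp add: d dg coeff_gegenbauer_at_1 gegenbauer_coeff_at_1_lead assms)
  have "poly (gegenbauer_poly lam n) 1 = coeff (gegenbauer_at_1 lam n) 0"
    by (simp add: gegenbauer_poly_def poly_pcompose poly_0_coeff_0)
  also have "\<dots> = pochhammer (2 * lam) n / fact n"
    by (simp add: coeff_gegenbauer_at_1 gegenbauer_coeff_at_1_def)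
  also have "pochhammer (2 * lam) n = Gamma (2 * lam + real n) / Gamma (2 * lam)"
    using assms by (intro pochhammer_Gamma) (auto elim!: nonpos_Ints_cases)
  finally show "poly (gegenbauer_poly lam n) 1 = Gamma (real n + 2 * lam) / (fact n * Gamma (2 * lam))"
    by (simp add: add_ac)
qed

section \<open>Orthogonality and uniqueness of the Gegenbauer family\<close>

lemma gegenbauer_poly_orthogonal:
  assumes lam: "lam > 0" and "m \<noteq> n"
  shows "weight_functional lam (gegenbauer_poly lam m * gegenbauer_poly lam n) = 0"
proof -
  \<comment> \<open>Distinct degrees have distinct eigenvalues, so self-adjointness forces the two
    eigenvectors to be orthogonal.\<close>
  have "real m * (real m + 2 * lam) \<noteq> real n * (real n + 2 * lam)"
  proof
    assume "real m * (real m + 2 * lam) = real n * (real n + 2 * lam)"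
    hence "(real m - real n) * (real m + real n + 2 * lam) = 0" by (simp add: algebra_simps)
    with assms show False by auto
  qed
  moreover have "real m * (real m + 2 * lam) * weight_functional lam (gegenbauer_poly lam m * gegenbauer_poly lam n)
     = real n * (real n + 2 * lam) * weight_functional lam (gegenbauer_poly lam m * gegenbauer_poly lam n)"
    using gegenbauer_op_selfadjoint[OF lam, of "gegenbauer_poly lam m" "gegenbauer_poly lam n"]
    by (simp add: gegenbauer_op_gegenbauer_poly lam)
  ultimately show ?thesis by (metis mult_cancel_right)
qed

text \<open>Only the first \<open>n\<close> members of the family are used, so that the lemma also applies within an induction.\<close>

lemma orthogonal_to_smaller_degree:
  assumes lam: "lam > 0" and deg: "\<And>m. m < n \<Longrightarrow> degree (P m) = m \<and> P m \<noteq> 0"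
    and orth: "\<And>m. m < n \<Longrightarrow> weight_functional lam (P m * q) = 0"
    and p: "p = 0 \<or> degree p < n"
  shows "weight_functional lam (p * q) = 0"
  using p
proof (induction "degree p" arbitrary: p rule: less_induct)
  case less
  show ?case
  proof (cases "p = 0")
    case False
    define m where "m = degree p"
    have m: "m < n" using less.prems False by (auto simp: m_def)
    define c where "c = lead_coeff p / lead_coeff (P m)"
    define r where "r = p - smult c (P m)"
    have "lead_coeff (P m) \<noteq> 0" using conjunct2[OF deg[OF m]] by simp
    hence nz: "coeff (P m) m \<noteq> 0" unfolding conjunct1[OF deg[OF m]] .
    have "r = 0 \<or> degree r < m"
    proof (cases "r = 0")
      case nz': False
      have "degree r \<le> m"
        unfolding r_def using deg[OF m] by (intro degree_diff_le) (auto simp: m_def intro: order_trans[OF degree_smult_le])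
      moreover have "coeff r m = 0"
        using nz deg[OF m] by (simp add: r_def c_def m_def)
      ultimately show ?thesis using nz' by (metis le_neq_implies_less leading_coeff_0_iff)
    qed simp
    hence "weight_functional lam (r * q) = 0"
      using less.hyps[of r] m by (cases "r = 0") (auto simp: m_def)
    moreover have "p = r + smult c (P m)" by (simp add: r_def)
    ultimately show ?thesis
      using orth[OF m] lam by (simp add: distrib_right weight_functional_add)
  qed simp
qed

lemma gegenbauer_poly_orthogonal_smaller:
  assumes lam: "lam > 0" and "p = 0 \<or> degree p < n"
  shows "weight_functional lam (p * gegenbauer_poly lam n) = 0"
proof (rule orthogonal_to_smaller_degree[OF lam _ _ assms(2), of "gegenbauer_poly lam"])
  fix m assume m: "m < n"
  show "degree (gegenbauer_poly lam m) = m \<and> gegenbauer_poly lam m \<noteq> 0"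
    using lead_coeff_gegenbauer_poly[OF lam, of m] pochhammer_pos[of lam m] lam
    by (auto simp: degree_gegenbauer_poly)
  show "weight_functional lam (gegenbauer_poly lam m * gegenbauer_poly lam n) = 0"
    using m by (intro gegenbauer_poly_orthogonal lam) auto
qed

lemma is_gegenbauer_family_gegenbauer_poly:
  assumes lam: "lam > 0"
  shows "is_gegenbauer_family lam (gegenbauer_poly lam)"
  using gegenbauer_poly_orthogonal[OF lam]
  by (auto simp: is_gegenbauer_family_def degree_gegenbauer_poly lam poly_gegenbauer_poly_1 weight_functional_def)

text \<open>Once the smaller members are identified, q has degree below n and is orthogonal to all
  of them, hence to itself, so q = 0. The value at 1, which is nonzero, then fixes the scalar c.
  This is what gives the definite description in \<open>gegenbauer\<close> its meaning.\<close>

lemma is_gegenbauer_family_unique: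
  assumes lam: "lam > 0" and P: "is_gegenbauer_family lam P"
  shows "P n = gegenbauer_poly lam n"
proof (induction n rule: less_induct)
  case (less n)
  define G where "G = gegenbauer_poly lam"
  have deg: "degree (P n) = n" "degree (G n) = n" for n
    using P by (auto simp: is_gegenbauer_family_def G_def degree_gegenbauer_poly lam)
  have val: "poly (P n) 1 = poly (G n) 1" for n
    using P by (simp add: is_gegenbauer_family_def G_def poly_gegenbauer_poly_1 lam)
  have G1: "poly (G n) 1 \<noteq> 0" for n
    using lam by (auto simp: G_def poly_gegenbauer_poly_1 Gamma_eq_zero_iff elim!: nonpos_Ints_cases)
  have nz: "G n \<noteq> 0" "P n \<noteq> 0" for n using G1[of n] val[of n] by auto
  have orth: "weight_functional lam (P m * P n) = 0" if "m \<noteq> n" for m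
    using P that by (simp add: is_gegenbauer_family_def weight_functional_def)
  define c where "c = lead_coeff (P n) / lead_coeff (G n)"
  define q where "q = P n - smult c (G n)"
  have q: "q = 0 \<or> degree q < n"
  proof (cases "q = 0")
    case nz': False
    have "degree q \<le> n"
      unfolding q_def using deg by (intro degree_diff_le) (auto intro: order_trans[OF degree_smult_le])
    moreover have "lead_coeff (G n) \<noteq> 0" using nz by simp
    hence "coeff (G n) n \<noteq> 0" unfolding deg .
    hence "coeff q n = 0"
      by (simp add: q_def c_def deg)
    ultimately show ?thesis using nz' by (metis le_neq_implies_less leading_coeff_0_iff)
  qed simp
  have "weight_functional lam (G m * q) = 0" if m: "m < n" for m
  proof -
    have "weight_functional lam (G m * P n) = 0" using less[OF m] orth[of m] m by (simp add: G_def)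
    moreover have "weight_functional lam (G m * G n) = 0"
      unfolding G_def using m by (intro gegenbauer_poly_orthogonal lam) auto
    ultimately show ?thesis by (simp add: q_def right_diff_distrib weight_functional_diff lam)
  qed
  hence "weight_functional lam (q * q) = 0"
    using nz by (intro orthogonal_to_smaller_degree[OF lam _ _ q, of G]) (auto simp: deg)
  hence "q = 0" using weight_functional_square_pos[OF lam, of q] by auto
  hence e: "P n = smult c (G n)" by (simp add: q_def)
  hence "c = 1" using val[of n] G1[of n] by simp
  thus ?case using e by (simp add: G_def)
qed

lemma gegenbauer_eq:
  assumes "lam > 0"
  shows "gegenbauer lam = gegenbauer_poly lam"
  unfolding gegenbauer_def
  using is_gegenbauer_family_gegenbauer_poly[OF assms] is_gegenbauer_family_unique[OF assms]
  by (intro the_equality ext)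

section \<open>Gegenbauer coefficients of Chebyshev polynomials\<close>

text \<open>\<open>chebyshev_U_pred m\<close> is \<open>U\<^sub>m\<^sub>-\<^sub>1\<close>; the shift makes the recurrence start at \<open>0\<close>.\<close>

fun chebyshev_U_pred :: "nat \<Rightarrow> real poly" where
  "chebyshev_U_pred 0 = 0"
| "chebyshev_U_pred (Suc 0) = 1"
| "chebyshev_U_pred (Suc (Suc n)) = [:0, 2:] * chebyshev_U_pred (Suc n) - chebyshev_U_pred n"

lemma degree_chebyshev_U_pred: "degree (chebyshev_U_pred n) \<le> n - 1"
  and coeff_chebyshev_U_pred: "coeff (chebyshev_U_pred (Suc n)) n = 2 ^ n"
proof -
  have "degree (chebyshev_U_pred n) \<le> n - 1 \<and> degree (chebyshev_U_pred (Suc n)) \<le> n \<and>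
      coeff (chebyshev_U_pred (Suc n)) n = 2 ^ n" for n
  proof (induction n)
    case (Suc n)
    have "degree (chebyshev_U_pred (Suc (Suc n))) \<le> Suc n"
    proof -
      have "degree ([:0, 2:] * chebyshev_U_pred (Suc n)) \<le> Suc n"
        using Suc.IH by (intro order_trans[OF degree_mult_le]) simp
      thus ?thesis unfolding chebyshev_U_pred.simps
        by (intro degree_diff_le) (use Suc.IH in auto)
    qed
    moreover have "coeff (chebyshev_U_pred n) (Suc n) = 0"
      using Suc.IH by (intro coeff_eq_0) auto
    hence "coeff (chebyshev_U_pred (Suc (Suc n))) (Suc n) = 2 ^ Suc n"
      using Suc.IH by simp
    ultimately show ?case using Suc.IH by simp
  qed auto
  thus "degree (chebyshev_U_pred n) \<le> n - 1" "coeff (chebyshev_U_pred (Suc n)) n = 2 ^ n" by blast+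
qed

text \<open>The two identities are proved together because the first one at n + 1 uses both at n.
  Together they eliminate the derivative of \<open>U_(n-1)\<close> and express
  \<open>(1 - x^2) U_n'\<close> through \<open>U_n\<close> and \<open>U_(n-1)\<close>.\<close>

lemma
  shows chebyshev_U_pred_deriv1:
    "x * poly (pderiv (chebyshev_U_pred (Suc n))) x - poly (pderiv (chebyshev_U_pred n)) x
       = real n * poly (chebyshev_U_pred (Suc n)) x"
  and chebyshev_U_pred_deriv2:
    "poly (pderiv (chebyshev_U_pred (Suc n))) x - x * poly (pderiv (chebyshev_U_pred n)) x
       = (real n + 1) * poly (chebyshev_U_pred n) x"
proof (induction n)
  case (Suc n)
  define e0 e1 d0 d1 where "e0 = poly (chebyshev_U_pred n) x" and "e1 = poly (chebyshev_U_pred (Suc n)) x"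
    and "d0 = poly (pderiv (chebyshev_U_pred n)) x" and "d1 = poly (pderiv (chebyshev_U_pred (Suc n))) x"
  have e2: "poly (chebyshev_U_pred (Suc (Suc n))) x = 2 * x * e1 - e0"
    by (simp add: e0_def e1_def)
  have d2: "poly (pderiv (chebyshev_U_pred (Suc (Suc n)))) x = 2 * e1 + 2 * x * d1 - d0"
    by (simp add: e0_def e1_def d0_def d1_def pderiv_diff pderiv_mult pderiv_pCons pderiv_smult)
  have IH: "x * d1 - d0 = real n * e1" "d1 - x * d0 = (real n + 1) * e0"
    using Suc by (simp_all add: e0_def e1_def d0_def d1_def)
  show "x * poly (pderiv (chebyshev_U_pred (Suc (Suc n)))) x - poly (pderiv (chebyshev_U_pred (Suc n))) x
       = real (Suc n) * poly (chebyshev_U_pred (Suc (Suc n))) x"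
    unfolding e2 d2 d1_def[symmetric] using IH by (simp add: algebra_simps) algebra
  show "poly (pderiv (chebyshev_U_pred (Suc (Suc n)))) x - x * poly (pderiv (chebyshev_U_pred (Suc n))) x
       = (real (Suc n) + 1) * poly (chebyshev_U_pred (Suc n)) x"
    unfolding e2 d2 d1_def[symmetric] e1_def[symmetric] using IH by (simp add: algebra_simps)
qed auto

text \<open>The difference \<open>U_(n+1) - U_(n-1)\<close> is twice the Chebyshev polynomial
  \<open>T_(n+1)\<close>, whose derivative is a multiple of \<open>U_n\<close>. The operator thus
  needs only one derivative of \<open>U_n\<close>, and the result closes up in the same two
  polynomials.\<close>

lemma gegenbauer_op_chebyshev:
  "gegenbauer_op lam (chebyshev_U_pred (Suc (Suc n)) - chebyshev_U_pred n)
   = smult (- (real n + 1) * (real n + 1 + 2 * lam)) (chebyshev_U_pred (Suc (Suc n)))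
   + smult ((real n + 1) * (real n + 1 - 2 * lam)) (chebyshev_U_pred n)"
proof -
  define U where "U = chebyshev_U_pred"
  have U2: "poly (U (Suc (Suc n))) x = 2 * x * poly (U (Suc n)) x - poly (U n) x" for x
    by (simp add: U_def)
  have "pderiv (U (Suc (Suc n)) - U n) = smult (2 * (real n + 1)) (U (Suc n))"
  proof (rule poly_eq_poly_eq_iff[THEN iffD1, OF ext])
    fix x
    have "poly (pderiv (U (Suc (Suc n)))) x = 2 * poly (U (Suc n)) x + 2 * x * poly (pderiv (U (Suc n))) x - poly (pderiv (U n)) x"
      by (simp add: U_def pderiv_diff pderiv_mult pderiv_pCons pderiv_smult)
    thus "poly (pderiv (U (Suc (Suc n)) - U n)) x = poly (smult (2 * (real n + 1)) (U (Suc n))) x"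
      using chebyshev_U_pred_deriv1[of x n] by (simp add: U_def[symmetric] pderiv_diff algebra_simps)
  qed
  hence op: "gegenbauer_op lam (U (Suc (Suc n)) - U n) = [:1, 0, -1:] * smult (2 * (real n + 1)) (pderiv (U (Suc n)))
     - smult (2 * lam + 1) ([:0, 1:] * smult (2 * (real n + 1)) (U (Suc n)))"
    by (simp add: gegenbauer_op_def pderiv_smult)
  show ?thesis unfolding U_def[symmetric]
  proof (rule poly_eq_poly_eq_iff[THEN iffD1, OF ext])
    fix x
    define e0 e1 d0 d1 where "e0 = poly (U n) x" and "e1 = poly (U (Suc n)) x"
      and "d0 = poly (pderiv (U n)) x" and "d1 = poly (pderiv (U (Suc n))) x"
    have d: "x * d1 - d0 = real n * e1" "d1 - x * d0 = (real n + 1) * e0"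
      using chebyshev_U_pred_deriv1[of x n] chebyshev_U_pred_deriv2[of n x]
      by (simp_all add: e0_def e1_def d0_def d1_def U_def)
    have "(1 - x * x) * d1 = (real n + 1) * e0 - real n * (x * e1)"
      using d by algebra
    moreover have "poly (gegenbauer_op lam (U (Suc (Suc n)) - U n)) x
        = 2 * (real n + 1) * ((1 - x * x) * d1 - (2 * lam + 1) * x * e1)"
      unfolding op by (simp add: e1_def d1_def algebra_simps)
    ultimately have op': "poly (gegenbauer_op lam (U (Suc (Suc n)) - U n)) x
        = 2 * (real n + 1) * ((real n + 1) * e0 - real n * (x * e1) - (2 * lam + 1) * x * e1)"
      by simp
    show "poly (gegenbauer_op lam (U (Suc (Suc n)) - U n)) x =
        poly (smult (- (real n + 1) * (real n + 1 + 2 * lam)) (U (Suc (Suc n)))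
            + smult ((real n + 1) * (real n + 1 - 2 * lam)) (U n)) x"
      unfolding op' by (simp add: U2 e0_def[symmetric] e1_def[symmetric] algebra_simps)
  qed
qed

text \<open>The n-th Gegenbauer coefficient of \<open>U_(m-1)\<close>; with this shift the only m at
  which it can be nonzero are n + 1, n + 3, and so on.\<close>

definition chebyshev_moment :: "real \<Rightarrow> nat \<Rightarrow> nat \<Rightarrow> real" where
  "chebyshev_moment lam n m = weight_functional lam (chebyshev_U_pred m * gegenbauer_poly lam n)
     / weight_functional lam (gegenbauer_poly lam n * gegenbauer_poly lam n)"

lemma gegenbauer_poly_nonzero: "lam > 0 \<Longrightarrow> gegenbauer_poly lam n \<noteq> 0"
  using lead_coeff_gegenbauer_poly[of lam n] pochhammer_pos[of lam n] by auto

text \<open>Moving the operator from the Chebyshev difference to the n-th Gegenbauer polynomial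
  replaces it by the eigenvalue; comparing both evaluations gives a relation whose coefficients
  factor.\<close>

lemma chebyshev_moment_rec:
  assumes lam: "lam > 0"
  shows "(real m + 1 - real n) * (real m + 1 + real n + 2 * lam) * chebyshev_moment lam n (Suc (Suc m))
       = (real m + 1 + real n) * (real m + 1 - real n - 2 * lam) * chebyshev_moment lam n m"
proof -
  define h where "h = weight_functional lam (gegenbauer_poly lam n * gegenbauer_poly lam n)"
  define A where "A = (\<lambda>m. weight_functional lam (chebyshev_U_pred m * gegenbauer_poly lam n))"
  have "weight_functional lam (gegenbauer_op lam (chebyshev_U_pred (Suc (Suc m)) - chebyshev_U_pred m) * gegenbauer_poly lam n)
      = - real n * (real n + 2 * lam) * (A (Suc (Suc m)) - A m)"
    unfolding gegenbauer_op_selfadjoint[OF lam] gegenbauer_op_gegenbauer_poly[OF lam] A_def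
    by (simp only: mult_smult_right weight_functional_smult left_diff_distrib weight_functional_diff[OF lam])
  moreover have "weight_functional lam (gegenbauer_op lam (chebyshev_U_pred (Suc (Suc m)) - chebyshev_U_pred m) * gegenbauer_poly lam n)
      = - (real m + 1) * (real m + 1 + 2 * lam) * A (Suc (Suc m)) + (real m + 1) * (real m + 1 - 2 * lam) * A m"
    unfolding gegenbauer_op_chebyshev A_def
    by (simp only: mult_smult_left weight_functional_smult distrib_right weight_functional_add[OF lam])
  ultimately have "(real m + 1 - real n) * (real m + 1 + real n + 2 * lam) * A (Suc (Suc m))
       = (real m + 1 + real n) * (real m + 1 - real n - 2 * lam) * A m"
    by (simp add: algebra_simps)
  moreover have "chebyshev_moment lam n m = A m / h" for m
    by (simp add: chebyshev_moment_def A_def h_def)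
  ultimately show ?thesis by (simp only: times_divide_eq_right)
qed

lemma chebyshev_moment_small:
  assumes lam: "lam > 0" and "m \<le> n"
  shows "chebyshev_moment lam n m = 0"
proof -
  have "chebyshev_U_pred m = 0 \<or> degree (chebyshev_U_pred m) < n"
    using degree_chebyshev_U_pred[of m] assms by (cases m) auto
  thus ?thesis by (simp add: chebyshev_moment_def gegenbauer_poly_orthogonal_smaller lam)
qed

text \<open>The recurrence in steps of two starts from the vanishing moment at m = n, and its
  leading factor 2 j + 1 is never zero.\<close>

lemma chebyshev_moment_parity:
  assumes lam: "lam > 0"
  shows "chebyshev_moment lam n (n + 2 * j) = 0"
proof (induction j)
  case (Suc j)
  have "real (n + 2 * j) + 1 - real n \<noteq> 0" "real (n + 2 * j) + 1 + real n + 2 * lam \<noteq> 0"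
    using lam by auto
  thus ?case using chebyshev_moment_rec[OF lam, of "n + 2 * j" n] Suc.IH by simp
qed (simp add: chebyshev_moment_small lam)

text \<open>For j = 0 the coefficient is the quotient of the leading coefficients,
  \<open>n! / (lam)_n\<close>. In the step, the ratio given by the recurrence splits into
  \<open>(j + 1 - lam) / (j + 1)\<close>, the growth of the Pochhammer term, and
  \<open>(n + j + 1) / (n + j + 1 + lam)\<close>, the growth of the Beta term. The Beta function is
  kept so that Euler's integral can sum the series.\<close>

lemma chebyshev_moment_eq:
  assumes lam: "lam > 0"
  shows "chebyshev_moment lam n (Suc n + 2 * j)
       = (real n + lam) * (pochhammer (1 - lam) j / fact j * Beta (real n + real j + 1) lam)"
proof (induction j)
  case 0
  define G where "G = gegenbauer_poly lam n"
  define c where "c = fact n / pochhammer lam n"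
  define q where "q = chebyshev_U_pred (Suc n) - smult c G"
  have poch: "pochhammer lam n > 0" using lam by (rule pochhammer_pos)
  have "q = 0 \<or> degree q < n"
  proof (cases "q = 0")
    case False
    have "degree q \<le> n"
      unfolding q_def G_def using degree_chebyshev_U_pred[of "Suc n"]
      by (intro degree_diff_le) (auto intro: order_trans[OF degree_smult_le] simp: degree_gegenbauer_poly lam simp del: chebyshev_U_pred.simps)
    moreover have "coeff q n = 0"
      unfolding q_def coeff_diff coeff_chebyshev_U_pred coeff_smult G_def lead_coeff_gegenbauer_poly[OF lam]
      using poch by (simp add: c_def)
    ultimately show ?thesis using False by (metis le_neq_implies_less leading_coeff_0_iff)
  qed simp
  hence "weight_functional lam (q * G) = 0"
    unfolding G_def by (rule gegenbauer_poly_orthogonal_smaller[OF lam])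
  hence "weight_functional lam (chebyshev_U_pred (Suc n) * G) = c * weight_functional lam (G * G)"
    by (simp add: q_def left_diff_distrib weight_functional_diff lam)
  moreover have "weight_functional lam (G * G) > 0"
    unfolding G_def by (intro weight_functional_square_pos lam gegenbauer_poly_nonzero)
  ultimately have "chebyshev_moment lam n (Suc n) = c"
    by (simp add: chebyshev_moment_def G_def)
  also have "c = (real n + lam) * Beta (real n + 1) lam"
  proof -
    have "Gamma (lam + real n + 1) = (lam + real n) * Gamma (lam + real n)"
      using lam by (intro Gamma_plus1) (auto elim!: nonpos_Ints_cases)
    moreover have "pochhammer lam n = Gamma (lam + real n) / Gamma lam"
      using lam by (intro pochhammer_Gamma) (auto elim!: nonpos_Ints_cases)
    moreover have "Gamma (real n + 1) = fact n" by (metis Gamma_fact add.commute)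
    moreover have "Gamma (lam + real n) > 0" "Gamma lam > 0" using lam by (auto intro!: Gamma_real_pos)
    ultimately have "c = fact n * Gamma lam / Gamma (lam + real n)"
        and "Beta (real n + 1) lam = fact n * Gamma lam / ((lam + real n) * Gamma (lam + real n))"
      by (simp_all add: c_def Beta_def add_ac)
    thus ?thesis using lam by (simp add: add.commute)
  qed
  finally show ?case by simp
next
  case (Suc j)
  define B where "B = Beta (real n + real j + 1) lam"
  have "(real n + real j + 1 + lam) * Beta (real n + real j + 1 + 1) lam = (real n + real j + 1) * B"
    unfolding B_def using lam by (intro Beta_plus1_left) (auto elim!: nonpos_Ints_cases)
  hence B': "Beta (real n + real (Suc j) + 1) lam = (real n + real j + 1) / (real n + real j + 1 + lam) * B"
    using lam by (simp add: field_simps)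
  have "(2 * (real j + 1)) * (2 * (real n + real j + 1 + lam)) * chebyshev_moment lam n (Suc n + 2 * Suc j)
      = (2 * (real n + real j + 1)) * (2 * (real j + 1 - lam)) * chebyshev_moment lam n (Suc n + 2 * j)"
    using chebyshev_moment_rec[OF lam, of "Suc n + 2 * j" n] by (simp add: algebra_simps)
  moreover have "real j + 1 \<noteq> 0" "real n + real j + 1 + lam \<noteq> 0" using lam by auto
  moreover have "y = b * c / (i * a) * x" if "(2 * i) * (2 * a) * y = (2 * b) * (2 * c) * x" "i \<noteq> 0" "a \<noteq> 0"
    for a b c i x y :: real
    using that by (simp add: divide_simps mult_ac)
  ultimately have "chebyshev_moment lam n (Suc n + 2 * Suc j)
     = (real n + real j + 1) * (real j + 1 - lam) / ((real j + 1) * (real n + real j + 1 + lam)) * chebyshev_moment lam n (Suc n + 2 * j)"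
    by blast
  also have "\<dots> = (real n + lam) * (pochhammer (1 - lam) (Suc j) / fact (Suc j) * Beta (real n + real (Suc j) + 1) lam)"
  proof -
    have p: "pochhammer (1 - lam) (Suc j) = pochhammer (1 - lam) j * (real j + 1 - lam)"
      by (simp add: pochhammer_Suc algebra_simps)
    have f: "fact (Suc j) = (real j + 1) * fact j" by (simp add: algebra_simps)
    show ?thesis
      unfolding Suc.IH B' B_def[symmetric] p f
      by (simp only: times_divide_eq_left times_divide_eq_right divide_divide_eq_left mult_ac)
  qed
  finally show ?case .
qed

section \<open>The Gegenbauer kernel\<close>

text \<open>Termwise integration against a fixed density W. Bounds and convergence are asked only
  where W is nonzero, since the series in use need not converge outside the support of the
  density.\<close>

lemma sums_integral_dominated:
  fixes W :: "'a \<Rightarrow> real" and \<phi> :: "nat \<Rightarrow> 'a \<Rightarrow> complex"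
  assumes W: "integrable M W" and [measurable]: "\<And>j. \<phi> j \<in> borel_measurable M"
    and bound: "\<And>j x. x \<in> space M \<Longrightarrow> W x \<noteq> 0 \<Longrightarrow> norm (\<phi> j x) \<le> c j" and c: "summable c"
    and lim: "\<And>x. x \<in> space M \<Longrightarrow> W x \<noteq> 0 \<Longrightarrow> (\<lambda>j. \<phi> j x) sums \<Phi> x"
  shows "(\<lambda>j. LINT x|M. \<phi> j x * W x) sums (LINT x|M. \<Phi> x * W x)"
proof -
  have [measurable]: "W \<in> borel_measurable M" using W by auto
  have le: "norm (\<phi> j x * W x) \<le> c j * \<bar>W x\<bar>" if "x \<in> space M" for j x
    using bound[OF that, of j] by (cases "W x = 0") (auto simp: norm_mult intro!: mult_right_mono)
  have intW: "integrable M (\<lambda>x. c j * \<bar>W x\<bar>)" for j using W by auto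
  have int: "integrable M (\<lambda>x. \<phi> j x * W x)" for j
    by (rule Bochner_Integration.integrable_bound[OF intW[of j]])
       (auto intro!: AE_I2 order_trans[OF le] abs_ge_self simp del: norm_mult of_real_mult)
  have "(\<lambda>j. LINT x|M. \<phi> j x * W x) sums (LINT x|M. (\<Sum>j. \<phi> j x * W x))"
  proof (rule sums_integral[OF int])
    show "AE x in M. summable (\<lambda>i. norm (\<phi> i x * complex_of_real (W x)))"
    proof (rule AE_I2)
      fix x assume x: "x \<in> space M"
      show "summable (\<lambda>i. norm (\<phi> i x * complex_of_real (W x)))"
        by (rule summable_comparison_test'[OF summable_mult2[OF c, of "\<bar>W x\<bar>"]]) (use le[OF x] in auto)
    qed
    show "summable (\<lambda>i. LINT x|M. norm (\<phi> i x * complex_of_real (W x)))"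
    proof (rule summable_comparison_test'[OF summable_mult2[OF c, of "LINT x|M. \<bar>W x\<bar>"]])
      fix j
      have "norm (LINT x|M. norm (\<phi> j x * complex_of_real (W x))) = (LINT x|M. norm (\<phi> j x * complex_of_real (W x)))"
        by (simp add: Bochner_Integration.integral_nonneg)
      also have "\<dots> \<le> (LINT x|M. c j * \<bar>W x\<bar>)"
        by (intro integral_mono integrable_norm int intW le)
      finally show "norm (LINT x|M. norm (\<phi> j x * complex_of_real (W x))) \<le> c j * (LINT x|M. \<bar>W x\<bar>)"
        by simp
    qed
  qed
  also have "(LINT x|M. (\<Sum>j. \<phi> j x * W x)) = (LINT x|M. \<Phi> x * W x)"
  proof (rule Bochner_Integration.integral_cong[OF refl])
    fix x assume x: "x \<in> space M"
    show "(\<Sum>j. \<phi> j x * W x) = \<Phi> x * W x"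
      using sums_mult2[OF lim[OF x], of "complex_of_real (W x)"]
      by (cases "W x = 0") (auto dest: sums_unique)
  qed
  finally show ?thesis .
qed

lemma beta_density:
  assumes "a > 0" "b > (0::real)"
  shows "integrable lborel (\<lambda>t. indicator {0..1} t *\<^sub>R (t powr (a - 1) * (1 - t) powr (b - 1)))" (is ?A)
    and "(LINT t:{0..1}|lborel. t powr (a - 1) * (1 - t) powr (b - 1)) = Beta a b" (is ?B)
proof -
  note I = has_integral_Beta_real[OF assms]
  have "(\<lambda>t. t powr (a - 1) * (1 - t) powr (b - 1)) absolutely_integrable_on {0..1}"
    using I by (intro nonnegative_absolutely_integrable_1) (auto simp: integrable_on_def)
  thus A: ?A
    unfolding set_integrable_def by (subst (asm) integrable_completion) auto
  show ?B using A I
    by (subst set_borel_integral_eq_integral) (auto simp: set_integrable_def)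
qed

text \<open>Euler's integral for the hypergeometric series on the left, estimated pointwise.\<close>

lemma euler_series_bound:
  fixes s :: complex
  assumes lam: "lam > 0" and s: "norm s < 1"
    and sums: "(\<lambda>j. of_real (pochhammer (1 - lam) j / fact j * Beta (real n + real j + 1) lam) * s ^ j) sums S"
  shows "norm S \<le> Beta (real n + 1) lam *
     (if lam \<ge> 1 then (1 + norm s) powr (lam - 1) else (1 - norm s) powr (lam - 1))" (is "_ \<le> _ * ?C")
proof -
  define W :: "real \<Rightarrow> real" where "W = (\<lambda>t. indicator {0..1} t *\<^sub>R (t powr (real n + 1 - 1) * (1 - t) powr (lam - 1)))"
  define \<phi> where "\<phi> = (\<lambda>j (t::real). ((of_real (lam - 1) :: complex) gchoose j) * (- (of_real t * s)) ^ j)"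
  define \<Phi> where "\<Phi> = (\<lambda>t::real. (1 - of_real t * s) powr of_real (lam - 1))"
  have W: "integrable lborel W" unfolding W_def using lam by (intro beta_density) auto
  have Wsupp: "t \<in> {0..1}" if "W t \<noteq> 0" for t using that by (auto simp: W_def indicator_def split: if_splits)
  have ts: "norm (of_real t * s) \<le> norm s" if "t \<in> {0..1}" for t
    using that by (auto simp: norm_mult intro!: mult_left_le_one_le)
  \<comment> \<open>Absolute convergence of the binomial series at s follows from its convergence at
    a point of larger modulus inside the unit disc.\<close>
  obtain x where x: "norm s < x" "x < 1" using dense[OF s] by blast
  have x0: "x \<ge> 0" using x(1) norm_ge_zero[of s] by linarith
  have "summable (\<lambda>j. norm (((of_real (lam - 1) :: complex) gchoose j) * s ^ j))"
    using gen_binomial_complex[of "of_real x" "of_real (lam - 1)"] x x0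
    by (intro powser_insidea[of _ "of_real x"]) (auto simp: sums_iff)
  moreover have "(\<lambda>j. LINT t|lborel. \<phi> j t * W t) sums (LINT t|lborel. \<Phi> t * W t)"
  proof (rule sums_integral_dominated[OF W])
    show "\<phi> j \<in> borel_measurable lborel" for j
      unfolding \<phi>_def by (subst measurable_lborel2, intro borel_measurable_continuous_onI continuous_intros)
    show "summable (\<lambda>j. norm (((of_real (lam - 1) :: complex) gchoose j) * s ^ j))" by fact
    show "norm (\<phi> j t) \<le> norm (((of_real (lam - 1) :: complex) gchoose j) * s ^ j)" if "W t \<noteq> 0" for j t
      unfolding \<phi>_def norm_mult[of "_ gchoose _"] norm_power norm_minus_cancel
      by (intro mult_left_mono power_mono ts Wsupp that) auto
    show "(\<lambda>j. \<phi> j t) sums \<Phi> t" if "W t \<noteq> 0" for t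
      using gen_binomial_complex[of "- (of_real t * s)" "of_real (lam - 1)"] ts[OF Wsupp[OF that]] s
      by (simp add: \<phi>_def \<Phi>_def)
  qed
  moreover have "(LINT t|lborel. \<phi> j t * W t) = of_real (pochhammer (1 - lam) j / fact j * Beta (real n + real j + 1) lam) * s ^ j" for j
  proof -
    \<comment> \<open>The sign in the binomial coefficient cancels the one in the j-th power of - t
      s.\<close>
    have g: "((of_real (lam - 1) :: complex) gchoose j) = (- 1) ^ j * of_real (pochhammer (1 - lam) j / fact j)"
      unfolding gbinomial_pochhammer by (simp flip: pochhammer_of_real of_real_minus)
    have "(LINT t|lborel. \<phi> j t * W t) = (LINT t|lborel. (of_real (pochhammer (1 - lam) j / fact j) * s ^ j) *
       of_real (indicator {0..1} t *\<^sub>R (t powr (real n + real j + 1 - 1) * (1 - t) powr (lam - 1))))"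
    proof (rule Bochner_Integration.integral_cong_AE)
      show "AE t in lborel. \<phi> j t * W t = of_real (pochhammer (1 - lam) j / fact j) * s ^ j *
             of_real (indicator {0..1} t *\<^sub>R (t powr (real n + real j + 1 - 1) * (1 - t) powr (lam - 1)))"
        using AE_lborel_singleton[of 0]
      proof eventually_elim
        case (elim t)
        have "t powr (real n + real j) = t ^ j * t powr real n" if "t > 0"
          using that by (simp add: powr_add powr_realpow)
        moreover have "(- (of_real t * s)) ^ j = (-1) ^ j * of_real t ^ j * s ^ j"
          by (simp add: power_minus[of "of_real t * s"] power_mult_distrib)
        moreover have "(m * P) * (m * T * S) * of_real (a * w) = P * S * of_real (u * a * w)"
          if "m * m = 1" "T = of_real u" for m P T S :: complex and a w u :: real
        proof -
          have "(m * P) * (m * T * S) * of_real (a * w) = (m * m) * P * T * S * of_real (a * w)"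
            by (simp only: mult_ac)
          thus ?thesis using that by simp
        qed
        moreover have "(- 1) ^ j * (- 1) ^ j = (1 :: complex)" by (simp flip: power_mult_distrib)
        ultimately show ?case using elim
          unfolding \<phi>_def W_def g
          by (cases "t \<in> {0<..1}") (simp_all add: indicator_def)
      qed
    qed (auto simp: \<phi>_def W_def)
    also have "\<dots> = of_real (pochhammer (1 - lam) j / fact j) * s ^ j * of_real (Beta (real n + real j + 1) lam)"
      using beta_density(2)[of "real n + real j + 1" lam] lam
      unfolding integral_mult_right_zero integral_complex_of_real
      by (simp only: set_lebesgue_integral_def)
    finally show ?thesis by simp
  qed
  ultimately have "(\<lambda>j. of_real (pochhammer (1 - lam) j / fact j * Beta (real n + real j + 1) lam) * s ^ j) sums (LINT t|lborel. \<Phi> t * W t)"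
    by simp
  hence S: "S = (LINT t|lborel. \<Phi> t * W t)" using sums sums_unique2 by blast
  have Wnn: "W t \<ge> 0" for t by (simp add: W_def indicator_def)
  have bnd: "norm (\<Phi> t) \<le> ?C" if "W t \<noteq> 0" for t
  proof -
    have t: "norm (of_real t * s) \<le> norm s" by (rule ts[OF Wsupp[OF that]])
    have lo: "1 - norm s \<le> norm (1 - of_real t * s)"
      using norm_triangle_ineq2[of 1 "of_real t * s"] t by simp
    have hi: "norm (1 - of_real t * s) \<le> 1 + norm s"
      using norm_triangle_ineq4[of 1 "of_real t * s"] t by simp
    have "norm (\<Phi> t) = norm (1 - of_real t * s) powr (lam - 1)"
      unfolding \<Phi>_def by (subst norm_powr_real_powr') auto
    \<comment> \<open>The sign of lam - 1 decides whether the upper or the lower bound on the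
      modulus of 1 - t s applies; this is the origin of the two cases in \<open>D_bar\<close> and
      \<open>D_const\<close>.\<close>
    also have "\<dots> \<le> ?C"
    proof (cases "lam \<ge> 1")
      case True
      thus ?thesis using hi by (auto intro!: powr_mono2)
    next
      case False
      thus ?thesis using lo s by (auto intro!: powr_mono2')
    qed
    finally show ?thesis .
  qed
  have "norm S \<le> (LINT t|lborel. ?C * W t)"
    unfolding S
  proof (rule Bochner_Integration.integral_norm_bound_integral)
    have [measurable]: "W \<in> borel_measurable lborel" using W by auto
    have "norm (\<Phi> t * W t) \<le> ?C * W t" for t
      using bnd[of t] Wnn[of t] by (cases "W t = 0") (auto simp: norm_mult intro!: mult_right_mono)
    thus "\<And>t. norm (\<Phi> t * complex_of_real (W t)) \<le> ?C * W t" by blast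
    moreover have "\<Phi> \<in> borel_measurable lborel" unfolding \<Phi>_def by measurable
    ultimately show "integrable lborel (\<lambda>t. \<Phi> t * complex_of_real (W t))"
      by (intro Bochner_Integration.integrable_bound[OF integrable_mult_right[OF W, of ?C]])
         (auto intro!: AE_I2 intro: order_trans[OF _ abs_ge_self] simp del: of_real_mult)
    show "integrable lborel (\<lambda>t. ?C * W t)" by (intro integrable_mult_right W)
  qed
  also have "\<dots> = Beta (real n + 1) lam * ?C"
    using beta_density(2)[of "real n + 1" lam] lam by (simp add: W_def set_lebesgue_integral_def)
  finally show ?thesis .
qed

text \<open>With \<open>x = cos \<theta>\<close>, both \<open>a\<close> and \<open>b\<close> are the unimodular numbers \<open>exp (\<plusminus> \<i> \<theta>)\<close>.\<close>

lemma abs_chebyshev_U_pred_le: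
  assumes "x \<in> {-1..1}"
  shows "\<bar>poly (chebyshev_U_pred m) x\<bar> \<le> real m"
proof -
  define a b where "a = cis (arccos x)" and "b = cis (- arccos x)"
  have ab: "a + b = of_real (2 * x)" "a * b = 1"
    using assms by (auto simp: a_def b_def complex_eq_iff cis_mult)
  \<comment> \<open>Since a and b are the roots of the characteristic polynomial, the recurrence of
    order two reduces to one of order one with multiplier b of modulus 1; each step then adds at
    most 1.\<close>
  have "complex_of_real (poly (chebyshev_U_pred (Suc m)) x) = a ^ m + b * of_real (poly (chebyshev_U_pred m) x)" for m
  proof (induction m)
    case (Suc m)
    define e where "e = complex_of_real (poly (chebyshev_U_pred m) x)"
    have "complex_of_real (poly (chebyshev_U_pred (Suc (Suc m))) x)
        = of_real (2 * x) * of_real (poly (chebyshev_U_pred (Suc m)) x) - e"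
      by (simp add: e_def)
    also have "\<dots> = (a + b) * (a ^ m + b * e) - (a * b) * e"
      unfolding Suc.IH ab(2) ab(1) e_def by simp
    also have "\<dots> = a ^ Suc m + b * (a ^ m + b * e)" by (simp add: algebra_simps)
    finally show ?case unfolding Suc.IH e_def .
  qed simp
  hence step: "\<bar>poly (chebyshev_U_pred (Suc m)) x\<bar> \<le> 1 + \<bar>poly (chebyshev_U_pred m) x\<bar>" for m
    using norm_triangle_ineq[of "a ^ m" "b * of_real (poly (chebyshev_U_pred m) x)"]
    by (metis a_def b_def mult_1 norm_cis norm_mult norm_of_real norm_power power_one)
  show ?thesis
  proof (induction m)
    case (Suc m)
    thus ?case using step[of m] by linarith
  qed simp
qed

text \<open>Multiplying the sum by the denominator collapses the series to 1 by the recurrence. The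
  same product shows that the denominator is nonzero.\<close>

lemma chebyshev_generating_function:
  fixes v :: complex
  assumes x: "x \<in> {-1..1}" and v: "norm v < 1"
  shows "(\<lambda>m. of_real (poly (chebyshev_U_pred (Suc m)) x) * v ^ m) sums (1 / (1 - 2 * of_real x * v + v\<^sup>2))"
    and "summable (\<lambda>m. (real m + 1) * norm v ^ m)"
    and "1 - 2 * of_real x * v + v\<^sup>2 \<noteq> 0"
proof -
  define e where "e = (\<lambda>m. complex_of_real (poly (chebyshev_U_pred m) x))"
  have "summable (\<lambda>m. diffs (\<lambda>_. 1) m * norm v ^ m)"
    using v by (intro termdiff_converges[of _ 1]) (auto intro!: summable_geometric)
  thus sm: "summable (\<lambda>m. (real m + 1) * norm v ^ m)" by (simp add: diffs_def add.commute)
  have smt: "summable (\<lambda>m. e (Suc m) * v ^ m)"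
  proof (rule summable_comparison_test'[OF sm])
    fix m show "norm (e (Suc m) * v ^ m) \<le> (real m + 1) * norm v ^ m"
      using abs_chebyshev_U_pred_le[OF x, of "Suc m"]
      by (auto simp: e_def norm_mult norm_power simp del: chebyshev_U_pred.simps intro!: mult_right_mono)
  qed
  then obtain S where S: "(\<lambda>m. e (Suc m) * v ^ m) sums S" by (auto simp: summable_def)
  have e0: "e 0 = 0" "e (Suc 0) = 1" by (simp_all add: e_def)
  have S1: "(\<lambda>m. e m * v ^ m) sums (v * S)"
    using sums_mult[OF S, of v] e0 sums_Suc_iff[of "\<lambda>m. e m * v ^ m" "v * S"] by (simp add: mult_ac)
  have S2: "(\<lambda>m. e (Suc (Suc m)) * v ^ (Suc (Suc m))) sums (v * S - v)"
    using S1 e0 sums_Suc_iff[of "\<lambda>m. e (Suc m) * v ^ Suc m" "v * S - v"] sums_Suc_iff[of "\<lambda>m. e m * v ^ m" "v * S"]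
    by simp
  have rec: "e (Suc (Suc m)) = 2 * of_real x * e (Suc m) - e m" for m by (simp add: e_def)
  have "(\<lambda>m. 2 * of_real x * v\<^sup>2 * (e (Suc m) * v ^ m) - v\<^sup>2 * (e m * v ^ m)) sums (2 * of_real x * v\<^sup>2 * S - v\<^sup>2 * (v * S))"
    by (intro sums_diff sums_mult S S1)
  also have "(\<lambda>m. 2 * of_real x * v\<^sup>2 * (e (Suc m) * v ^ m) - v\<^sup>2 * (e m * v ^ m)) = (\<lambda>m. e (Suc (Suc m)) * v ^ (Suc (Suc m)))"
    by (simp add: rec algebra_simps power2_eq_square)
  finally have "v * S - v = 2 * of_real x * v\<^sup>2 * S - v\<^sup>2 * (v * S)"
    using S2 sums_unique2 by blast
  \<comment> \<open>The shifted series yield the identity only up to a factor v; for v = 0 the sum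
    is read off from its constant term.\<close>
  hence "v = 0 \<or> S * (1 - 2 * of_real x * v + v\<^sup>2) = 1" by algebra
  moreover have "S = 1" if "v = 0"
    using S e0 that powser_sums_zero_iff[of "\<lambda>m. e (Suc m)" S] by simp
  ultimately have *: "S * (1 - 2 * of_real x * v + v\<^sup>2) = 1" by auto
  thus "1 - 2 * of_real x * v + v\<^sup>2 \<noteq> 0" by auto
  with * have "S = 1 / (1 - 2 * of_real x * v + v\<^sup>2)" by (simp add: field_simps)
  with S show "(\<lambda>m. of_real (poly (chebyshev_U_pred (Suc m)) x) * v ^ m) sums (1 / (1 - 2 * of_real x * v + v\<^sup>2))"
    by (simp add: e_def)
qed

text \<open>Normalised and extended by zero, so that a coefficient is a plain integral over the line
  and, in several variables, an integral against a product of such densities.\<close>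

definition gegenbauer_density :: "real \<Rightarrow> nat \<Rightarrow> real \<Rightarrow> real" where
  "gegenbauer_density lam n x =
     indicator {-1..1} x * (poly (gegenbauer lam n) x * gegenbauer_weight lam x / gegenbauer_h lam n)"

lemma gegenbauer_h_eq:
  "lam > 0 \<Longrightarrow> gegenbauer_h lam n = weight_functional lam (gegenbauer_poly lam n * gegenbauer_poly lam n)"
  by (simp add: gegenbauer_h_def weight_functional_def gegenbauer_eq power2_eq_square)

lemma gegenbauer_density_integrable:
  assumes "lam > 0"
  shows "integrable lborel (gegenbauer_density lam n)"
proof -
  have "integrable lborel (\<lambda>x. (indicator {-1..1} x *\<^sub>R (poly (gegenbauer lam n) x * gegenbauer_weight lam x)) / gegenbauer_h lam n)"
    using poly_weight_integrable[OF assms, of "gegenbauer lam n"]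
    by (intro Bochner_Integration.integrable_divide) (simp add: set_integrable_def)
  thus ?thesis by (simp add: gegenbauer_density_def[abs_def] mult_ac)
qed

lemma chebyshev_moment_eq_integral:
  assumes "lam > 0"
  shows "(LINT x|lborel. poly (chebyshev_U_pred m) x * gegenbauer_density lam n x) = chebyshev_moment lam n m"
proof -
  have "(LINT x|lborel. poly (chebyshev_U_pred m) x * gegenbauer_density lam n x)
    = (LINT x|lborel. indicator {-1..1} x *\<^sub>R (poly (chebyshev_U_pred m * gegenbauer lam n) x * gegenbauer_weight lam x) / gegenbauer_h lam n)"
    by (intro Bochner_Integration.integral_cong) (auto simp: gegenbauer_density_def)
  thus ?thesis
    by (simp add: chebyshev_moment_def gegenbauer_h_eq assms gegenbauer_eq weight_functional_def set_lebesgue_integral_def)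
qed

lemma gegenbauer_kernel_bound:
  fixes v :: complex
  assumes lam: "lam > 0" and v: "norm v < 1"
  shows "norm (LINT x|lborel. 1 / (1 - 2 * of_real x * v + v\<^sup>2) * of_real (gegenbauer_density lam n x))
    \<le> norm v ^ n * (fact n * Gamma lam / Gamma (real n + lam)) *
     (if lam \<ge> 1 then (1 + norm v ^ 2) powr (lam - 1) else (1 - norm v ^ 2) powr (lam - 1))"
    (is "norm ?I \<le> _ * ?C")
proof -
  have supp: "x \<in> {-1..1}" if "gegenbauer_density lam n x \<noteq> 0" for x
    using that by (auto simp: gegenbauer_density_def indicator_def split: if_splits)
  have "(\<lambda>m. LINT x|lborel. (of_real (poly (chebyshev_U_pred (Suc m)) x) * v ^ m) * of_real (gegenbauer_density lam n x)) sums ?I"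
  proof (rule sums_integral_dominated[OF gegenbauer_density_integrable[OF lam]])
    show "summable (\<lambda>m. (real m + 1) * norm v ^ m)" using chebyshev_generating_function(2)[of 0 v] v by simp
    show "norm (of_real (poly (chebyshev_U_pred (Suc m)) x) * v ^ m) \<le> (real m + 1) * norm v ^ m"
      if "gegenbauer_density lam n x \<noteq> 0" for m x
      using abs_chebyshev_U_pred_le[OF supp[OF that], of "Suc m"]
      by (auto simp: norm_mult norm_power simp del: chebyshev_U_pred.simps intro!: mult_right_mono)
    show "(\<lambda>m. of_real (poly (chebyshev_U_pred (Suc m)) x) * v ^ m) sums (1 / (1 - 2 * of_real x * v + v\<^sup>2))"
      if "gegenbauer_density lam n x \<noteq> 0" for x
      by (rule chebyshev_generating_function supp that v)+
    show "(\<lambda>x. complex_of_real (poly (chebyshev_U_pred (Suc m)) x) * v ^ m) \<in> borel_measurable lborel" for m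
      by (subst measurable_lborel2, intro borel_measurable_continuous_onI continuous_intros)
  qed
  moreover have "(LINT x|lborel. (of_real (poly (chebyshev_U_pred (Suc m)) x) * v ^ m) * of_real (gegenbauer_density lam n x))
      = of_real (chebyshev_moment lam n (Suc m)) * v ^ m" for m
  proof -
    have "(LINT x|lborel. (of_real (poly (chebyshev_U_pred (Suc m)) x) * v ^ m) * of_real (gegenbauer_density lam n x))
       = (LINT x|lborel. v ^ m * of_real (poly (chebyshev_U_pred (Suc m)) x * gegenbauer_density lam n x))"
      by (simp add: mult_ac del: chebyshev_U_pred.simps)
    also have "\<dots> = v ^ m * of_real (LINT x|lborel. poly (chebyshev_U_pred (Suc m)) x * gegenbauer_density lam n x)"
      by (subst integral_mult_right_zero, subst integral_complex_of_real) simp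
    finally show ?thesis by (simp add: chebyshev_moment_eq_integral[OF lam] del: chebyshev_U_pred.simps)
  qed
  ultimately have sums: "(\<lambda>m. of_real (chebyshev_moment lam n (Suc m)) * v ^ m) sums ?I" by simp
  have "(\<lambda>j. of_real (chebyshev_moment lam n (Suc (n + 2 * j))) * v ^ (n + 2 * j)) sums ?I"
  proof (subst sums_mono_reindex[of "\<lambda>j. n + 2 * j" "\<lambda>m. of_real (chebyshev_moment lam n (Suc m)) * v ^ m"])
    show "strict_mono (\<lambda>j. n + 2 * j)" by (rule strict_monoI) simp
    \<comment> \<open>Indices m < n and those of the wrong parity contribute nothing, so the series
      runs over m = n + 2 j only.\<close>
    fix m assume m: "m \<notin> range (\<lambda>j. n + 2 * j)"
    have "chebyshev_moment lam n (Suc m) = 0"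
    proof (cases "Suc m \<le> n")
      case True thus ?thesis by (rule chebyshev_moment_small[OF lam])
    next
      case False
      define i where "i = m - n"
      have i: "m = n + i" using False by (simp add: i_def)
      have "odd i" using m by (auto simp: i elim!: evenE)
      then obtain j where "i = 2 * j + 1" by (elim oddE)
      hence "Suc m = n + 2 * Suc j" using i by simp
      thus ?thesis by (simp only: chebyshev_moment_parity[OF lam])
    qed
    thus "of_real (chebyshev_moment lam n (Suc m)) * v ^ m = 0" by simp
  qed (rule sums)
  hence sums': "(\<lambda>j. (of_real (real n + lam) * v ^ n) * (of_real (pochhammer (1 - lam) j / fact j * Beta (real n + real j + 1) lam) * (v\<^sup>2) ^ j)) sums ?I"
  proof -
    have "of_real (chebyshev_moment lam n (Suc (n + 2 * j))) * v ^ (n + 2 * j)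
      = (of_real (real n + lam) * v ^ n) * (of_real (pochhammer (1 - lam) j / fact j * Beta (real n + real j + 1) lam) * (v\<^sup>2) ^ j)" for j
      unfolding chebyshev_moment_eq[OF lam, of n j, unfolded add_Suc] power_add power_mult[of v 2 j] of_real_mult
      by (simp only: mult_ac)
    thus ?thesis using \<open>(\<lambda>j. of_real (chebyshev_moment lam n (Suc (n + 2 * j))) * v ^ (n + 2 * j)) sums ?I\<close>
      by (simp only:)
  qed
  show ?thesis
  proof (cases "v = 0 \<and> n > 0")
    \<comment> \<open>Here the prefactor \<open>v ^ n\<close> vanishes and cannot be divided out,
      but both sides of the claim are zero.\<close>
    case True
    thus ?thesis using sums' by (auto simp: zero_power sums_iff)
  next
    case False
    define c where "c = of_real (real n + lam) * v ^ n"
    have "complex_of_real (real n + lam) \<noteq> 0"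
      unfolding of_real_eq_0_iff using lam by linarith
    hence c: "c \<noteq> 0" using False by (simp add: c_def)
    have "(\<lambda>j. of_real (pochhammer (1 - lam) j / fact j * Beta (real n + real j + 1) lam) * (v\<^sup>2) ^ j) sums (?I / c)"
      using sums_divide[OF sums', of c] c unfolding c_def[symmetric] by simp
    hence "norm (?I / c) \<le> Beta (real n + 1) lam *
     (if lam \<ge> 1 then (1 + norm (v\<^sup>2)) powr (lam - 1) else (1 - norm (v\<^sup>2)) powr (lam - 1))"
      using v by (intro euler_series_bound lam) (auto simp: norm_power power_less_one_iff abs_square_less_1)
    hence "norm ?I / norm c \<le> Beta (real n + 1) lam * ?C"
      unfolding norm_divide norm_power .
    hence "norm ?I \<le> Beta (real n + 1) lam * ?C * norm c" using c by (simp add: divide_le_eq)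
    also have "norm c = (real n + lam) * norm v ^ n"
      unfolding c_def norm_mult norm_power norm_of_real using lam by simp
    also have "Beta (real n + 1) lam * ?C * ((real n + lam) * norm v ^ n)
        = norm v ^ n * ((real n + lam) * Beta (real n + 1) lam) * ?C" by (simp only: mult_ac)
    also have "(real n + lam) * Beta (real n + 1) lam = fact n * Gamma lam / Gamma (real n + lam)"
    proof -
      have "Gamma (real n + lam + 1) = (real n + lam) * Gamma (real n + lam)"
        using lam by (intro Gamma_plus1) (auto elim!: nonpos_Ints_cases)
      moreover have "Gamma (real n + 1) = fact n" by (metis Gamma_fact add.commute)
      ultimately have "Beta (real n + 1) lam = fact n * Gamma lam / ((real n + lam) * Gamma (real n + lam))"
        by (simp add: Beta_def add_ac)
      thus ?thesis using lam by simp
    qed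
    finally show ?thesis .
  qed
qed

text \<open>Let f = ln Gamma, which is convex with f (x + 1) - f x = ln x. For lam > 1 the slope
  over [n, n + lam] is at least that over [n, n + 1], namely ln n, and no further constant is
  required. For lam < 1 the slope over [n + lam, n + 1] is at most that over [n + 1, n + 2], namely
  ln (n + 1); replacing this by ln n costs (1 - lam) ln 2, which the exponential absorbs.\<close>

lemma Gamma_ratio_bound:
  assumes lam: "lam > 0" and n: "n \<noteq> 0"
  shows "fact n / Gamma (real n + lam)
     \<le> real n powr (1 - lam) * (if lam \<ge> 1 then exp (1 / 12) else exp (1 / 12 + (1 - lam) / (2 * lam)))"
    (is "_ \<le> _ * ?E")
proof -
  define f :: "real \<Rightarrow> real" where "f = ln \<circ> Gamma"
  have conv: "convex_on {0<..} f" unfolding f_def by (rule log_convex_Gamma_real)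
  have f1: "f (x + 1) = f x + ln x" if "x > 0" for x
  proof -
    have "Gamma (x + 1) = x * Gamma x" using that by (intro Gamma_plus1) (auto elim!: nonpos_Ints_cases)
    moreover have "ln (x * Gamma x) = ln x + ln (Gamma x)"
      using that Gamma_real_pos[of x] by (intro ln_mult_pos)
    ultimately show ?thesis by (simp add: f_def)
  qed
  have "f (real n + 1) - f (real n + lam) \<le> (1 - lam) * ln (real n) + ln ?E"
  proof -
    consider "lam > 1" | "lam = 1" | "lam < 1" by linarith
    thus ?thesis
    proof cases
      case 1
      have "(f (real n) - f (real n + 1)) / (real n - (real n + 1)) \<le> (f (real n) - f (real n + lam)) / (real n - (real n + lam))"
        using n 1 by (intro convex_on_slope_le(1)[OF conv]) auto
      hence "lam * ln (real n) \<le> f (real n + lam) - f (real n)"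
        using f1[of n] n 1 by (simp add: divide_simps mult.commute split: if_splits)
      thus ?thesis using f1[of n] n 1 by (simp add: algebra_simps)
    next
      case 2
      thus ?thesis by simp
    next
      case 3
      have "(f (real n + lam) - f (real n + 2)) / ((real n + lam) - (real n + 2)) \<le> (f (real n + 1) - f (real n + 2)) / ((real n + 1) - (real n + 2))"
        using n 3 lam by (intro convex_on_slope_le(2)[OF conv]) auto
      hence 1: "(f (real n + lam) - f (real n + 2)) / (lam - 2) \<le> ln (real n + 1)"
        using f1[of "real n + 1"] n by (simp add: add.assoc)
      have "(f (real n + lam) - f (real n + 1)) / ((real n + lam) - (real n + 1)) \<le> (f (real n + lam) - f (real n + 2)) / ((real n + lam) - (real n + 2))"
        using n 3 lam by (intro convex_on_slope_le(1)[OF conv]) auto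
      hence "(f (real n + lam) - f (real n + 1)) / (lam - 1) \<le> ln (real n + 1)"
        using 1 by simp
      hence "(lam - 1) * ln (real n + 1) \<le> f (real n + lam) - f (real n + 1)"
        using 3 by (simp add: divide_simps mult.commute split: if_splits)
      hence "f (real n + 1) - f (real n + lam) \<le> (1 - lam) * ln (real n + 1)"
        by (simp add: algebra_simps)
      also have "ln (real n + 1) \<le> ln (2 * real n)" using n by simp
      also have "ln (2 * real n) = ln 2 + ln (real n)" using n by (simp add: ln_mult)
      also have "ln 2 \<le> (25/36 :: real)" by (rule ln2_le_25_over_36)
      finally have "f (real n + 1) - f (real n + lam) \<le> (1 - lam) * (25/36 + ln (real n))"
        using 3 by simp
      also have "\<dots> = (1 - lam) * ln (real n) + (1 - lam) * (25/36)" by (simp add: algebra_simps)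
      also have "(1 - lam) * (25/36) \<le> 1 / 12 + (1 - lam) / (2 * lam)"
      proof -
        \<comment> \<open>With denominators cleared, the claim reads 25 lam^2 - 40 lam + 18 >= 0,
          and the left-hand side is (5 lam - 4)^2 + 2.\<close>
        have "0 \<le> (5 * lam - 4)\<^sup>2" by simp
        hence "lam * 40 \<le> 18 + lam * (lam * 25)" by (simp add: power2_eq_square algebra_simps)
        thus ?thesis using lam by (simp add: divide_simps) (simp add: algebra_simps)
      qed
      finally show ?thesis using 3 by simp
    qed
  qed
  hence "exp (f (real n + 1) - f (real n + lam)) \<le> exp ((1 - lam) * ln (real n) + ln ?E)" by simp
  moreover have "Gamma (real n + 1) = fact n" by (metis Gamma_fact add.commute)
  moreover have "Gamma (real n + lam) > 0" using lam by (intro Gamma_real_pos) auto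
  ultimately show ?thesis using n by (simp add: f_def exp_diff exp_add powr_def)
qed

section \<open>The Cauchy formula on Bernstein ellipses\<close>

text \<open>The closed region bounded by \<open>bernstein_ellipse\<close>, given by its foci -1 and
  1, which makes closedness and convexity immediate; for radius 1 it is the segment.\<close>

definition filled_ellipse :: "real \<Rightarrow> complex set" where
  "filled_ellipse \<rho> = {z. cmod (z - 1) + cmod (z + 1) \<le> \<rho> + 1 / \<rho>}"

text \<open>Subtracting or adding 1 gives the perfect squares \<open>(v - 1)^2 / (2 v)\<close> and
  \<open>(v + 1)^2 / (2 v)\<close>, whose moduli add up by the parallelogram law.\<close>

lemma joukowski_foci:
  fixes v :: complex
  assumes "v \<noteq> 0"
  shows "cmod ((v + 1 / v) / 2 - 1) + cmod ((v + 1 / v) / 2 + 1) = norm v + 1 / norm v"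
proof -
  have e: "(v + 1 / v) / 2 - 1 = (v - 1) ^ 2 / (2 * v)" "(v + 1 / v) / 2 + 1 = (v + 1) ^ 2 / (2 * v)"
    using assms by (simp_all add: field_simps power2_eq_square)
  have "norm (v - 1) ^ 2 + norm (v + 1) ^ 2 = 2 * (norm v ^ 2 + 1)"
    by (simp add: cmod_power2) (simp add: power2_eq_square algebra_simps)
  thus ?thesis using assms
    unfolding e by (simp add: norm_divide norm_mult norm_power add_divide_distrib[symmetric] divide_simps power2_eq_square)
qed

lemma bernstein_ellipse_subset_filled:
  assumes "\<rho> > 0"
  shows "bernstein_ellipse \<rho> \<subseteq> filled_ellipse \<rho>"
proof
  fix z assume "z \<in> bernstein_ellipse \<rho>"
  then obtain u where u: "cmod u = \<rho>" "z = (u + 1 / u) / 2"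
    by (auto simp: bernstein_ellipse_def inverse_eq_divide)
  hence "u \<noteq> 0" using assms by auto
  from joukowski_foci[OF this] show "z \<in> filled_ellipse \<rho>"
    unfolding filled_ellipse_def u(2) mem_Collect_eq using u(1) by simp
qed

lemma two_le_add_inverse: "\<rho> > 0 \<Longrightarrow> 2 \<le> \<rho> + 1 / (\<rho>::real)"
  using zero_le_power2[of "\<rho> - 1"] by (simp add: field_simps power2_eq_square)

lemma two_less_add_inverse: "\<rho> > 1 \<Longrightarrow> 2 < \<rho> + 1 / (\<rho>::real)"
  using zero_less_power2[of "\<rho> - 1"] by (simp add: field_simps power2_eq_square)

lemma interval_foci:
  assumes "x \<in> {-1..1}"
  shows "cmod (of_real x - 1) + cmod (of_real x + 1) = 2"
proof -
  have "cmod (of_real x - 1) = \<bar>x - 1\<bar>" "cmod (of_real x + 1) = \<bar>x + 1\<bar>"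
    by (metis norm_of_real of_real_1 of_real_diff of_real_add)+
  thus ?thesis using assms by auto
qed

lemma interval_subset_filled_ellipse:
  assumes "\<rho> > 0" "x \<in> {-1..1}"
  shows "of_real x \<in> filled_ellipse \<rho>"
  using interval_foci[OF assms(2)] two_le_add_inverse[OF assms(1)] by (simp add: filled_ellipse_def)

lemma closed_filled_ellipse: "closed (filled_ellipse \<rho>)"
  unfolding filled_ellipse_def by (intro closed_Collect_le continuous_intros)

lemma compact_filled_ellipse: "compact (filled_ellipse \<rho>)"
proof -
  have "norm z \<le> \<rho> + 1 / \<rho>" if "z \<in> filled_ellipse \<rho>" for z
  proof -
    have "2 * norm z = norm ((z - 1) + (z + 1))" by (simp add: norm_mult flip: mult_2)
    also have "\<dots> \<le> cmod (z - 1) + cmod (z + 1)" by (rule norm_triangle_ineq)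
    also have "\<dots> \<le> \<rho> + 1 / \<rho>" using that by (simp add: filled_ellipse_def)
    finally show ?thesis using norm_ge_zero[of z] by linarith
  qed
  hence "bounded (filled_ellipse \<rho>)" by (auto simp: bounded_iff)
  thus ?thesis using closed_filled_ellipse by (simp add: compact_eq_bounded_closed)
qed

lemma convex_filled_ellipse: "convex (filled_ellipse \<rho>)"
proof -
  have conv: "convex_on UNIV (\<lambda>z::complex. dist 1 z + dist (-1) z)"
    by (intro convex_on_add convex_on_dist convex_UNIV)
  have "convex {z::complex. dist 1 z + dist (-1) z \<le> \<rho> + 1 / \<rho>}"
  proof (intro convexI)
    fix x y :: complex and u v :: real
    assume x: "x \<in> {z::complex. dist 1 z + dist (-1) z \<le> \<rho> + 1 / \<rho>}"
      and y: "y \<in> {z::complex. dist 1 z + dist (-1) z \<le> \<rho> + 1 / \<rho>}"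
      and uv: "0 \<le> u" "0 \<le> v" "u + v = 1"
    have "dist 1 (u *\<^sub>R x + v *\<^sub>R y) + dist (-1) (u *\<^sub>R x + v *\<^sub>R y) \<le> max (dist 1 x + dist (-1) x) (dist 1 y + dist (-1) y)"
      by (rule convex_lower[OF conv UNIV_I UNIV_I uv])
    also have "\<dots> \<le> \<rho> + 1 / \<rho>" using x y by (intro max.boundedI) auto
    finally show "u *\<^sub>R x + v *\<^sub>R y \<in> {z::complex. dist 1 z + dist (-1) z \<le> \<rho> + 1 / \<rho>}" by blast
  qed
  moreover have "{z::complex. dist 1 z + dist (-1) z \<le> \<rho> + 1 / \<rho>} = filled_ellipse \<rho>"
    by (auto simp: filled_ellipse_def dist_norm norm_minus_commute[of 1] norm_minus_commute[of "-1"])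
  ultimately show ?thesis by simp
qed

lemma interval_interior_filled_ellipse:
  assumes "\<rho> > 1" "x \<in> {-1..1}"
  shows "of_real x \<in> interior (filled_ellipse \<rho>)"
proof (rule interiorI)
  show "open {z. cmod (z - 1) + cmod (z + 1) < \<rho> + 1 / \<rho>}"
    by (intro open_Collect_less continuous_intros)
  show "of_real x \<in> {z. cmod (z - 1) + cmod (z + 1) < \<rho> + 1 / \<rho>}"
    using interval_foci[OF assms(2)] two_less_add_inverse[OF assms(1)] by simp
qed (auto simp: filled_ellipse_def)

text \<open>The ellipse is parametrised by \<open>v = 1 / u\<close>, which stays in the unit disc.\<close>

definition ellipse_param :: "real \<Rightarrow> real \<Rightarrow> complex" where
  "ellipse_param \<rho> t = exp (2 * of_real pi * \<i> * of_real t) / of_real \<rho>"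

definition ellipse_point :: "real \<Rightarrow> real \<Rightarrow> complex" where
  "ellipse_point \<rho> t = (ellipse_param \<rho> t + 1 / ellipse_param \<rho> t) / 2"

lemma norm_ellipse_param: "\<rho> > 0 \<Longrightarrow> norm (ellipse_param \<rho> t) = 1 / \<rho>"
  by (simp add: ellipse_param_def norm_divide)

lemma ellipse_param_nonzero: "\<rho> > 0 \<Longrightarrow> ellipse_param \<rho> t \<noteq> 0"
  by (simp add: ellipse_param_def)

lemma ellipse_point_in_bernstein: "\<rho> > 0 \<Longrightarrow> ellipse_point \<rho> t \<in> bernstein_ellipse \<rho>"
  unfolding bernstein_ellipse_def ellipse_point_def
  by (auto intro!: exI[of _ "1 / ellipse_param \<rho> t"] simp: norm_divide norm_ellipse_param inverse_eq_divide add.commute)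

lemma continuous_on_ellipse_param: "\<rho> > 0 \<Longrightarrow> continuous_on A (ellipse_param \<rho>)"
  unfolding ellipse_param_def by (intro continuous_intros) auto

lemma continuous_on_ellipse_point: "\<rho> > 0 \<Longrightarrow> continuous_on A (ellipse_point \<rho>)"
  unfolding ellipse_point_def by (intro continuous_intros continuous_on_ellipse_param) (auto simp: ellipse_param_nonzero)

lemma ellipse_param_has_vector_derivative:
  "\<rho> > 0 \<Longrightarrow> (ellipse_param \<rho> has_vector_derivative 2 * of_real pi * \<i> * ellipse_param \<rho> t) (at t)"
  unfolding ellipse_param_def by (rule has_vector_derivative_real_field) (auto intro!: derivative_eq_intros)

lemma ellipse_point_has_vector_derivative:
  assumes "\<rho> > 0"
  shows "(ellipse_point \<rho> has_vector_derivative
           pi * \<i> * (ellipse_param \<rho> t - 1 / ellipse_param \<rho> t)) (at t)"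
proof -
  have "((\<lambda>v. (v + 1 / v) / 2) has_field_derivative (1 - 1 / (ellipse_param \<rho> t)\<^sup>2) / 2) (at (ellipse_param \<rho> t))"
    using ellipse_param_nonzero[OF assms, of t]
    by (auto intro!: derivative_eq_intros simp: field_simps power2_eq_square)
  from field_vector_diff_chain_at[OF ellipse_param_has_vector_derivative[OF assms, of t] this]
  have "(ellipse_point \<rho> has_vector_derivative 2 * of_real pi * \<i> * ellipse_param \<rho> t * ((1 - 1 / (ellipse_param \<rho> t)\<^sup>2) / 2)) (at t)"
    by (simp add: o_def ellipse_point_def[abs_def])
  moreover have "2 * of_real pi * \<i> * ellipse_param \<rho> t * ((1 - 1 / (ellipse_param \<rho> t)\<^sup>2) / 2)
      = pi * \<i> * (ellipse_param \<rho> t - 1 / ellipse_param \<rho> t)"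
    using ellipse_param_nonzero[OF assms, of t] by (simp add: field_simps power2_eq_square)
  ultimately show ?thesis by (simp add: mult.assoc)
qed

lemma valid_path_ellipse_point:
  assumes "\<rho> > 0"
  shows "valid_path (ellipse_point \<rho>)"
  unfolding valid_path_def
proof (rule C1_differentiable_imp_piecewise)
  show "ellipse_point \<rho> C1_differentiable_on {0..1}"
    unfolding C1_differentiable_on_def
    using ellipse_point_has_vector_derivative[OF assms]
    by (intro exI[of _ "\<lambda>t. pi * \<i> * (ellipse_param \<rho> t - 1 / ellipse_param \<rho> t)"] conjI ballI
          continuous_intros continuous_on_ellipse_param assms)
       (auto simp: ellipse_param_nonzero assms)
qed

text \<open>Up to the factor \<open>- 2 pi i\<close>, this is the derivative of
  \<open>ellipse_point\<close> divided by \<open>ellipse_point - x\<close>, the Cauchy kernel along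
  the ellipse. The sign is negative because the parameter v = 1/u runs through the ellipse
  clockwise.\<close>

definition ellipse_kernel :: "real \<Rightarrow> real \<Rightarrow> real \<Rightarrow> complex" where
  "ellipse_kernel \<rho> t x = (1 - (ellipse_param \<rho> t)\<^sup>2) / (1 - 2 * of_real x * ellipse_param \<rho> t + (ellipse_param \<rho> t)\<^sup>2)"

text \<open>As a function of v the kernel is holomorphic on the closed disc of radius 1 / rho and
  takes the value 1 at 0, so its mean over the circle is 1. It serves to normalise Cauchy's
  formula.\<close>

lemma ellipse_kernel_mean:
  assumes \<rho>: "\<rho> > 1" and x: "x \<in> {-1..1}"
  shows "((\<lambda>t. ellipse_kernel \<rho> t x) has_integral 1) {0..1}"
proof -
  define \<phi> where "\<phi> = (\<lambda>v :: complex. (1 - v\<^sup>2) / (1 - 2 * of_real x * v + v\<^sup>2))"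
  have "\<phi> holomorphic_on cball 0 (1 / \<rho>)"
    unfolding \<phi>_def
  proof (intro holomorphic_intros)
    fix v :: complex assume "v \<in> cball 0 (1 / \<rho>)"
    hence "norm v \<le> 1 / \<rho>" by simp
    also have "1 / \<rho> < 1" using \<rho> by simp
    finally show "1 - 2 * of_real x * v + v\<^sup>2 \<noteq> 0" by (rule chebyshev_generating_function(3)[OF x])
  qed
  from Cauchy_integral_circlepath_simple[OF this, of 0]
  have "((\<lambda>u. \<phi> u / (u - 0)) has_contour_integral 2 * pi * \<i> * \<phi> 0) (circlepath 0 (1/\<rho>))"
    using \<rho> by simp
  hence "((\<lambda>t. \<phi> (circlepath 0 (1/\<rho>) t) / circlepath 0 (1/\<rho>) t * vector_derivative (circlepath 0 (1/\<rho>)) (at t))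
     has_integral 2 * pi * \<i>) {0..1}"
    by (simp add: has_contour_integral \<phi>_def)
  moreover have "circlepath 0 (1/\<rho>) t = ellipse_param \<rho> t" for t
    by (simp add: circlepath ellipse_param_def)
  moreover have "vector_derivative (circlepath 0 (1/\<rho>)) (at t) = 2 * of_real pi * \<i> * ellipse_param \<rho> t" for t
    by (simp add: vector_derivative_circlepath ellipse_param_def)
  moreover have "\<phi> (ellipse_param \<rho> t) = ellipse_kernel \<rho> t x" for t
    by (simp add: \<phi>_def ellipse_kernel_def)
  ultimately have "((\<lambda>t. ellipse_kernel \<rho> t x * (2 * of_real pi * \<i>)) has_integral 2 * pi * \<i>) {0..1}"
    using ellipse_param_nonzero[of \<rho>] \<rho> by (simp add: mult_ac)
  from has_integral_mult_left[OF this, of "1 / (2 * of_real pi * \<i>)"]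
  show ?thesis by simp
qed

text \<open>The winding number is never computed. Cauchy's formula holds with an unknown constant c;
  applied to the constant function 1 and compared with \<open>ellipse_kernel_mean\<close>, it
  determines c.\<close>

lemma cauchy_ellipse:
  assumes \<rho>: "\<rho> > 1" and x: "x \<in> {-1..1}" and g: "g holomorphic_on filled_ellipse \<rho>"
  shows "((\<lambda>t. g (ellipse_point \<rho> t) * ellipse_kernel \<rho> t x) has_integral g (of_real x)) {0..1}"
proof -
  have \<rho>0: "\<rho> > 0" using \<rho> by simp
  define p where "p = ellipse_point \<rho>"
  define c where "c = 2 * of_real pi * \<i> * winding_number p (of_real x)"
  have foci: "cmod (p t - 1) + cmod (p t + 1) = \<rho> + 1 / \<rho>" for t
    using joukowski_foci[OF ellipse_param_nonzero[OF \<rho>0, of t]] \<rho>0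
    by (simp add: p_def ellipse_point_def norm_ellipse_param add.commute)
  hence ne: "p t \<noteq> of_real x" for t
    using interval_foci[OF x] two_less_add_inverse[OF \<rho>] by (metis order_less_irrefl)
  have img: "path_image p \<subseteq> filled_ellipse \<rho> - {of_real x}"
    using foci ne by (auto simp: path_image_def filled_ellipse_def)
  have closed: "pathfinish p = pathstart p"
    by (simp add: pathfinish_def pathstart_def p_def ellipse_point_def ellipse_param_def exp_eq_1)
  have cauchy: "((\<lambda>w. f w / (w - of_real x)) has_contour_integral (c * f (of_real x))) p"
    if "f holomorphic_on filled_ellipse \<rho>" for f
    using Cauchy_integral_formula_convex_simple[OF convex_filled_ellipse that
        interval_interior_filled_ellipse[OF \<rho> x] _ img closed]
    by (simp add: c_def p_def valid_path_ellipse_point \<rho>0)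
  have vd: "vector_derivative p (at t) / (p t - of_real x) = - (2 * of_real pi * \<i>) * ellipse_kernel \<rho> t x" for t
  proof -
    define v where "v = ellipse_param \<rho> t"
    have v: "v \<noteq> 0" "norm v < 1" using \<rho> by (simp_all add: v_def ellipse_param_nonzero norm_ellipse_param)
    define D where "D = 1 - 2 * of_real x * v + v\<^sup>2"
    have D: "D \<noteq> 0" unfolding D_def by (rule chebyshev_generating_function(3)[OF x v(2)])
    have 1: "p t - of_real x = D / (2 * v)"
      unfolding D_def using v by (simp add: p_def ellipse_point_def v_def[symmetric] field_simps power2_eq_square)
    have 2: "vector_derivative p (at t) = pi * \<i> * (v - 1 / v)"
      unfolding p_def v_def using \<rho>0 by (intro vector_derivative_at ellipse_point_has_vector_derivative)
    have 3: "ellipse_kernel \<rho> t x = (1 - v\<^sup>2) / D"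
      by (simp add: ellipse_kernel_def v_def D_def)
    show ?thesis
    proof -
      have "(v - 1 / v) * (2 * v) = - 2 * (1 - v\<^sup>2)" using v by (simp add: power2_eq_square algebra_simps)
      hence w: "(v - 1 / v) * (2 * v) = - 2 * (1 - v\<^sup>2)" .
      have "pi * \<i> * (v - 1 / v) / (D / (2 * v)) = pi * \<i> * ((v - 1 / v) * (2 * v)) / D"
        by simp
      also have "\<dots> = - (2 * of_real pi * \<i>) * ((1 - v\<^sup>2) / D)"
        unfolding w by (simp add: divide_inverse algebra_simps)
      finally show ?thesis unfolding 1 2 3 .
    qed
  qed
  have cauchy': "((\<lambda>t. f (p t) * ellipse_kernel \<rho> t x) has_integral (- c / (2 * of_real pi * \<i>) * f (of_real x))) {0..1}"
    if "f holomorphic_on filled_ellipse \<rho>" for f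
  proof -
    have "((\<lambda>t. f (p t) / (p t - of_real x) * vector_derivative p (at t)) has_integral (c * f (of_real x))) {0..1}"
      using cauchy[OF that] by (simp add: has_contour_integral)
    moreover have "f (p t) / (p t - of_real x) * vector_derivative p (at t) = f (p t) * ellipse_kernel \<rho> t x * (- (2 * of_real pi * \<i>))" for t
    proof -
      have "f (p t) / (p t - of_real x) * vector_derivative p (at t) = f (p t) * (vector_derivative p (at t) / (p t - of_real x))"
        by simp
      thus ?thesis unfolding vd by (simp only: mult_ac)
    qed
    ultimately have "((\<lambda>t. f (p t) * ellipse_kernel \<rho> t x * (- (2 * of_real pi * \<i>))) has_integral (c * f (of_real x))) {0..1}"
      by simp
    from has_integral_mult_left[OF this, of "- 1 / (2 * of_real pi * \<i>)"]
    show ?thesis by (simp add: mult_ac)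
  qed
  have "- c / (2 * of_real pi * \<i>) = 1"
    using cauchy'[of "\<lambda>_. 1"] ellipse_kernel_mean[OF \<rho> x]
    by (auto dest: has_integral_unique)
  thus ?thesis using cauchy'[OF g] by (simp add: p_def)
qed

section \<open>Arc length of the Bernstein ellipse\<close>

lemma integral_norm_ellipse_ge:
  assumes "\<rho> > 0"
  shows "1 \<le> integral {0..1} (\<lambda>t. norm (1 - (ellipse_param \<rho> t)\<^sup>2))"
proof -
  \<comment> \<open>The square of \<open>ellipse_param\<close> has mean zero over a period, so the
    integrand without the norm has mean 1.\<close>
  have "((\<lambda>t. 1 - (ellipse_param \<rho> t)\<^sup>2) has_integral
     ((of_real 1 - (ellipse_param \<rho> 1)\<^sup>2 / (4 * of_real pi * \<i>)) - (of_real 0 - (ellipse_param \<rho> 0)\<^sup>2 / (4 * of_real pi * \<i>)))) {0..1}"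
  proof (rule fundamental_theorem_of_calculus)
    fix t :: real
    have "((\<lambda>t. of_real t - (ellipse_param \<rho> t)\<^sup>2 / (4 * of_real pi * \<i>)) has_vector_derivative 1 - (ellipse_param \<rho> t)\<^sup>2) (at t)"
      unfolding ellipse_param_def using assms
      by (intro has_vector_derivative_real_field)
         (auto intro!: derivative_eq_intros simp: power2_eq_square field_simps)
    thus "((\<lambda>t. of_real t - (ellipse_param \<rho> t)\<^sup>2 / (4 * of_real pi * \<i>)) has_vector_derivative 1 - (ellipse_param \<rho> t)\<^sup>2) (at t within {0..1})"
      by (rule has_vector_derivative_at_within)
  qed simp
  moreover have "ellipse_param \<rho> 1 = ellipse_param \<rho> 0" by (simp add: ellipse_param_def exp_eq_1)
  ultimately have i: "((\<lambda>t. 1 - (ellipse_param \<rho> t)\<^sup>2) has_integral 1) {0..1}" by simp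
  have "norm (integral {0..1} (\<lambda>t. 1 - (ellipse_param \<rho> t)\<^sup>2)) \<le> integral {0..1} (\<lambda>t. norm (1 - (ellipse_param \<rho> t)\<^sup>2))"
    by (intro integral_norm_bound_integral integrable_continuous_interval continuous_intros continuous_on_ellipse_param assms) auto
  thus ?thesis using i by (simp add: integral_unique)
qed

text \<open>The numerator \<open>1 - v^2\<close> of \<open>ellipse_kernel\<close> has, up to a
  constant factor, the modulus of the speed along the ellipse; this is how the length enters the
  coefficient bound.\<close>

lemma ellipse_length_eq:
  assumes "\<rho> > 0"
  shows "ellipse_length \<rho> = pi * \<rho> * integral {0..1} (\<lambda>t. norm (1 - (ellipse_param \<rho> t)\<^sup>2))"
proof -
  define f where "f = (\<lambda>t. norm (1 - (ellipse_param \<rho> t)\<^sup>2))"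
  have curve: "bernstein_curve \<rho> t = ellipse_point \<rho> ((- 1 / (2 * pi)) * t)" for t
  proof -
    have "exp (2 * of_real pi * \<i> * of_real ((- 1 / (2 * pi)) * t)) = 1 / exp (of_real t * \<i>)"
      by (simp add: exp_minus inverse_eq_divide mult.commute)
    thus ?thesis
      unfolding bernstein_curve_def Let_def ellipse_point_def ellipse_param_def
      using assms by (simp add: inverse_eq_divide add.commute)
  qed
  have nv: "norm (vector_derivative (bernstein_curve \<rho>) (at t)) = \<rho> / 2 * f (1 / (2 * pi) * t + 0)" for t
  proof -
    define s where "s = (- 1 / (2 * pi)) * t"
    define v where "v = ellipse_param \<rho> s"
    have "((\<lambda>t. (- 1 / (2 * pi)) * t) has_vector_derivative (- 1 / (2 * pi))) (at t)"
      by (auto intro!: derivative_eq_intros)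
    from vector_diff_chain_at[OF this ellipse_point_has_vector_derivative[OF assms]]
    have "(bernstein_curve \<rho> has_vector_derivative (- 1 / (2 * pi)) *\<^sub>R (pi * \<i> * (v - 1 / v))) (at t)"
      by (simp add: o_def curve[abs_def] v_def s_def)
    hence "vector_derivative (bernstein_curve \<rho>) (at t) = (- 1 / (2 * pi)) *\<^sub>R (pi * \<i> * (v - 1 / v))"
      by (rule vector_derivative_at)
    also have "norm \<dots> = norm (v - 1 / v) / 2" by (simp add: norm_mult)
    also have "v - 1 / v = - (1 - v\<^sup>2) / v"
      using ellipse_param_nonzero[OF assms, of s] by (simp add: v_def field_simps power2_eq_square)
    also have "norm \<dots> / 2 = \<rho> / 2 * norm (1 - v\<^sup>2)"
      by (simp add: norm_divide v_def norm_ellipse_param assms norm_minus_commute)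
    \<comment> \<open>\<open>bernstein_curve\<close> runs in the opposite direction; reversing the
      parameter conjugates v, which the modulus does not see.\<close>
    also have "v = cnj (ellipse_param \<rho> (1 / (2 * pi) * t))"
      by (simp add: v_def s_def ellipse_param_def exp_cnj)
    also have "norm (1 - (cnj (ellipse_param \<rho> (1 / (2 * pi) * t)))\<^sup>2) = f (1 / (2 * pi) * t + 0)"
      unfolding f_def by (metis add_0_right complex_cnj_diff complex_cnj_one complex_cnj_power complex_mod_cnj)
    finally show ?thesis .
  qed
  have "f integrable_on {0..1}"
    unfolding f_def by (intro integrable_continuous_interval continuous_intros continuous_on_ellipse_param assms)
  hence "(f has_integral integral {0..1} f) (cbox 0 1)" by (simp add: has_integral_integral)
  from has_integral_affinity[OF this, of "1 / (2 * pi)" 0]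
  have "((\<lambda>t. f (1 / (2 * pi) * t + 0)) has_integral (2 * pi * integral {0..1} f)) ((\<lambda>x. 2 * pi * x) ` cbox 0 1)"
    by (simp add: abs_of_pos)
  moreover have "(\<lambda>x. 2 * pi * x) ` cbox 0 1 = {0..2 * pi}"
    by (subst cbox_interval, subst image_mult_atLeastAtMost) auto
  ultimately have "((\<lambda>t. f (1 / (2 * pi) * t + 0)) has_integral (2 * pi * integral {0..1} f)) {0..2*pi}" by simp
  from has_integral_mult_right[OF this, of "\<rho> / 2"]
  have "((\<lambda>t. norm (vector_derivative (bernstein_curve \<rho>) (at t))) has_integral (\<rho> / 2 * (2 * pi * integral {0..1} f))) {0..2*pi}"
    unfolding nv .
  thus ?thesis unfolding ellipse_length_def by (simp add: integral_unique f_def)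
qed

section \<open>The coefficient functional carried over to the ellipse\<close>

definition coeff_kernel :: "real \<Rightarrow> nat \<Rightarrow> real \<Rightarrow> real \<Rightarrow> complex" where
  "coeff_kernel lam n \<rho> t = indicator {0..1} t *\<^sub>R (LINT x|lborel. ellipse_kernel \<rho> t x * of_real (gegenbauer_density lam n x))"

lemma gegenbauer_density_support: "gegenbauer_density lam n x \<noteq> 0 \<Longrightarrow> x \<in> {-1..1}"
  by (auto simp: gegenbauer_density_def indicator_def split: if_splits)

lemma ellipse_param_measurable [measurable]: "ellipse_param \<rho> \<in> borel_measurable borel"
  unfolding ellipse_param_def divide_inverse
  by (intro borel_measurable_continuous_onI continuous_intros)

lemma gegenbauer_density_measurable [measurable]: "gegenbauer_density lam n \<in> borel_measurable borel"
  unfolding gegenbauer_density_def gegenbauer_weight_def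
  by (intro borel_measurable_times borel_measurable_divide borel_measurable_indicator
        borel_measurable_continuous_onI[of "poly _"] continuous_intros) measurable

lemma coeff_kernel_bound:
  assumes lam: "lam > 0" and \<rho>: "\<rho> > 1"
  shows "norm (coeff_kernel lam n \<rho> t) \<le> indicator {0..1} t *
     (norm (1 - (ellipse_param \<rho> t)\<^sup>2) * ((1 / \<rho>) ^ n * (fact n * Gamma lam / Gamma (real n + lam)) *
     (if lam \<ge> 1 then (1 + 1 / \<rho>\<^sup>2) powr (lam - 1) else (1 - 1 / \<rho>\<^sup>2) powr (lam - 1))))"
proof -
  define v where "v = ellipse_param \<rho> t"
  have nv: "norm v = 1 / \<rho>" using \<rho> by (simp add: v_def norm_ellipse_param)
  have v: "norm v < 1" using \<rho> by (simp add: nv)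
  have "coeff_kernel lam n \<rho> t = indicator {0..1} t *\<^sub>R
     (LINT x|lborel. (1 - v\<^sup>2) * (1 / (1 - 2 * of_real x * v + v\<^sup>2) * of_real (gegenbauer_density lam n x)))"
    by (simp add: coeff_kernel_def ellipse_kernel_def v_def mult.assoc)
  also have "\<dots> = indicator {0..1} t *\<^sub>R ((1 - v\<^sup>2) * (LINT x|lborel. 1 / (1 - 2 * of_real x * v + v\<^sup>2) * of_real (gegenbauer_density lam n x)))"
    by (simp only: integral_mult_right_zero)
  finally have e: "coeff_kernel lam n \<rho> t = \<dots>" .
  show ?thesis
    using mult_left_mono[OF gegenbauer_kernel_bound[OF lam v, of n] norm_ge_zero[of "1 - v\<^sup>2"]]
    unfolding e v_def[symmetric] norm_scaleR norm_mult nv power_one_over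
    by (cases "t \<in> {0..1}") (simp_all only: indicator_simps abs_one abs_zero mult_1 mult_zero_left order_refl not_False_eq_True)
qed

text \<open>Insert Cauchy's formula for \<open>g x\<close> under the integral and exchange the order
  of integration; what remains next to g on the ellipse is the Gegenbauer coefficient of the kernel
  in x.\<close>

lemma coeff_kernel_reproduces:
  assumes lam: "lam > 0" and \<rho>: "\<rho> > 1" and g: "g holomorphic_on filled_ellipse \<rho>"
  shows "(LINT x|lborel. g (of_real x) * of_real (gegenbauer_density lam n x))
       = (LINT t|lborel. g (ellipse_point \<rho> t) * coeff_kernel lam n \<rho> t)"
    and "coeff_kernel lam n \<rho> \<in> borel_measurable borel"
proof -
  have \<rho>0: "\<rho> > 0" using \<rho> by simp
  define E where "E = (\<lambda>t. indicator {0..1} t *\<^sub>R g (ellipse_point \<rho> t))"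
  have pt: "ellipse_point \<rho> t \<in> filled_ellipse \<rho>" for t
    using ellipse_point_in_bernstein[OF \<rho>0] bernstein_ellipse_subset_filled[OF \<rho>0] by blast
  have contE: "continuous_on {0..1} (\<lambda>t. g (ellipse_point \<rho> t))"
    by (rule continuous_on_compose2[OF holomorphic_on_imp_continuous_on[OF g] continuous_on_ellipse_point[OF \<rho>0]])
       (use pt in auto)
  hence [measurable]: "E \<in> borel_measurable borel"
    unfolding E_def by (intro borel_measurable_continuous_on_indicator) auto
  have "compact (g ` filled_ellipse \<rho>)"
    by (intro compact_continuous_image compact_filled_ellipse holomorphic_on_imp_continuous_on g)
  then obtain B where B: "norm (g z) \<le> B" if "z \<in> filled_ellipse \<rho>" for z
    by (metis bounded_iff compact_imp_bounded imageI)
  have Bnn: "B \<ge> 0" using B[OF pt] norm_ge_zero order_trans by blast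
  \<comment> \<open>R majorises the generating series at modulus 1 / rho, uniformly in x, because
    \<open>U_m\<close> is at most m + 1 on the interval; it provides the dominating function for
    Fubini.\<close>
  define R where "R = (\<Sum>m. (real m + 1) * (1 / \<rho>) ^ m)"
  have kb: "norm (ellipse_kernel \<rho> t x) \<le> 2 * R" if x: "x \<in> {-1..1}" for t x
  proof -
    define v where "v = ellipse_param \<rho> t"
    have nv: "norm v = 1 / \<rho>" using \<rho>0 by (simp add: v_def norm_ellipse_param)
    have v: "norm v < 1" using \<rho> by (simp add: nv)
    note gf = chebyshev_generating_function[OF x v]
    have "norm (1 / (1 - 2 * of_real x * v + v\<^sup>2)) \<le> R"
      unfolding R_def sums_unique[OF gf(1)] nv[symmetric]
    proof (rule norm_suminf_le[OF _ gf(2)])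
      fix m show "norm (of_real (poly (chebyshev_U_pred (Suc m)) x) * v ^ m) \<le> (real m + 1) * norm v ^ m"
        using abs_chebyshev_U_pred_le[OF x, of "Suc m"]
        by (auto simp: norm_mult norm_power simp del: chebyshev_U_pred.simps intro!: mult_right_mono)
    qed
    moreover have "norm (1 - v\<^sup>2) \<le> 2"
      using norm_triangle_ineq4[of 1 "v\<^sup>2"] power_le_one[of "norm v" 2] v by (simp add: norm_power)
    moreover have "ellipse_kernel \<rho> t x = (1 - v\<^sup>2) * (1 / (1 - 2 * of_real x * v + v\<^sup>2))"
      by (simp add: ellipse_kernel_def v_def)
    moreover have "0 \<le> (2 :: real)" by simp
    ultimately show ?thesis
      by (simp only: norm_mult) (rule mult_mono, assumption+, rule norm_ge_zero)
  qed
  have R: "R \<ge> 0" using order_trans[OF norm_ge_zero kb[of 0 0]] by simp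
  define f where "f = (\<lambda>x t. E t * (ellipse_kernel \<rho> t x * of_real (gegenbauer_density lam n x)))"
  have mk[measurable]: "(\<lambda>p. ellipse_kernel \<rho> (snd p) (fst p)) \<in> borel_measurable (lborel \<Otimes>\<^sub>M lborel)"
    unfolding ellipse_kernel_def by measurable
  have m[measurable]: "case_prod f \<in> borel_measurable (lborel \<Otimes>\<^sub>M lborel)"
    unfolding f_def case_prod_beta by measurable
  have fb: "norm (f x t) \<le> indicator {0..1} t * (B * (2 * R) * \<bar>gegenbauer_density lam n x\<bar>)" for x t
  proof (cases "gegenbauer_density lam n x = 0 \<or> t \<notin> {0..1}")
    case True thus ?thesis by (auto simp: f_def E_def)
  next
    case False
    hence x: "x \<in> {-1..1}" using gegenbauer_density_support by blast
    have "norm (f x t) = norm (g (ellipse_point \<rho> t)) * (norm (ellipse_kernel \<rho> t x) * \<bar>gegenbauer_density lam n x\<bar>)"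
      using False by (simp add: f_def E_def norm_mult)
    also have "\<dots> \<le> B * (2 * R * \<bar>gegenbauer_density lam n x\<bar>)"
      by (intro mult_mono B pt kb x order_refl mult_nonneg_nonneg Bnn R) auto
    finally show ?thesis using False by (simp add: mult.assoc)
  qed
  have int: "integrable (lborel \<Otimes>\<^sub>M lborel) (case_prod f)"
  proof (rule Bochner_Integration.integrable_bound[OF _ m])
    show "integrable (lborel \<Otimes>\<^sub>M lborel) (\<lambda>(x, t::real). indicator {0..1} t * (B * (2 * R) * \<bar>gegenbauer_density lam n x\<bar>))"
    proof (rule lborel_pair.Fubini_integrable)
      show "AE x in lborel. integrable lborel (\<lambda>t. case (x, t) of (x, t::real) \<Rightarrow> indicator {0..1} t * (B * (2 * R) * \<bar>gegenbauer_density lam n x\<bar>))"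
        by (intro AE_I2) (auto intro!: integrable_mult_left integrable_real_indicator)
      have "integrable lborel (\<lambda>x. \<bar>B * (2 * R) * gegenbauer_density lam n x\<bar>)"
        by (intro integrable_abs integrable_mult_right gegenbauer_density_integrable lam)
      thus "integrable lborel (\<lambda>x. LINT t|lborel. norm (case (x, t) of (x, t::real) \<Rightarrow> indicator {0..1} t * (B * (2 * R) * \<bar>gegenbauer_density lam n x\<bar>)))"
        by (simp add: abs_mult mult_ac)
    qed measurable
    show "AE p in lborel \<Otimes>\<^sub>M lborel. norm (case p of (x, t) \<Rightarrow> f x t) \<le>
       norm (case p of (x, t) \<Rightarrow> indicator {0..1} t * (B * (2 * R) * \<bar>gegenbauer_density lam n x\<bar>))"
      by (intro AE_I2) (auto intro: order_trans[OF fb] abs_ge_self)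
  qed
  have "(LINT t|lborel. g (ellipse_point \<rho> t) * coeff_kernel lam n \<rho> t) = (LINT t|lborel. LINT x|lborel. f x t)"
    by (intro Bochner_Integration.integral_cong)
       (simp_all add: coeff_kernel_def f_def E_def indicator_def)
  also have "\<dots> = (LINT x|lborel. LINT t|lborel. f x t)" by (rule lborel_pair.Fubini_integral[OF int])
  also have "\<dots> = (LINT x|lborel. g (of_real x) * of_real (gegenbauer_density lam n x))"
  proof (rule Bochner_Integration.integral_cong[OF refl])
    fix x
    show "(LINT t|lborel. f x t) = g (of_real x) * of_real (gegenbauer_density lam n x)"
    proof (cases "gegenbauer_density lam n x = 0")
      case False
      hence x: "x \<in> {-1..1}" by (rule gegenbauer_density_support)
      have "continuous_on {0..1} (\<lambda>t. g (ellipse_point \<rho> t) * ellipse_kernel \<rho> t x)"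
        unfolding ellipse_kernel_def using chebyshev_generating_function(3)[OF x] norm_ellipse_param[OF \<rho>0] \<rho>
        by (intro continuous_intros contE continuous_on_ellipse_param \<rho>0) auto
      hence si: "set_integrable lborel {0..1} (\<lambda>t. g (ellipse_point \<rho> t) * ellipse_kernel \<rho> t x)"
        by (rule borel_integrable_atLeastAtMost')
      have "(LINT t|lborel. f x t) = (LINT t:{0..1}|lborel. g (ellipse_point \<rho> t) * ellipse_kernel \<rho> t x) * of_real (gegenbauer_density lam n x)"
        unfolding set_lebesgue_integral_def integral_mult_left_zero[symmetric]
        by (intro Bochner_Integration.integral_cong) (auto simp: f_def E_def)
      also have "(LINT t:{0..1}|lborel. g (ellipse_point \<rho> t) * ellipse_kernel \<rho> t x) = g (of_real x)"
        using cauchy_ellipse[OF \<rho> x g] by (subst set_borel_integral_eq_integral[OF si]) (simp add: integral_unique)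
      finally show ?thesis .
    qed (simp add: f_def)
  qed
  finally show "(LINT x|lborel. g (of_real x) * of_real (gegenbauer_density lam n x))
       = (LINT t|lborel. g (ellipse_point \<rho> t) * coeff_kernel lam n \<rho> t)" ..
  show "coeff_kernel lam n \<rho> \<in> borel_measurable borel"
    unfolding coeff_kernel_def ellipse_kernel_def by measurable
qed

lemma coeff_kernel_integral:
  assumes lam: "lam > 0" and \<rho>: "\<rho> > 1"
  shows "integrable lborel (coeff_kernel lam n \<rho>)"
    and "(LINT t|lborel. norm (coeff_kernel lam n \<rho> t)) \<le>
      ellipse_length \<rho> / (pi * \<rho>) * ((1 / \<rho>) ^ n * (fact n * Gamma lam / Gamma (real n + lam)) *
     (if lam \<ge> 1 then (1 + 1 / \<rho>\<^sup>2) powr (lam - 1) else (1 - 1 / \<rho>\<^sup>2) powr (lam - 1)))"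
proof -
  define C where "C = (1 / \<rho>) ^ n * (fact n * Gamma lam / Gamma (real n + lam)) *
     (if lam \<ge> 1 then (1 + 1 / \<rho>\<^sup>2) powr (lam - 1) else (1 - 1 / \<rho>\<^sup>2) powr (lam - 1))"
  have \<rho>0: "\<rho> > 0" using \<rho> by simp
  have C: "C \<ge> 0" using lam \<rho> by (auto simp: C_def intro!: mult_nonneg_nonneg divide_nonneg_nonneg Gamma_real_nonneg)
  define W where "W = (\<lambda>t. indicator {0..1} t *\<^sub>R norm (1 - (ellipse_param \<rho> t)\<^sup>2))"
  have si: "set_integrable lborel {0..1} (\<lambda>t. norm (1 - (ellipse_param \<rho> t)\<^sup>2))"
    by (intro borel_integrable_atLeastAtMost' continuous_intros continuous_on_ellipse_param \<rho>0)
  hence W: "integrable lborel (\<lambda>t. W t * C)" unfolding W_def set_integrable_def by (rule integrable_mult_left)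
  have b: "norm (coeff_kernel lam n \<rho> t) \<le> W t * C" for t
    using coeff_kernel_bound[OF lam \<rho>, of n t] by (simp add: C_def W_def mult.assoc)
  have m: "coeff_kernel lam n \<rho> \<in> borel_measurable lborel"
    using coeff_kernel_reproduces(2)[OF lam \<rho>, of "\<lambda>_. 0"] by simp
  show int: "integrable lborel (coeff_kernel lam n \<rho>)"
    by (rule Bochner_Integration.integrable_bound[OF W m]) (intro AE_I2 order_trans[OF b], simp)
  have "(LINT t|lborel. norm (coeff_kernel lam n \<rho> t)) \<le> (LINT t|lborel. W t * C)"
    by (intro integral_mono integrable_norm int W b)
  also have "\<dots> = integral {0..1} (\<lambda>t. norm (1 - (ellipse_param \<rho> t)\<^sup>2)) * C"
    using set_borel_integral_eq_integral(2)[OF si] by (simp add: W_def set_lebesgue_integral_def)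
  also have "integral {0..1} (\<lambda>t. norm (1 - (ellipse_param \<rho> t)\<^sup>2)) = ellipse_length \<rho> / (pi * \<rho>)"
    using \<rho>0 by (simp add: ellipse_length_eq)
  finally show "(LINT t|lborel. norm (coeff_kernel lam n \<rho> t)) \<le>
      ellipse_length \<rho> / (pi * \<rho>) * ((1 / \<rho>) ^ n * (fact n * Gamma lam / Gamma (real n + lam)) *
     (if lam \<ge> 1 then (1 + 1 / \<rho>\<^sup>2) powr (lam - 1) else (1 - 1 / \<rho>\<^sup>2) powr (lam - 1)))"
    by (simp only: C_def)
qed

section \<open>Several variables\<close>

text \<open>A vector is the sum of its single coordinates, each placed by a continuous
  embedding.\<close>

lemma borel_measurable_vec_lambda [measurable (raw)]:
  fixes g :: "'d::finite \<Rightarrow> 'a \<Rightarrow> 'b::euclidean_space"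
  assumes [measurable]: "\<And>i. g i \<in> borel_measurable M"
  shows "(\<lambda>x. \<chi> i. g i x) \<in> borel_measurable M"
proof -
  have "continuous_on UNIV (\<lambda>z::'b. \<chi> j. if j = i then z else 0)" for i :: 'd
  proof (rule continuous_on_vec_lambda)
    show "continuous_on UNIV (\<lambda>z::'b. if j = i then z else 0)" for j
      by (cases "j = i") auto
  qed
  hence [measurable]: "(\<lambda>z::'b. \<chi> j. if j = i then z else 0) \<in> borel_measurable borel" for i :: 'd
    by (rule borel_measurable_continuous_onI)
  have "(\<lambda>x. \<chi> i. g i x) = (\<lambda>x. \<Sum>i\<in>UNIV. (\<chi> j. if j = i then g i x else 0))"
    by (auto simp: vec_eq_iff)
  also have "\<dots> \<in> borel_measurable M"
    by measurable
  finally show ?thesis .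
qed

text \<open>Both measures agree on boxes. The product form allows Fubini in a single coordinate,
  with the remaining index set \<open>UNIV - {i}\<close>.\<close>

lemma lborel_vec_eq_PiM:
  "(lborel :: (real ^ 'd) measure) = distr (\<Pi>\<^sub>M i\<in>(UNIV :: 'd set). lborel) borel (\<lambda>x. \<chi> i. x i)"
proof (rule lborel_eqI)
  interpret product_sigma_finite "\<lambda>_::'d. lborel :: real measure" ..
  fix l u :: "real ^ 'd"
  assume lu: "\<And>b. b \<in> Basis \<Longrightarrow> l \<bullet> b \<le> u \<bullet> b"
  have le: "l $ i \<le> u $ i" for i
    using lu[of "axis i 1"] by (simp add: inner_axis axis_in_Basis_iff)
  have "emeasure (distr (\<Pi>\<^sub>M i\<in>(UNIV :: 'd set). lborel) borel (\<lambda>x. \<chi> i. x i)) (box l u)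
     = emeasure (\<Pi>\<^sub>M i\<in>(UNIV :: 'd set). lborel) (PiE UNIV (\<lambda>i. {l $ i<..<u $ i}))"
    by (subst emeasure_distr)
       (auto intro!: arg_cong[where f = "emeasure _"] simp: mem_box_cart space_PiM PiE_iff)
  also have "\<dots> = (\<Prod>i\<in>UNIV. emeasure lborel {l $ i<..<u $ i})"
    by (rule emeasure_PiM) auto
  also have "\<dots> = (\<Prod>i\<in>UNIV. ennreal (u $ i - l $ i))"
    using le by (intro prod.cong refl) simp
  also have "\<dots> = ennreal (\<Prod>i\<in>UNIV. u $ i - l $ i)"
    using le by (intro prod_ennreal) auto
  also have "(\<Prod>i\<in>UNIV. u $ i - l $ i) = (\<Prod>b\<in>Basis. (u - l) \<bullet> b)"
  proof -
    have "bij_betw (\<lambda>i. axis i 1) UNIV (Basis :: (real ^ 'd) set)"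
      by (auto simp: bij_betw_def inj_on_def axis_eq_axis Basis_vec_def)
    from prod.reindex_bij_betw[OF this, of "\<lambda>b. (u - l) \<bullet> b"] show ?thesis
      by (simp add: inner_axis)
  qed
  finally show "emeasure (distr (\<Pi>\<^sub>M i\<in>(UNIV :: 'd set). lborel) borel (\<lambda>x. \<chi> i. x i)) (box l u)
      = ennreal (\<Prod>b\<in>Basis. (u - l) \<bullet> b)" .
qed simp

text \<open>Induction on the set J of coordinates already exchanged. Fubini isolates coordinate i,
  and \<open>swap\<close> acts on it while the others are frozen in z, some still real, some already
  on their ellipses; this is why \<open>swap\<close> is required for every z and F is bounded
  everywhere.\<close>

lemma integral_exchange_coordinates:
  fixes F :: "complex ^ 'd \<Rightarrow> complex" and \<phi> \<psi> p q :: "'d \<Rightarrow> real \<Rightarrow> complex"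
  assumes [measurable]: "F \<in> borel_measurable borel"
    and B: "\<And>z. norm (F z) \<le> B"
    and [measurable]: "\<And>i. \<phi> i \<in> borel_measurable borel" "\<And>i. \<psi> i \<in> borel_measurable borel"
    and p: "\<And>i. integrable lborel (p i)" and q: "\<And>i. integrable lborel (q i)"
    and swap: "\<And>i z. (LINT t|lborel. F (\<chi> j. if j = i then \<phi> i t else z $ j) * p i t)
       = (LINT t|lborel. F (\<chi> j. if j = i then \<psi> i t else z $ j) * q i t)"
  shows "(LINT x|(\<Pi>\<^sub>M i\<in>UNIV. lborel). F (\<chi> i. \<phi> i (x i)) * (\<Prod>i\<in>UNIV. p i (x i)))
       = (LINT x|(\<Pi>\<^sub>M i\<in>UNIV. lborel). F (\<chi> i. \<psi> i (x i)) * (\<Prod>i\<in>UNIV. q i (x i)))"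
proof -
  interpret product_sigma_finite "\<lambda>_::'d. lborel :: real measure" ..
  have [measurable]: "p i \<in> borel_measurable borel" "q i \<in> borel_measurable borel" for i
    using p[of i] q[of i] by auto
  have split: "(LINT x|(\<Pi>\<^sub>M i\<in>UNIV. lborel). F (\<chi> j. a j (x j)) * (\<Prod>j\<in>UNIV. r j (x j)))
      = (LINT x|(\<Pi>\<^sub>M j\<in>UNIV - {i}. lborel). (\<Prod>j\<in>UNIV - {i}. r j (x j)) *
           (LINT t|lborel. F (\<chi> j. if j = i then a i t else a j (x j)) * r i t))"
    if [measurable]: "\<And>j. a j \<in> borel_measurable borel" and r: "\<And>j. integrable lborel (r j)"
    for a r :: "'d \<Rightarrow> real \<Rightarrow> complex" and i
  proof -
    have [measurable]: "r j \<in> borel_measurable borel" for j using r[of j] by auto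
    have ins: "insert i (UNIV - {i}) = UNIV" by auto
    have "integrable (\<Pi>\<^sub>M i\<in>UNIV. lborel) (\<lambda>x. F (\<chi> j. a j (x j)) * (\<Prod>j\<in>UNIV. r j (x j)))"
    proof (rule Bochner_Integration.integrable_bound)
      show "integrable (\<Pi>\<^sub>M i\<in>UNIV. lborel) (\<lambda>x. of_real B * (\<Prod>j\<in>UNIV. r j (x j)))"
        by (intro integrable_mult_right product_integrable_prod r) auto
      show "AE x in \<Pi>\<^sub>M i\<in>UNIV. lborel. norm (F (\<chi> j. a j (x j)) * (\<Prod>j\<in>UNIV. r j (x j)))
          \<le> norm (of_real B * (\<Prod>j\<in>UNIV. r j (x j)))"
        by (intro AE_I2) (auto simp: norm_mult intro!: mult_right_mono intro: order_trans[OF B])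
      show "(\<lambda>x. F (\<chi> j. a j (x j)) * (\<Prod>j\<in>UNIV. r j (x j))) \<in> borel_measurable (\<Pi>\<^sub>M i\<in>UNIV. lborel)"
        by measurable
    qed
    hence "(LINT x|(\<Pi>\<^sub>M i\<in>UNIV. lborel). F (\<chi> j. a j (x j)) * (\<Prod>j\<in>UNIV. r j (x j)))
       = (LINT x|(\<Pi>\<^sub>M j\<in>UNIV - {i}. lborel). LINT t|lborel. F (\<chi> j. a j ((x(i := t)) j)) * (\<Prod>j\<in>UNIV. r j ((x(i := t)) j)))"
      using product_integral_insert[of "UNIV - {i}" i "\<lambda>x. F (\<chi> j. a j (x j)) * (\<Prod>j\<in>UNIV. r j (x j))"]
      unfolding ins by simp
    also have "\<dots> = (LINT x|(\<Pi>\<^sub>M j\<in>UNIV - {i}. lborel). (\<Prod>j\<in>UNIV - {i}. r j (x j)) *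
           (LINT t|lborel. F (\<chi> j. if j = i then a i t else a j (x j)) * r i t))"
    proof (rule Bochner_Integration.integral_cong[OF refl])
      fix x :: "'d \<Rightarrow> real"
      have e: "F (\<chi> j. a j ((x(i := t)) j)) * (\<Prod>j\<in>UNIV. r j ((x(i := t)) j))
         = (\<Prod>j\<in>UNIV - {i}. r j (x j)) * (F (\<chi> j. if j = i then a i t else a j (x j)) * r i t)" for t
      proof -
        have "(\<Prod>j\<in>UNIV. r j ((x(i := t)) j)) = r i t * (\<Prod>j\<in>UNIV - {i}. r j (x j))"
          by (subst prod.remove[of UNIV i]) (auto intro!: prod.cong)
        moreover have "(\<chi> j. a j ((x(i := t)) j)) = (\<chi> j. if j = i then a i t else a j (x j))"
          by (auto simp: vec_eq_iff)
        ultimately show ?thesis by (simp only: mult_ac)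
      qed
      show "(LINT t|lborel. F (\<chi> j. a j ((x(i := t)) j)) * (\<Prod>j\<in>UNIV. r j ((x(i := t)) j)))
         = (\<Prod>j\<in>UNIV - {i}. r j (x j)) * (LINT t|lborel. F (\<chi> j. if j = i then a i t else a j (x j)) * r i t)"
        unfolding e by (rule integral_mult_right_zero)
    qed
    finally show ?thesis .
  qed
  define I where "I = (\<lambda>J. LINT x|(\<Pi>\<^sub>M i\<in>UNIV. lborel). F (\<chi> i. (if i \<in> J then \<psi> i else \<phi> i) (x i)) *
      (\<Prod>i\<in>UNIV. (if i \<in> J then q i else p i) (x i)))"
  have "I J = I {}" if "finite J" for J
    using that
  proof induction
    case (insert i J)
    have m: "(if j \<in> J' then \<psi> j else \<phi> j) \<in> borel_measurable borel" "integrable lborel (if j \<in> J' then q j else p j)" for j J'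
      using p q by auto
    have "I (insert i J) = I J"
      unfolding I_def split[of "\<lambda>j. if j \<in> insert i J then \<psi> j else \<phi> j" "\<lambda>j. if j \<in> insert i J then q j else p j" i, OF m]
        split[of "\<lambda>j. if j \<in> J then \<psi> j else \<phi> j" "\<lambda>j. if j \<in> J then q j else p j" i, OF m]
    proof (rule Bochner_Integration.integral_cong[OF refl], rule arg_cong2[where f = "(*)"])
      fix x :: "'d \<Rightarrow> real"
      show "(\<Prod>j\<in>UNIV - {i}. (if j \<in> insert i J then q j else p j) (x j)) = (\<Prod>j\<in>UNIV - {i}. (if j \<in> J then q j else p j) (x j))"
        by (intro prod.cong) auto
      define z where "z = (\<chi> j. (if j \<in> J then \<psi> j else \<phi> j) (x j))"
      have "(LINT t|lborel. F (\<chi> j. if j = i then (if i \<in> insert i J then \<psi> i else \<phi> i) t else (if j \<in> insert i J then \<psi> j else \<phi> j) (x j)) *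
           (if i \<in> insert i J then q i else p i) t) = (LINT t|lborel. F (\<chi> j. if j = i then \<psi> i t else z $ j) * q i t)"
        by (intro Bochner_Integration.integral_cong refl arg_cong2[where f = "(*)"] arg_cong[where f = F])
           (auto simp: vec_eq_iff z_def)
      also have "\<dots> = (LINT t|lborel. F (\<chi> j. if j = i then \<phi> i t else z $ j) * p i t)"
        by (rule swap[symmetric])
      also have "\<dots> = (LINT t|lborel. F (\<chi> j. if j = i then (if i \<in> J then \<psi> i else \<phi> i) t else (if j \<in> J then \<psi> j else \<phi> j) (x j)) *
           (if i \<in> J then q i else p i) t)"
        using insert.hyps
        by (intro Bochner_Integration.integral_cong refl arg_cong2[where f = "(*)"] arg_cong[where f = F])
           (auto simp: vec_eq_iff z_def)
      finally show "(LINT t|lborel. F (\<chi> j. if j = i then (if i \<in> insert i J then \<psi> i else \<phi> i) t else (if j \<in> insert i J then \<psi> j else \<phi> j) (x j)) *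
           (if i \<in> insert i J then q i else p i) t) = \<dots>" .
    qed
    thus ?case using insert.IH by simp
  qed simp
  from this[of UNIV] show ?thesis by (simp add: I_def)
qed

text \<open>The bound M is asked only where no factor vanishes: in a degenerate coordinate the point
  lies on the ellipse only on the support of the density.\<close>

lemma norm_product_integral_le:
  fixes F :: "complex ^ 'd \<Rightarrow> complex" and \<psi> q :: "'d \<Rightarrow> real \<Rightarrow> complex"
  assumes q: "\<And>i. integrable lborel (q i)"
    and M: "\<And>x. (\<And>i. q i (x i) \<noteq> 0) \<Longrightarrow> norm (F (\<chi> i. \<psi> i (x i))) \<le> M"
    and M0: "M \<ge> 0" and b: "\<And>i. (LINT t|lborel. norm (q i t)) \<le> b i"
  shows "norm (LINT x|(\<Pi>\<^sub>M i\<in>UNIV. lborel). F (\<chi> i. \<psi> i (x i)) * (\<Prod>i\<in>UNIV. q i (x i))) \<le> M * (\<Prod>i\<in>UNIV. b i)"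
proof -
  interpret product_sigma_finite "\<lambda>_::'d. lborel :: real measure" ..
  have "norm (LINT x|(\<Pi>\<^sub>M i\<in>UNIV. lborel). F (\<chi> i. \<psi> i (x i)) * (\<Prod>i\<in>UNIV. q i (x i)))
      \<le> (LINT x|(\<Pi>\<^sub>M i\<in>UNIV. lborel). M * (\<Prod>i\<in>UNIV. norm (q i (x i))))"
  proof (rule order_trans[OF integral_norm_bound integral_mono'])
    show "integrable (\<Pi>\<^sub>M i\<in>UNIV. lborel) (\<lambda>x. M * (\<Prod>i\<in>UNIV. norm (q i (x i))))"
      by (intro integrable_mult_right product_integrable_prod integrable_norm q) auto
    fix x :: "'d \<Rightarrow> real"
    show "0 \<le> M * (\<Prod>i\<in>UNIV. norm (q i (x i)))"
      by (intro mult_nonneg_nonneg M0 prod_nonneg) auto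
    have "norm (F (\<chi> i. \<psi> i (x i)) * (\<Prod>i\<in>UNIV. q i (x i))) = norm (F (\<chi> i. \<psi> i (x i))) * (\<Prod>i\<in>UNIV. norm (q i (x i)))"
      by (simp add: norm_mult prod_norm)
    also have "\<dots> \<le> M * (\<Prod>i\<in>UNIV. norm (q i (x i)))"
    proof (cases "\<forall>i. q i (x i) \<noteq> 0")
      case True
      thus ?thesis by (intro mult_right_mono M prod_nonneg) auto
    next
      case False
      hence z: "(\<Prod>i\<in>UNIV. norm (q i (x i))) = 0" by auto
      show ?thesis unfolding z by (simp only: mult_zero_right order_refl)
    qed
    finally show "norm (F (\<chi> i. \<psi> i (x i)) * (\<Prod>i\<in>UNIV. q i (x i))) \<le> M * (\<Prod>i\<in>UNIV. norm (q i (x i)))" .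
  qed
  also have "\<dots> = M * (\<Prod>i\<in>UNIV. LINT t|lborel. norm (q i t))"
    unfolding integral_mult_right_zero
    using product_integral_prod[of UNIV "\<lambda>i t. norm (q i t)"] by (simp add: integrable_norm q)
  also have "\<dots> \<le> M * (\<Prod>i\<in>UNIV. b i)"
    by (intro mult_left_mono M0 prod_mono conjI b Bochner_Integration.integral_nonneg) auto
  finally show ?thesis .
qed

lemma compact_vec_product:
  fixes S :: "'d::finite \<Rightarrow> complex set"
  assumes S: "\<And>i. compact (S i)"
  shows "compact {z :: complex ^ 'd. \<forall>i. z $ i \<in> S i}"
proof -
  have "{z :: complex ^ 'd. \<forall>i. z $ i \<in> S i} = (\<Inter>i. (\<lambda>z. z $ i) -` S i)" by auto
  moreover have "closed (\<Inter>i. (\<lambda>z :: complex ^ 'd. z $ i) -` S i)"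
    using S by (intro closed_INT ballI closed_vimage compact_imp_closed continuous_intros)
  moreover have "bounded {z :: complex ^ 'd. \<forall>i. z $ i \<in> S i}"
  proof -
    have "\<exists>B. \<forall>w\<in>S i. norm w \<le> B" for i
      using compact_imp_bounded[OF S[of i]] by (simp add: bounded_iff)
    then obtain B where B: "\<And>i w. w \<in> S i \<Longrightarrow> norm w \<le> B i" by metis
    have "norm z \<le> (\<Sum>i\<in>UNIV. B i)" if "z \<in> {z :: complex ^ 'd. \<forall>i. z $ i \<in> S i}" for z
    proof -
      have "norm z \<le> (\<Sum>i\<in>UNIV. norm (z $ i))" unfolding norm_vec_def by (rule L2_set_le_sum) auto
      also have "\<dots> \<le> (\<Sum>i\<in>UNIV. B i)" using that by (intro sum_mono B) auto
      finally show ?thesis .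
    qed
    thus ?thesis by (auto simp: bounded_iff)
  qed
  ultimately show ?thesis by (simp add: compact_eq_bounded_closed)
qed

section \<open>Cube, polyellipses and the coefficient as a product integral\<close>

definition complex_cube :: "(complex ^ 'd) set" where
  "complex_cube = {z. \<forall>i. z $ i \<in> of_real ` {-1..1}}"

definition filled_poly_ellipse :: "real ^ 'd \<Rightarrow> (complex ^ 'd) set" where
  "filled_poly_ellipse r = {z. \<forall>j. z $ j \<in> filled_ellipse (r $ j)}"

lemma compact_complex_cube: "compact (complex_cube :: (complex ^ 'd) set)"
  unfolding complex_cube_def by (intro compact_vec_product compact_continuous_image continuous_intros) auto

lemma compact_filled_poly_ellipse: "compact (filled_poly_ellipse r)"
  unfolding filled_poly_ellipse_def by (intro compact_vec_product compact_filled_ellipse)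

lemma compact_poly_ellipse:
  assumes "\<And>i. r $ i > 0"
  shows "compact (poly_ellipse r)"
  unfolding poly_ellipse_def
proof (intro compact_vec_product)
  fix i
  have "bernstein_ellipse (r $ i) = (\<lambda>u. (u + inverse u) / 2) ` sphere 0 (r $ i)"
    by (auto simp: bernstein_ellipse_def)
  also have "compact \<dots>"
    using assms[of i] by (intro compact_continuous_image continuous_intros) auto
  finally show "compact (bernstein_ellipse (r $ i))" .
qed

lemma complex_cube_subset_filled:
  fixes r :: "real ^ 'd"
  assumes "\<And>i. r $ i > 0"
  shows "complex_cube \<subseteq> filled_poly_ellipse r"
proof
  fix z :: "complex ^ 'd" assume z: "z \<in> complex_cube"
  have "z $ j \<in> filled_ellipse (r $ j)" for j
  proof -
    have "z $ j \<in> of_real ` {-1..1}" using z unfolding complex_cube_def by blast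
    then obtain x where "x \<in> {-1..1}" "z $ j = of_real x" by blast
    thus ?thesis using interval_subset_filled_ellipse[OF assms] by simp
  qed
  thus "z \<in> filled_poly_ellipse r" by (simp add: filled_poly_ellipse_def)
qed

lemma poly_ellipse_subset_filled:
  assumes "\<And>i. r $ i > 0"
  shows "poly_ellipse r \<subseteq> filled_poly_ellipse r"
  using bernstein_ellipse_subset_filled[OF assms] by (auto simp: poly_ellipse_def filled_poly_ellipse_def)

text \<open>Outside X nothing is known about f; the indicator of the closed set X makes the
  integrand Borel on the whole space and changes nothing on the cube.\<close>

lemma gegenbauer_coeff_eq_product_integral:
  fixes f :: "complex ^ 'd \<Rightarrow> complex" and k :: "nat ^ 'd"
  assumes lam: "lam > 0" and X: "closed X" "complex_cube \<subseteq> X" and f: "continuous_on X f"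
  shows "gegenbauer_coeff lam f k = (LINT x|(\<Pi>\<^sub>M i\<in>UNIV. lborel).
       (indicator X (\<chi> i. of_real (x i)) *\<^sub>R f (\<chi> i. of_real (x i))) * (\<Prod>i\<in>UNIV. of_real (gegenbauer_density lam (k $ i) (x i))))"
    (is "_ = ?R")
proof -
  define F where "F = (\<lambda>z. indicator X z *\<^sub>R f z)"
  have [measurable]: "F \<in> borel_measurable borel"
    unfolding F_def using f X(1) by (intro borel_measurable_continuous_on_indicator) auto
  have [measurable]: "(\<lambda>x::real^'d. x $ i) \<in> borel_measurable borel" for i
    by (intro borel_measurable_continuous_onI continuous_intros)
  have [measurable]: "complex_vec \<in> borel_measurable (borel :: (real ^ 'd) measure)"
    unfolding complex_vec_def by measurable
  define G where "G = (\<lambda>x. F (complex_vec x) * (\<Prod>i\<in>UNIV. complex_of_real (gegenbauer_density lam (k $ i) (x $ i))))"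
  have "gegenbauer_coeff lam f k = (LINT x|lborel. 1 / of_real (mv_gegenbauer_h lam k) *
      (indicator cube x *\<^sub>R (f (complex_vec x) * of_real (mv_gegenbauer lam k x) * of_real (mv_weight lam x))))"
    unfolding gegenbauer_coeff_def set_lebesgue_integral_def by (rule integral_mult_right_zero[symmetric])
  also have "\<dots> = (LINT x|lborel. G x)"
  proof (rule Bochner_Integration.integral_cong[OF refl])
    fix x :: "real ^ 'd"
    show "1 / of_real (mv_gegenbauer_h lam k) *
      (indicator cube x *\<^sub>R (f (complex_vec x) * of_real (mv_gegenbauer lam k x) * of_real (mv_weight lam x))) = G x"
    proof (cases "x \<in> cube")
      case True
      hence xi: "x $ i \<in> {-1..1}" for i by (auto simp: cube_def)
      have "complex_vec x \<in> X" using X(2) xi by (auto simp: complex_cube_def complex_vec_def)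
      hence "F (complex_vec x) = f (complex_vec x)" by (simp add: F_def)
      moreover have "(\<Prod>i\<in>UNIV. complex_of_real (gegenbauer_density lam (k $ i) (x $ i)))
        = of_real (mv_gegenbauer lam k x) * of_real (mv_weight lam x) / of_real (mv_gegenbauer_h lam k)"
        unfolding mv_gegenbauer_def mv_weight_def mv_gegenbauer_h_def of_real_prod prod.distrib[symmetric] prod_dividef[symmetric]
        using xi by (intro prod.cong) (auto simp: gegenbauer_density_def)
      ultimately show ?thesis using True by (simp add: G_def)
    next
      case False
      then obtain i where i: "x $ i \<notin> {-1..1}" by (auto simp: cube_def)
      have "gegenbauer_density lam (k $ i) (x $ i) = 0"
        using i gegenbauer_density_support by blast
      hence "(\<Prod>i\<in>UNIV. complex_of_real (gegenbauer_density lam (k $ i) (x $ i))) = 0"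
        by (intro prod_zero) auto
      with False show ?thesis by (simp add: G_def del: prod_zero_iff)
    qed
  qed
  also have "\<dots> = (LINT x|(\<Pi>\<^sub>M i\<in>UNIV. lborel). G (\<chi> i. x i))"
  proof -
    have "G \<in> borel_measurable borel" unfolding G_def by measurable
    moreover have "(\<lambda>x. \<chi> i. x i) \<in> (\<Pi>\<^sub>M i\<in>(UNIV :: 'd set). (lborel :: real measure)) \<rightarrow>\<^sub>M borel"
      by measurable
    ultimately show ?thesis unfolding lborel_vec_eq_PiM by (intro integral_distr)
  qed
  also have "\<dots> = ?R" by (simp add: G_def F_def complex_vec_def)
  finally show ?thesis .
qed

text \<open>Coefficients depend continuously on the function in the supremum norm over the cube.
  This lets them follow the limit of the dilations.\<close>

lemma gegenbauer_coeff_diff_le: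
  fixes f g :: "complex ^ 'd \<Rightarrow> complex" and k :: "nat ^ 'd"
  assumes lam: "lam > 0" and f: "continuous_on complex_cube f" and g: "continuous_on complex_cube g"
    and e: "\<And>z. z \<in> complex_cube \<Longrightarrow> norm (f z - g z) \<le> e" "e \<ge> 0"
  shows "norm (gegenbauer_coeff lam f k - gegenbauer_coeff lam g k)
    \<le> e * (\<Prod>i\<in>UNIV. LINT t|lborel. norm (complex_of_real (gegenbauer_density lam (k $ i) t)))"
proof -
  interpret product_sigma_finite "\<lambda>_::'d. lborel :: real measure" ..
  define q where "q = (\<lambda>i t. complex_of_real (gegenbauer_density lam (k $ i) t))"
  have q: "integrable lborel (q i)" for i
    unfolding q_def by (intro integrable_of_real gegenbauer_density_integrable lam)
  hence [measurable]: "q i \<in> borel_measurable borel" for i using borel_measurable_integrable by force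
  define T where "T = (\<lambda>f (z :: complex ^ 'd). indicator complex_cube z *\<^sub>R (f z :: complex))"
  have Tm: "T f \<in> borel_measurable borel" if "continuous_on complex_cube f" for f
    unfolding T_def using that
    by (intro borel_measurable_continuous_on_indicator borel_closed compact_imp_closed[OF compact_complex_cube])
  have int: "integrable (\<Pi>\<^sub>M i\<in>UNIV. lborel) (\<lambda>x. T f (\<chi> i. of_real (x i)) * (\<Prod>i\<in>UNIV. q i (x i)))"
    if f: "continuous_on complex_cube f" for f
  proof -
    have [measurable]: "T f \<in> borel_measurable borel" by (rule Tm[OF f])
    have "bounded (f ` complex_cube)"
      by (intro compact_imp_bounded compact_continuous_image f compact_complex_cube)
    then obtain B where B: "\<And>z. z \<in> complex_cube \<Longrightarrow> norm (f z) \<le> B" unfolding bounded_iff by blast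
    have TB: "norm (T f z) \<le> \<bar>B\<bar>" for z
      using B[of z] by (auto simp: T_def indicator_def)
    show ?thesis
    proof (rule Bochner_Integration.integrable_bound)
      show "integrable (\<Pi>\<^sub>M i\<in>UNIV. lborel) (\<lambda>x. of_real \<bar>B\<bar> * (\<Prod>i\<in>UNIV. q i (x i)))"
        by (intro integrable_mult_right product_integrable_prod q) auto
      show "AE x in \<Pi>\<^sub>M i\<in>UNIV. lborel. norm (T f (\<chi> i. of_real (x i)) * (\<Prod>i\<in>UNIV. q i (x i)))
          \<le> norm (of_real \<bar>B\<bar> * (\<Prod>i\<in>UNIV. q i (x i)))"
        by (intro AE_I2) (auto simp: norm_mult intro!: mult_right_mono TB)
      show "(\<lambda>x. T f (\<chi> i. of_real (x i)) * (\<Prod>i\<in>UNIV. q i (x i))) \<in> borel_measurable (\<Pi>\<^sub>M i\<in>UNIV. lborel)"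
        by measurable
    qed
  qed
  have rep: "gegenbauer_coeff lam f k = (LINT x|(\<Pi>\<^sub>M i\<in>UNIV. lborel). T f (\<chi> i. of_real (x i)) * (\<Prod>i\<in>UNIV. q i (x i)))"
    if "continuous_on complex_cube f" for f
    unfolding T_def q_def
    by (rule gegenbauer_coeff_eq_product_integral[OF lam compact_imp_closed[OF compact_complex_cube] subset_refl that])
  have "gegenbauer_coeff lam f k - gegenbauer_coeff lam g k
      = (LINT x|(\<Pi>\<^sub>M i\<in>UNIV. lborel). T (\<lambda>z. f z - g z) (\<chi> i. of_real (x i)) * (\<Prod>i\<in>UNIV. q i (x i)))"
    unfolding rep[OF f] rep[OF g] Bochner_Integration.integral_diff[OF int[OF f] int[OF g], symmetric]
    by (intro Bochner_Integration.integral_cong) (simp_all add: T_def algebra_simps)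
  also have "norm \<dots> \<le> e * (\<Prod>i\<in>UNIV. LINT t|lborel. norm (q i t))"
    using e by (intro norm_product_integral_le[where \<psi> = "\<lambda>_. of_real"] q) (auto simp: T_def indicator_def)
  finally show ?thesis by (simp only: q_def)
qed

section \<open>The bound for functions holomorphic on the filled polyellipse\<close>

lemma gegenbauer_poly_0: "lam > 0 \<Longrightarrow> poly (gegenbauer_poly lam 0) x = 1"
  by (simp add: gegenbauer_poly_def gegenbauer_at_1_def gegenbauer_coeff_at_1_def poly_pcompose)

text \<open>As \<open>C_0 = 1\<close>, the density is nonnegative and its norm is its mass, which is
  the kernel integral at v = 0 with n = 0.\<close>

lemma gegenbauer_density_0_norm:
  assumes lam: "lam > 0"
  shows "(LINT t|lborel. norm (complex_of_real (gegenbauer_density lam 0 t))) \<le> 1"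
proof -
  have "gegenbauer_h lam 0 > 0"
    unfolding gegenbauer_h_eq[OF lam] by (intro weight_functional_square_pos lam gegenbauer_poly_nonzero)
  hence nn: "gegenbauer_density lam 0 t \<ge> 0" for t
    using gegenbauer_poly_0[OF lam] lam
    by (auto simp: gegenbauer_density_def gegenbauer_eq gegenbauer_weight_def)
  have "(LINT t|lborel. norm (complex_of_real (gegenbauer_density lam 0 t))) = (LINT t|lborel. gegenbauer_density lam 0 t)"
    using nn by simp
  also have "\<dots> \<le> norm (LINT t|lborel. complex_of_real (gegenbauer_density lam 0 t))"
    unfolding integral_complex_of_real norm_of_real by simp
  also have "\<dots> \<le> 1"
    using gegenbauer_kernel_bound[OF lam, of 0 0] Gamma_real_pos[OF lam] by (cases "lam \<ge> 1") auto
  finally show ?thesis .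
qed

lemma bernstein_ellipse_1: "x \<in> {-1..1} \<Longrightarrow> of_real x \<in> bernstein_ellipse 1"
  unfolding bernstein_ellipse_def mem_Collect_eq
  by (rule exI[of _ "cis (arccos x)"], unfold cis_inverse) (auto simp: complex_eq_iff)

text \<open>The share of one coordinate in the claimed bound, still with its own power of its own
  radius.\<close>

definition coeff_factor :: "real \<Rightarrow> nat \<Rightarrow> real \<Rightarrow> real" where
  "coeff_factor lam n \<rho> = ellipse_length \<rho> / (pi * \<rho> ^ n) *
     (if n = 0 then D_bar lam \<rho> else real n powr (1 - lam) * D_const lam \<rho>)"

lemma ellipse_length_ge: "\<rho> > 0 \<Longrightarrow> ellipse_length \<rho> \<ge> pi * \<rho>"
  using integral_norm_ellipse_ge[of \<rho>] by (simp add: ellipse_length_eq)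

lemma ellipse_length_nonneg: "\<rho> > 0 \<Longrightarrow> ellipse_length \<rho> \<ge> 0"
  using ellipse_length_ge[of \<rho>] mult_pos_pos[of pi \<rho>] pi_gt_zero by linarith

lemma coeff_factor_nonneg: "lam > 0 \<Longrightarrow> \<rho> > 0 \<Longrightarrow> coeff_factor lam n \<rho> \<ge> 0"
  using ellipse_length_nonneg[of \<rho>]
  by (auto simp: coeff_factor_def D_bar_def D_const_def intro!: mult_nonneg_nonneg divide_nonneg_nonneg Gamma_real_nonneg)

text \<open>At radius 1 the factor is the length over pi times 2^(lam - 1); both are at least 1, the
  first by \<open>ellipse_length_ge\<close>, the second since lam >= 1.\<close>

lemma density_0_le_coeff_factor:
  assumes "lam \<ge> 1"
  shows "(LINT t|lborel. norm (complex_of_real (gegenbauer_density lam 0 t))) \<le> coeff_factor lam 0 1"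
proof -
  have "(LINT t|lborel. norm (complex_of_real (gegenbauer_density lam 0 t))) \<le> 1 * 1"
    using gegenbauer_density_0_norm[of lam] assms by simp
  also have "\<dots> \<le> ellipse_length 1 / pi * (2 powr (lam - 1))"
    using ellipse_length_ge[of 1] ellipse_length_nonneg[of 1] assms by (intro mult_mono ge_one_powr_ge_zero) auto
  also have "\<dots> = coeff_factor lam 0 1" using assms by (simp add: coeff_factor_def D_bar_def)
  finally show ?thesis .
qed

lemma coeff_kernel_le_coeff_factor:
  assumes lam: "lam > 0" and \<rho>: "\<rho> > 1"
  shows "(LINT t|lborel. norm (coeff_kernel lam n \<rho> t)) \<le> coeff_factor lam n \<rho>"
proof -
  define C where "C = (if lam \<ge> 1 then (1 + 1 / \<rho>\<^sup>2) powr (lam - 1) else (1 - 1 / \<rho>\<^sup>2) powr (lam - 1))"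
  define E where "E = (if lam \<ge> 1 then exp (1 / 12) else exp (1 / 12 + (1 - lam) / (2 * lam)))"
  define a where "a = ellipse_length \<rho> / (pi * \<rho> ^ n) * (C / \<rho>)"
  have C: "C \<ge> 0" by (simp add: C_def)
  have G: "Gamma lam > 0" using lam by (rule Gamma_real_pos)
  have a: "a \<ge> 0"
    unfolding a_def using C ellipse_length_nonneg[of \<rho>] \<rho> by (auto intro!: mult_nonneg_nonneg divide_nonneg_nonneg)
  have "(LINT t|lborel. norm (coeff_kernel lam n \<rho> t)) \<le> a * (Gamma lam * (fact n / Gamma (real n + lam)))"
    using coeff_kernel_integral(2)[OF lam \<rho>, of n] by (simp add: C_def[symmetric] a_def power_one_over mult_ac)
  also have "\<dots> \<le> coeff_factor lam n \<rho>"
  proof (cases "n = 0")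
    case True
    have "D_bar lam \<rho> = C / \<rho>" by (simp add: D_bar_def C_def)
    thus ?thesis using True G by (simp add: coeff_factor_def a_def)
  next
    case False
    have "D_const lam \<rho> = Gamma lam * E * (C / \<rho>)" by (simp add: D_const_def C_def E_def)
    hence "coeff_factor lam n \<rho> = a * (Gamma lam * (real n powr (1 - lam) * E))"
      using False by (simp add: coeff_factor_def a_def)
    thus ?thesis
      using mult_left_mono[OF mult_left_mono[OF Gamma_ratio_bound[OF lam False] less_imp_le[OF G]] a]
      by (simp only: E_def)
  qed
  finally show ?thesis .
qed

text \<open>Holomorphy is asked in one variable at a time with the others frozen, which is the form
  Cauchy's formula consumes. Cutting f off to the filled polyellipse makes it Borel and bounded
  everywhere, as the exchange of coordinates requires.\<close>

lemma gegenbauer_coeff_bound: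
  fixes f :: "complex ^ 'd \<Rightarrow> complex" and k :: "nat ^ 'd" and r :: "real ^ 'd"
  assumes lam: "lam > 0"
    and r: "\<And>i. r $ i > 1 \<or> r $ i = 1 \<and> k $ i = 0 \<and> lam \<ge> 1"
    and cont: "continuous_on (filled_poly_ellipse r) f"
    and hol: "\<And>i z. (\<And>j. j \<noteq> i \<Longrightarrow> z $ j \<in> filled_ellipse (r $ j)) \<Longrightarrow>
         (\<lambda>w. f (\<chi> j. if j = i then w else z $ j)) holomorphic_on filled_ellipse (r $ i)"
    and M: "\<And>z. z \<in> poly_ellipse r \<Longrightarrow> norm (f z) \<le> M" "M \<ge> 0"
  shows "norm (gegenbauer_coeff lam f k) \<le> M * (\<Prod>i\<in>UNIV. coeff_factor lam (k $ i) (r $ i))"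
proof -
  have r0: "r $ i > 0" for i using r[of i] by auto
  define X where "X = filled_poly_ellipse r"
  have X: "compact X" "complex_cube \<subseteq> X" "poly_ellipse r \<subseteq> X"
    unfolding X_def by (intro compact_filled_poly_ellipse complex_cube_subset_filled poly_ellipse_subset_filled r0)+
  define F where "F = (\<lambda>z. indicator X z *\<^sub>R f z)"
  have Fm: "F \<in> borel_measurable borel"
    unfolding F_def using cont
    by (intro borel_measurable_continuous_on_indicator borel_closed compact_imp_closed[OF X(1)]) (simp add: X_def)
  have "bounded (f ` X)" using cont X(1) by (intro compact_imp_bounded compact_continuous_image) (auto simp: X_def)
  then obtain B where B: "\<And>z. z \<in> X \<Longrightarrow> norm (f z) \<le> B" unfolding bounded_iff by blast
  have FB: "norm (F z) \<le> \<bar>B\<bar>" for z using B[of z] by (auto simp: F_def indicator_def)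
  define p where "p = (\<lambda>i t. complex_of_real (gegenbauer_density lam (k $ i) t))"
  define q where "q = (\<lambda>i. if r $ i > 1 then coeff_kernel lam (k $ i) (r $ i) else p i)"
  define \<psi> :: "'d \<Rightarrow> real \<Rightarrow> complex" where "\<psi> = (\<lambda>i. if r $ i > 1 then ellipse_point (r $ i) else of_real)"
  have p: "integrable lborel (p i)" for i
    unfolding p_def by (intro integrable_of_real gegenbauer_density_integrable lam)
  have q: "integrable lborel (q i)" for i
    using p coeff_kernel_integral(1)[OF lam] by (simp add: q_def)
  have \<psi>m: "\<psi> i \<in> borel_measurable borel" for i
    unfolding \<psi>_def using borel_measurable_continuous_onI[OF continuous_on_ellipse_point[OF r0[of i]]] by simp
  have "gegenbauer_coeff lam f k = (LINT x|(\<Pi>\<^sub>M i\<in>UNIV. lborel). F (\<chi> i. of_real (x i)) * (\<Prod>i\<in>UNIV. p i (x i)))"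
    unfolding F_def p_def using cont
    by (intro gegenbauer_coeff_eq_product_integral lam X compact_imp_closed) (simp add: X_def)
  also have "\<dots> = (LINT x|(\<Pi>\<^sub>M i\<in>UNIV. lborel). F (\<chi> i. \<psi> i (x i)) * (\<Prod>i\<in>UNIV. q i (x i)))"
  proof (rule integral_exchange_coordinates[OF Fm FB _ \<psi>m p q])
    fix i and z :: "complex ^ 'd"
    show "(LINT t|lborel. F (\<chi> j. if j = i then of_real t else z $ j) * p i t)
        = (LINT t|lborel. F (\<chi> j. if j = i then \<psi> i t else z $ j) * q i t)"
    proof (cases "r $ i > 1 \<and> (\<forall>j. j \<noteq> i \<longrightarrow> z $ j \<in> filled_ellipse (r $ j))")
      case True
      define g where "g = (\<lambda>w. f (\<chi> j. if j = i then w else z $ j))"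
      have Fg: "F (\<chi> j. if j = i then w else z $ j) = g w" if "w \<in> filled_ellipse (r $ i)" for w
        using True that by (auto simp: F_def g_def X_def filled_poly_ellipse_def indicator_def)
      have "(LINT t|lborel. F (\<chi> j. if j = i then of_real t else z $ j) * p i t) = (LINT t|lborel. g (of_real t) * of_real (gegenbauer_density lam (k $ i) t))"
      proof (intro Bochner_Integration.integral_cong refl)
        fix t
        show "F (\<chi> j. if j = i then of_real t else z $ j) * p i t = g (of_real t) * of_real (gegenbauer_density lam (k $ i) t)"
          using Fg[OF interval_subset_filled_ellipse[OF r0 gegenbauer_density_support]]
          by (cases "gegenbauer_density lam (k $ i) t = 0") (auto simp: p_def)
      qed
      also have "\<dots> = (LINT t|lborel. g (ellipse_point (r $ i) t) * coeff_kernel lam (k $ i) (r $ i) t)"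
        using True unfolding g_def by (intro coeff_kernel_reproduces lam hol) auto
      also have "\<dots> = (LINT t|lborel. F (\<chi> j. if j = i then \<psi> i t else z $ j) * q i t)"
      proof (intro Bochner_Integration.integral_cong refl)
        fix t
        have "\<psi> i t = ellipse_point (r $ i) t" "q i t = coeff_kernel lam (k $ i) (r $ i) t"
          using True by (simp_all add: \<psi>_def q_def)
        moreover have "ellipse_point (r $ i) t \<in> filled_ellipse (r $ i)"
          using bernstein_ellipse_subset_filled[OF r0] ellipse_point_in_bernstein[OF r0] by blast
        ultimately show "g (ellipse_point (r $ i) t) * coeff_kernel lam (k $ i) (r $ i) t
            = F (\<chi> j. if j = i then \<psi> i t else z $ j) * q i t"
          by (simp only: Fg)
      qed
      finally show ?thesis .
    next
      case False
      show ?thesis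
      proof (cases "r $ i > 1")
        case True
        \<comment> \<open>If a frozen coordinate lies outside its filled ellipse, F vanishes along
          the whole line and both integrals are zero.\<close>
        with False obtain j where j: "j \<noteq> i" "z $ j \<notin> filled_ellipse (r $ j)" by blast
        hence "(\<chi> j. if j = i then w else z $ j) \<notin> X" for w
          by (auto simp: X_def filled_poly_ellipse_def)
        thus ?thesis by (simp add: F_def)
      next
        case False
        hence "\<psi> i = of_real" "q i = p i" by (simp_all add: \<psi>_def q_def)
        thus ?thesis by (simp only:)
      qed
    qed
  qed simp
  also have "norm \<dots> \<le> M * (\<Prod>i\<in>UNIV. coeff_factor lam (k $ i) (r $ i))"
  proof (rule norm_product_integral_le[OF q _ M(2)])
    fix x :: "'d \<Rightarrow> real" assume x: "\<And>i. q i (x i) \<noteq> 0"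
    have "\<psi> i (x i) \<in> bernstein_ellipse (r $ i)" for i
    proof (cases "r $ i > 1")
      case True
      thus ?thesis by (simp add: \<psi>_def ellipse_point_in_bernstein)
    next
      case False
      hence "p i (x i) \<noteq> 0" using x[of i] by (simp add: q_def)
      hence "x i \<in> {-1..1}" unfolding p_def of_real_eq_0_iff by (rule gegenbauer_density_support)
      moreover have "r $ i = 1" using False r[of i] by auto
      ultimately show ?thesis using bernstein_ellipse_1[of "x i"] by (simp add: \<psi>_def)
    qed
    hence "(\<chi> i. \<psi> i (x i)) \<in> poly_ellipse r" by (simp add: poly_ellipse_def)
    thus "norm (F (\<chi> i. \<psi> i (x i))) \<le> M" using M X(3) by (auto simp: F_def indicator_def)
  next
    fix i
    show "(LINT t|lborel. norm (q i t)) \<le> coeff_factor lam (k $ i) (r $ i)"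
    proof (cases "r $ i > 1")
      case True
      thus ?thesis using coeff_kernel_le_coeff_factor[OF lam] by (simp add: q_def)
    next
      case False
      thus ?thesis using r[of i] density_0_le_coeff_factor[of lam] by (auto simp: q_def p_def)
    qed
  qed
  finally show ?thesis .
qed

section \<open>The domain of analyticity\<close>

text \<open>On the nonnegative axis sinh is convex with value 0 at 0. Inverting gives the lower
  bound on arsinh that compares each radius with a power of rho.\<close>

lemma sinh_mult_le:
  assumes "a \<ge> 0" "0 \<le> c" "c \<le> (1::real)"
  shows "sinh (c * a) \<le> c * sinh a"
proof -
  have "convex_on {0..} (sinh :: real \<Rightarrow> real)"
  proof (rule convex_on_realI)
    show "(sinh has_real_derivative cosh x) (at x)" for x :: real
      by (auto intro!: derivative_eq_intros)
    show "cosh x \<le> cosh y" if "x \<in> {0..}" "y \<in> {0..}" "x \<le> y" for x y :: real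
      using that by (simp add: cosh_real_nonneg_le_iff)
  qed auto
  from convex_onD[OF this, of c 0 a] show ?thesis using assms by simp
qed

lemma arsinh_mult_ge:
  assumes "h \<ge> 0" "0 \<le> c" "c \<le> (1::real)"
  shows "c * arsinh h \<le> arsinh (c * h)"
proof -
  have "0 \<le> sinh (arsinh h)" using assms by simp
  hence "arsinh h \<ge> 0" by (simp only: sinh_real_nonneg_iff)
  hence "sinh (c * arsinh h) \<le> sinh (arsinh (c * h))"
    using sinh_mult_le[of "arsinh h" c] assms by simp
  thus ?thesis by (simp only: sinh_real_le_iff)
qed

section \<open>The multi-index and the radii\<close>

lemma index_ratio_le_1: "real (k $ i) / index_norm k \<le> 1"
proof -
  have "real (k $ i) ^ 2 \<le> (\<Sum>j\<in>UNIV. (real (k $ j))\<^sup>2)"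
    by (rule member_le_sum) auto
  hence "real (k $ i) \<le> index_norm k"
    unfolding index_norm_def by (rule real_le_rsqrt)
  thus ?thesis by (auto simp: divide_le_eq_1)
qed

lemma index_norm_nonneg: "index_norm k \<ge> 0"
  by (simp add: index_norm_def sum_nonneg)

text \<open>For the zero multi-index all ratios are 0 because x / 0 = 0. The value 1 yields the
  exponent \<open>index_norm k\<close>; the domain estimate uses that the sum is at most 1.\<close>

lemma sum_index_ratio_squares:
  "(\<Sum>i\<in>UNIV. (real (k $ i) / index_norm k)\<^sup>2) = (if index_norm k = 0 then 0 else 1)"
proof -
  have "(\<Sum>i\<in>UNIV. (real (k $ i) / index_norm k)\<^sup>2) = (\<Sum>i\<in>UNIV. (real (k $ i))\<^sup>2) / (index_norm k)\<^sup>2"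
    by (simp add: power_divide sum_divide_distrib)
  also have "(\<Sum>i\<in>UNIV. (real (k $ i))\<^sup>2) = (index_norm k)\<^sup>2"
    by (simp add: index_norm_def sum_nonneg)
  finally show ?thesis by simp
qed

lemma rho_hat_eq:
  "rho_hat h eps k $ i = sqrt ((real (k $ i) / index_norm k * h)\<^sup>2 + eps) + sqrt (1 + ((real (k $ i) / index_norm k * h)\<^sup>2 + eps))"
  by (simp add: rho_hat_def Let_def add.assoc)

text \<open>Here rho is exp (arsinh h), and the i-th radius is at least exp (arsinh (c_i h)), hence
  at least rho to the power c_i. The exponents k_i c_i add up to the norm of k because c_i is k_i
  over that norm.\<close>

lemma powr_index_norm_le_prod_rho_hat:
  assumes h: "h > 0" and eps: "eps \<ge> 0"
  shows "(h + sqrt (1 + h\<^sup>2)) powr index_norm k \<le> (\<Prod>i\<in>UNIV. (rho_hat h eps k $ i) ^ (k $ i))"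
proof -
  define c where "c = (\<lambda>i. real (k $ i) / index_norm k)"
  define N where "N = index_norm k"
  have N: "N \<ge> 0" unfolding N_def by (rule index_norm_nonneg)
  have c: "0 \<le> c i" "c i \<le> 1" for i
    using index_ratio_le_1[of k i] index_norm_nonneg[of k] by (auto simp: c_def)
  have exp_arsinh: "exp (arsinh x) = x + sqrt (1 + x\<^sup>2)" if "x \<ge> 0" for x :: real
  proof -
    have "sqrt (x\<^sup>2 + 1) > 0" by (simp add: add_nonneg_pos)
    hence "x + sqrt (x\<^sup>2 + 1) > 0" using that by linarith
    thus ?thesis by (simp add: arsinh_real_def add.commute)
  qed
  have "exp (real (k $ i) * (c i * arsinh h)) \<le> (rho_hat h eps k $ i) ^ (k $ i)" for i
  proof -
    have "exp (c i * arsinh h) \<le> exp (arsinh (c i * h))"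
      using arsinh_mult_ge[of h "c i"] c[of i] h by simp
    also have "\<dots> = sqrt ((c i * h)\<^sup>2) + sqrt (1 + (c i * h)\<^sup>2)"
      using c[of i] h by (subst exp_arsinh) auto
    also have "\<dots> \<le> rho_hat h eps k $ i"
    proof -
      have "rho_hat h eps k $ i = sqrt ((c i * h)\<^sup>2 + eps) + sqrt (1 + ((c i * h)\<^sup>2 + eps))"
        by (simp only: rho_hat_eq c_def)
      thus ?thesis using eps by (simp only:) (intro add_mono real_sqrt_le_mono, simp_all)
    qed
    finally have "exp (c i * arsinh h) ^ (k $ i) \<le> (rho_hat h eps k $ i) ^ (k $ i)"
      by (intro power_mono) auto
    thus ?thesis by (simp add: exp_of_nat_mult)
  qed
  hence "(\<Prod>i\<in>UNIV. exp (real (k $ i) * (c i * arsinh h))) \<le> (\<Prod>i\<in>UNIV. (rho_hat h eps k $ i) ^ (k $ i))"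
    by (intro prod_mono) auto
  moreover have "(\<Prod>i\<in>UNIV. exp (real (k $ i) * (c i * arsinh h))) = exp (\<Sum>i\<in>UNIV. real (k $ i) * (c i * arsinh h))"
    by (simp add: exp_sum)
  moreover have "(\<Sum>i\<in>UNIV. real (k $ i) * (c i * arsinh h)) = N * arsinh h"
  proof (cases "N = 0")
    case True
    thus ?thesis by (simp add: c_def N_def)
  next
    case False
    have "(\<Sum>i\<in>UNIV. real (k $ i) * (c i * arsinh h)) = (\<Sum>i\<in>UNIV. (c i)\<^sup>2) * (N * arsinh h)"
      unfolding sum_distrib_right using False
      by (intro sum.cong) (auto simp: c_def N_def[symmetric] power2_eq_square)
    also have "(\<Sum>i\<in>UNIV. (c i)\<^sup>2) = 1" using sum_index_ratio_squares[of k] False by (simp add: c_def N_def)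
    finally show ?thesis by simp
  qed
  moreover have "exp (N * arsinh h) = (h + sqrt (1 + h\<^sup>2)) powr N"
    using h by (simp add: exp_arsinh[symmetric] powr_def del: exp_arsinh)
  ultimately show ?thesis by (simp add: N_def)
qed

text \<open>Squaring the sum of the distances to -1 and 1 produces, by the parallelogram law, twice
  the sum of the distances of \<open>z^2\<close> to 0 and 1, plus 2.\<close>

lemma filled_ellipse_square:
  assumes z: "z \<in> filled_ellipse (sqrt b + sqrt (1 + b))" and b: "b \<ge> 0"
  shows "cmod (z\<^sup>2) + cmod (z\<^sup>2 - 1) \<le> 2 * b + 1"
proof -
  define S where "S = cmod (z - 1) + cmod (z + 1)"
  have pos: "sqrt b + sqrt (1 + b) > 0" using b by (simp add: add_nonneg_pos)
  have "(sqrt (1 + b) - sqrt b) * (sqrt b + sqrt (1 + b)) = 1"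
    using b by (simp add: algebra_simps flip: real_sqrt_mult) 
  hence inv: "1 / (sqrt b + sqrt (1 + b)) = sqrt (1 + b) - sqrt b"
    using pos by (simp add: field_simps)
  have "S \<le> 2 * sqrt (1 + b)" using z by (simp add: S_def filled_ellipse_def inv)
  hence "S\<^sup>2 \<le> (2 * sqrt (1 + b))\<^sup>2" by (intro power_mono) (auto simp: S_def)
  also have "\<dots> = 4 * (1 + b)" using b by (simp add: power_mult_distrib)
  finally have S2: "S\<^sup>2 \<le> 4 * (1 + b)" .
  have "cmod (z - 1) ^ 2 + cmod (z + 1) ^ 2 = 2 * cmod z ^ 2 + 2"
    by (simp add: cmod_power2) (simp add: power2_eq_square algebra_simps)
  moreover have "cmod (z - 1) * cmod (z + 1) = cmod (z\<^sup>2 - 1)"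
    by (simp add: power2_eq_square algebra_simps flip: norm_mult)
  ultimately have "S\<^sup>2 = 2 * cmod (z\<^sup>2) + 2 + 2 * cmod (z\<^sup>2 - 1)"
    by (simp add: S_def power2_sum norm_power)
  with S2 show ?thesis by simp
qed

text \<open>The polyellipse may touch the boundary of the region of analyticity, but since \<open>0\<close> lies
  strictly inside the ellipse bounding \<open>N_region\<close>, every proper dilation moves it into the interior.\<close>

lemma dilation_in_D_region:
  fixes z :: "complex ^ 'd" and k :: "nat ^ 'd"
  assumes h: "h > 0" and eps: "eps \<ge> 0" and z: "z \<in> filled_poly_ellipse (rho_hat h eps k)"
    and s: "0 \<le> s" "s < 1"
  shows "s *\<^sub>R z \<in> D_region h eps"
proof -
  define d where "d = real CARD('d)"
  define a where "a = h\<^sup>2 + d * eps"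
  define b where "b = (\<lambda>i. (real (k $ i) / index_norm k * h)\<^sup>2 + eps)"
  define S where "S = (\<Sum>i\<in>UNIV. (z $ i)\<^sup>2)"
  have a: "a > 0" using h eps by (simp add: a_def d_def add_pos_nonneg)
  \<comment> \<open>Coordinatewise squares have foci 0 and 1; by the triangle inequality their sum
    is controlled with respect to the foci 0 and d.\<close>
  have "cmod S + cmod (S - of_real d) \<le> (\<Sum>i\<in>UNIV. cmod ((z $ i)\<^sup>2)) + (\<Sum>i\<in>UNIV. cmod ((z $ i)\<^sup>2 - 1))"
  proof (rule add_mono)
    show "cmod S \<le> (\<Sum>i\<in>UNIV. cmod ((z $ i)\<^sup>2))" unfolding S_def by (rule norm_sum)
    have "S - of_real d = (\<Sum>i\<in>UNIV. (z $ i)\<^sup>2 - 1)" by (simp add: S_def d_def sum_subtractf)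
    thus "cmod (S - of_real d) \<le> (\<Sum>i\<in>UNIV. cmod ((z $ i)\<^sup>2 - 1))" by (simp only: norm_sum)
  qed
  also have "\<dots> = (\<Sum>i\<in>UNIV. cmod ((z $ i)\<^sup>2) + cmod ((z $ i)\<^sup>2 - 1))" by (simp add: sum.distrib)
  also have "\<dots> \<le> (\<Sum>i\<in>UNIV. 2 * b i + 1)"
  proof (rule sum_mono)
    fix i
    have "z $ i \<in> filled_ellipse (sqrt (b i) + sqrt (1 + b i))"
      using z unfolding filled_poly_ellipse_def b_def rho_hat_eq[symmetric] by simp
    thus "cmod ((z $ i)\<^sup>2) + cmod ((z $ i)\<^sup>2 - 1) \<le> 2 * b i + 1"
      using eps by (intro filled_ellipse_square) (auto simp: b_def)
  qed
  also have "\<dots> = 2 * (h\<^sup>2 * (\<Sum>i\<in>UNIV. (real (k $ i) / index_norm k)\<^sup>2) + d * eps) + d"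
  proof -
    have "b i = h\<^sup>2 * (real (k $ i) / index_norm k)\<^sup>2 + eps" for i
      by (simp only: b_def power_mult_distrib mult.commute)
    thus ?thesis by (simp add: d_def sum.distrib algebra_simps flip: sum_distrib_left)
  qed
  also have "\<dots> \<le> 2 * (h\<^sup>2 * 1 + d * eps) + d"
    unfolding sum_index_ratio_squares by simp
  finally have S: "cmod S + cmod (S - of_real d) \<le> d + 2 * a" by (simp add: a_def)
  have s2: "s\<^sup>2 < 1" using s by (simp add: power_less_one_iff abs_square_less_1)
  have e: "(\<Sum>i\<in>UNIV. ((s *\<^sub>R z) $ i)\<^sup>2) = of_real (s\<^sup>2) * S"
  proof -
    have "(s *\<^sub>R z) $ i = of_real s * z $ i" for i
      unfolding vector_scaleR_component by (rule scaleR_conv_of_real)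
    thus ?thesis by (simp add: S_def sum_distrib_left power_mult_distrib)
  qed
  \<comment> \<open>The dilated sum \<open>s^2 S\<close> is a convex combination of S and the focus
    0, for which the sum of distances is only d; since a > 0 the value drops strictly below d + 2
    a.\<close>
  have "of_real (s\<^sup>2) * S - of_real d = of_real (s\<^sup>2) * (S - of_real d) - of_real ((1 - s\<^sup>2) * d)"
    by (simp add: algebra_simps)
  hence "cmod (of_real (s\<^sup>2) * S - of_real d) \<le> s\<^sup>2 * cmod (S - of_real d) + (1 - s\<^sup>2) * d"
    using norm_triangle_ineq4[of "of_real (s\<^sup>2) * (S - of_real d)" "of_real ((1 - s\<^sup>2) * d)"] s2
    unfolding norm_mult[of "of_real (s\<^sup>2)"] norm_of_real by (simp add: d_def)
  moreover have "cmod (of_real (s\<^sup>2) * S) = s\<^sup>2 * cmod S"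
    unfolding norm_mult norm_of_real by simp
  ultimately have "cmod (of_real (s\<^sup>2) * S) + cmod (of_real (s\<^sup>2) * S - of_real d)
      \<le> s\<^sup>2 * (cmod S + cmod (S - of_real d)) + (1 - s\<^sup>2) * d"
    by (simp add: algebra_simps)
  also have "\<dots> \<le> s\<^sup>2 * (d + 2 * a) + (1 - s\<^sup>2) * d"
    using S by (intro add_right_mono mult_left_mono) auto
  also have "\<dots> = d + s\<^sup>2 * (2 * a)" by (simp add: algebra_simps)
  also have "\<dots> < d + 2 * a" using a s2 by simp
  finally show ?thesis
    unfolding D_region_def N_region_def mem_Collect_eq e by (simp add: d_def a_def)
qed

text \<open>The squares of real points sum to a point on the segment between the foci, where the sum
  of distances equals d, so the cube lies in the open region undilated.\<close>

lemma complex_cube_subset_D_region: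
  assumes h: "h > 0" and eps: "eps \<ge> 0"
  shows "(complex_cube :: (complex ^ 'd) set) \<subseteq> D_region h eps"
proof
  fix z :: "complex ^ 'd" assume z: "z \<in> complex_cube"
  define d where "d = real CARD('d)"
  have "\<forall>i. \<exists>x. z $ i = of_real x \<and> x \<in> {-1..1}" using z unfolding complex_cube_def by blast
  then obtain x where x: "\<And>i. z $ i = of_real (x i)" "\<And>i. x i \<in> {-1..1}" by metis
  define S where "S = (\<Sum>i\<in>UNIV. (x i)\<^sup>2)"
  have S0: "S \<ge> 0" by (simp add: S_def sum_nonneg)
  have "S \<le> (\<Sum>i\<in>(UNIV :: 'd set). 1)"
    unfolding S_def using x(2) by (intro sum_mono) (simp add: abs_square_le_1 abs_le_iff)
  hence S1: "S \<le> d" by (simp add: d_def)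
  have "(\<Sum>i\<in>UNIV. (z $ i)\<^sup>2) = of_real S" by (simp add: S_def x(1))
  moreover have "cmod (of_real S - of_real d) = d - S"
    using S1 by (metis abs_minus_commute abs_of_nonneg diff_ge_0_iff_ge norm_of_real of_real_diff)
  moreover have "h\<^sup>2 + d * eps > 0" using h eps by (simp add: d_def add_pos_nonneg)
  ultimately show "z \<in> D_region h eps"
    unfolding D_region_def N_region_def mem_Collect_eq using S0 by (simp add: d_def)
qed

text \<open>A radius equal to 1 forces eps = 0, hence lam >= 1, and c_i h = 0, hence k_i =
  0.\<close>

lemma rho_hat_cases:
  fixes lam h eps :: real
  assumes h: "h > 0" and eps: "if lam < 1 then eps > 0 else eps = 0"
  shows "rho_hat h eps k $ i > 1 \<or> rho_hat h eps k $ i = 1 \<and> k $ i = 0 \<and> lam \<ge> 1"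
proof -
  define b where "b = (real (k $ i) / index_norm k * h)\<^sup>2 + eps"
  have r: "rho_hat h eps k $ i = sqrt b + sqrt (1 + b)" by (simp add: rho_hat_eq b_def)
  have b0: "b \<ge> 0" using eps by (auto simp: b_def split: if_splits)
  show ?thesis
  proof (cases "b = 0")
    case True
    hence "eps = 0" "real (k $ i) / index_norm k * h = 0"
      using eps by (auto simp: b_def add_nonneg_eq_0_iff split: if_splits)
    moreover have "index_norm k \<noteq> 0" if "k $ i \<noteq> 0"
      using that member_le_sum[of i UNIV "\<lambda>i. (real (k $ i))\<^sup>2"] by (auto simp: index_norm_def)
    ultimately have "k $ i = 0" "lam \<ge> 1" using h eps by (auto simp: not_less split: if_splits)
    thus ?thesis using True by (simp add: r)
  next
    case False
    hence "sqrt b > 0" "sqrt (1 + b) > 1" using b0 by auto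
    hence "rho_hat h eps k $ i > 1" unfolding r by linarith
    thus ?thesis ..
  qed
qed

section \<open>Functions of several variables and the final bound\<close>

lemma mv_analytic_on_imp_continuous_on:
  assumes "mv_analytic_on f S"
  shows "continuous_on S f"
proof (rule continuous_at_imp_continuous_on, rule ballI)
  fix z assume "z \<in> S"
  with assms obtain e where e: "e > 0" "\<forall>w\<in>ball z e. \<exists>f'. (f has_derivative f') (at w) \<and> (\<forall>c v. f' (c *s v) = c * f' v)"
    unfolding mv_analytic_on_def by blast
  from e(2)[rule_format, of z] e(1) obtain f' where "(f has_derivative f') (at z)" by auto
  thus "isCont f z" by (rule has_derivative_continuous)
qed

text \<open>Along one coordinate the argument moves affinely, as \<open>c + w *s v\<close>. The
  chain rule gives a real derivative, and complex homogeneity of \<open>f'\<close> turns it into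
  multiplication by \<open>f' v\<close>.\<close>

lemma mv_analytic_on_coordinate:
  fixes f :: "complex ^ 'd \<Rightarrow> complex" and z :: "complex ^ 'd"
  assumes f: "mv_analytic_on f S"
    and w: "s *\<^sub>R (\<chi> j. if j = i then w else z $ j) \<in> S"
  shows "(\<lambda>w. f (s *\<^sub>R (\<chi> j. if j = i then w else z $ j))) field_differentiable (at w)"
proof -
  define P where "P = (\<lambda>w. s *\<^sub>R (\<chi> j. if j = i then w else z $ j))"
  define v :: "complex ^ 'd" where "v = (\<chi> j. if j = i then of_real s else 0)"
  define c :: "complex ^ 'd" where "c = (\<chi> j. if j = i then 0 else s *\<^sub>R (z $ j))"
  have P: "P w = c + w *s v" for w
    unfolding vec_eq_iff by (auto simp: P_def c_def v_def) (simp add: scaleR_conv_of_real)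
  obtain e where e: "e > 0" "\<forall>w\<in>ball (P w) e. \<exists>f'. (f has_derivative f') (at w) \<and> (\<forall>c v. f' (c *s v) = c * f' v)"
    using f w unfolding mv_analytic_on_def P_def by blast
  then obtain f' where f': "(f has_derivative f') (at (P w))" "\<And>c v. f' (c *s v) = c * f' v"
    by (metis centre_in_ball)
  have "linear (\<lambda>w :: complex. w *s v)"
    by (rule linearI) (simp_all add: vec_eq_iff algebra_simps)
  hence "bounded_linear (\<lambda>w :: complex. w *s v)" by (simp add: linear_conv_bounded_linear)
  hence "((\<lambda>w. w *s v) has_derivative (\<lambda>w. w *s v)) (at w)" by (rule bounded_linear_imp_has_derivative)
  hence "(P has_derivative (\<lambda>w. w *s v)) (at w)"
    unfolding P by (auto intro!: derivative_eq_intros)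
  from diff_chain_at[OF this f'(1)] have "((\<lambda>w. f (P w)) has_derivative (\<lambda>x. f' v * x)) (at w)"
    by (simp add: o_def f'(2) mult.commute)
  hence "((\<lambda>w. f (P w)) has_field_derivative f' v) (at w)"
    by (simp add: has_field_derivative_def)
  thus ?thesis unfolding P_def field_differentiable_def by blast
qed

text \<open>\<open>N_region\<close> is open, so analyticity says nothing about f where the
  polyellipse meets the boundary of \<open>D_region\<close>. Continuity up to such points, the
  assumption \<open>boundary\<close>, makes the supremum an attained maximum and lets the dilations
  converge.\<close>

theorem theorem3p7:
  fixes f :: "complex ^ 'd \<Rightarrow> complex"
    and k :: "nat ^ 'd"
    and lam h eps :: real
  assumes lam: "lam > 0"
    and h: "h > 0"
    and eps: "if lam < 1 then eps > 0 else eps = 0"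
    and analytic: "mv_analytic_on f (D_region h eps)"
    and boundary: "continuous_on (D_region h eps \<union> poly_ellipse (rho_hat h eps k)) f"
  shows "cmod (gegenbauer_coeff lam f k) \<le>
     max_on_ellipse f (rho_hat h eps k) * poly_ellipse_length (rho_hat h eps k)
       / (pi ^ CARD('d) * (h + sqrt (1 + h\<^sup>2)) powr index_norm k)
     * (\<Prod>i | k $ i = 0. D_bar lam (rho_hat h eps k $ i))
     * (\<Prod>j | k $ j \<noteq> 0. real (k $ j) powr (1 - lam) * D_const lam (rho_hat h eps k $ j))"
proof -
  define r where "r = rho_hat h eps k"
  define M where "M = max_on_ellipse f r"
  define P where "P = (\<Prod>i\<in>UNIV. coeff_factor lam (k $ i) (r $ i))"
  define Q where "Q = (\<Prod>i\<in>UNIV. LINT t|lborel. norm (complex_of_real (gegenbauer_density lam (k $ i) t)))"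
  have eps0: "eps \<ge> 0" using eps by (auto split: if_splits)
  have r: "r $ i > 1 \<or> r $ i = 1 \<and> k $ i = 0 \<and> lam \<ge> 1" for i
    unfolding r_def by (rule rho_hat_cases[OF h eps])
  have r0: "r $ i > 0" for i using r[of i] by auto
  have P0: "P \<ge> 0" unfolding P_def by (intro prod_nonneg coeff_factor_nonneg lam r0)
  have Q0: "Q \<ge> 0" unfolding Q_def by (intro prod_nonneg) auto
  have cont: "continuous_on (D_region h eps) f" using analytic by (rule mv_analytic_on_imp_continuous_on)
  have cE: "compact (poly_ellipse r)" by (rule compact_poly_ellipse[OF r0])
  have "bounded (f ` poly_ellipse r)"
    by (intro compact_imp_bounded compact_continuous_image cE continuous_on_subset[OF boundary]) (auto simp: r_def)
  hence bdd: "bdd_above ((\<lambda>z. cmod (f z)) ` poly_ellipse r)"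
    unfolding bounded_iff by (auto intro: bdd_aboveI2)
  have M: "cmod (f z) \<le> M" if "z \<in> poly_ellipse r" for z
    unfolding M_def max_on_ellipse_def using that bdd by (rule cSUP_upper)
  have "(\<chi> i. ellipse_point (r $ i) 0) \<in> poly_ellipse r"
    by (simp add: poly_ellipse_def ellipse_point_in_bernstein r0)
  hence M0: "M \<ge> 0" using M norm_ge_zero order_trans by blast
  have approx: "cmod (gegenbauer_coeff lam f k) \<le> (M + e) * P + e * Q" if e: "e > 0" for e
  proof -
    \<comment> \<open>f and its dilation must be close on the polyellipse, to compare maxima, and on
      the cube, to compare coefficients. The compact set K holds both together with all their
      dilations, so f is uniformly continuous on it.\<close>
    define Y where "Y = poly_ellipse r \<union> (complex_cube :: (complex ^ 'd) set)"
    define K where "K = (\<lambda>(s :: real, z). s *\<^sub>R z) ` ({0..1} \<times> Y)"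
    have Y: "compact Y" unfolding Y_def by (intro compact_Un cE compact_complex_cube)
    have Yfill: "Y \<subseteq> filled_poly_ellipse r"
      unfolding Y_def using poly_ellipse_subset_filled[OF r0] complex_cube_subset_filled[OF r0] by blast
    have K: "compact K"
      unfolding K_def case_prod_beta by (intro compact_continuous_image compact_Times Y continuous_intros) auto
    have "K \<subseteq> D_region h eps \<union> poly_ellipse r"
    proof
      fix y assume "y \<in> K"
      then obtain s z where sz: "s \<in> {0..1}" "z \<in> Y" "y = s *\<^sub>R z" unfolding K_def by auto
      show "y \<in> D_region h eps \<union> poly_ellipse r"
      proof (cases "s = 1")
        case True
        thus ?thesis using sz complex_cube_subset_D_region[OF h eps0] by (auto simp: Y_def)
      next
        case False
        thus ?thesis using sz dilation_in_D_region[OF h eps0, of z k s] Yfill by (auto simp: r_def)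
      qed
    qed
    hence "uniformly_continuous_on K f"
      using K boundary by (intro compact_uniformly_continuous) (auto simp: r_def intro: continuous_on_subset)
    then obtain \<delta> where \<delta>: "\<delta> > 0" "\<And>x x'. x \<in> K \<Longrightarrow> x' \<in> K \<Longrightarrow> dist x' x < \<delta> \<Longrightarrow> dist (f x') (f x) < e"
      unfolding uniformly_continuous_on_def using e by metis
    obtain R where R: "\<And>z. z \<in> Y \<Longrightarrow> norm z \<le> R" "R > 0"
      using compact_imp_bounded[OF Y] unfolding bounded_pos by auto
    \<comment> \<open>For z in Y the points z and s z are then at distance at most delta / 2; the
      cap 1/2 keeps s nonnegative.\<close>
    define s where "s = 1 - min (1/2) (\<delta> / (2 * R))"
    have s: "0 \<le> s" "s < 1" using \<delta>(1) R(2) by (auto simp: s_def)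
    define g where "g = (\<lambda>z. f (s *\<^sub>R z))"
    have close: "cmod (f z - g z) \<le> e" if z: "z \<in> Y" for z
    proof -
      have zK: "z \<in> K" "s *\<^sub>R z \<in> K"
        unfolding K_def using z s by (force intro!: image_eqI[of _ _ "(1, z)"], force intro!: image_eqI[of _ _ "(s, z)"])
      have "z - s *\<^sub>R z = (1 - s) *\<^sub>R z" by (simp add: scaleR_diff_left)
      hence "dist z (s *\<^sub>R z) = (1 - s) * norm z" using s by (simp add: dist_norm)
      also have "\<dots> \<le> (\<delta> / (2 * R)) * R"
        using R z s \<delta>(1) by (intro mult_mono) (auto simp: s_def)
      also have "\<dots> < \<delta>" using R(2) \<delta>(1) by simp
      finally have "dist (f z) (f (s *\<^sub>R z)) < e" by (intro \<delta>(2) zK)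
      thus ?thesis by (simp add: dist_norm g_def)
    qed
    have inD: "s *\<^sub>R z \<in> D_region h eps" if "z \<in> filled_poly_ellipse r" for z
      using that s by (intro dilation_in_D_region[OF h eps0]) (auto simp: r_def)
    have gcont: "continuous_on (filled_poly_ellipse r) g"
      unfolding g_def by (rule continuous_on_compose2[OF cont]) (auto intro!: continuous_intros inD)
    have "cmod (gegenbauer_coeff lam g k) \<le> (M + e) * P"
      unfolding P_def
    proof (rule gegenbauer_coeff_bound[OF lam r gcont])
      fix i and z :: "complex ^ 'd"
      assume z: "\<And>j. j \<noteq> i \<Longrightarrow> z $ j \<in> filled_ellipse (r $ j)"
      show "(\<lambda>w. g (\<chi> j. if j = i then w else z $ j)) holomorphic_on filled_ellipse (r $ i)"
        unfolding holomorphic_on_def g_def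
      proof
        fix w assume "w \<in> filled_ellipse (r $ i)"
        hence "(\<chi> j. if j = i then w else z $ j) \<in> filled_poly_ellipse r"
          using z by (auto simp: filled_poly_ellipse_def)
        from mv_analytic_on_coordinate[OF analytic inD[OF this]]
        show "(\<lambda>w. f (s *\<^sub>R (\<chi> j. if j = i then w else z $ j))) field_differentiable at w within filled_ellipse (r $ i)"
          by (rule field_differentiable_at_within)
      qed
    next
      fix z assume z: "z \<in> poly_ellipse r"
      have "cmod (g z) \<le> cmod (f z) + cmod (f z - g z)"
        using norm_triangle_ineq4[of "f z" "f z - g z"] by simp
      thus "cmod (g z) \<le> M + e" using M[OF z] close[of z] z by (simp add: Y_def)
    qed (use M0 e in simp)
    moreover have "cmod (gegenbauer_coeff lam f k - gegenbauer_coeff lam g k) \<le> e * Q"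
      unfolding Q_def using e complex_cube_subset_D_region[OF h eps0] complex_cube_subset_filled[OF r0] close
      by (intro gegenbauer_coeff_diff_le lam continuous_on_subset[OF cont] continuous_on_subset[OF gcont]) (auto simp: Y_def)
    ultimately show ?thesis
      using norm_triangle_ineq2[of "gegenbauer_coeff lam f k" "gegenbauer_coeff lam g k"] by simp
  qed
  have "cmod (gegenbauer_coeff lam f k) \<le> M * P"
  proof (rule field_le_epsilon)
    fix e :: real assume e: "e > 0"
    have PQ: "P + Q + 1 > 0" using P0 Q0 by simp
    \<comment> \<open>The total error is e' (P + Q); the added 1 keeps the denominator positive even
      if P = Q = 0.\<close>
    define e' where "e' = e / (P + Q + 1)"
    have "e' > 0" using e PQ by (simp add: e'_def)
    from approx[OF this] have "cmod (gegenbauer_coeff lam f k) \<le> M * P + e' * (P + Q)"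
      by (simp add: algebra_simps)
    also have "e' * (P + Q) \<le> e' * (P + Q + 1)" using \<open>e' > 0\<close> by simp
    also have "\<dots> = e" using PQ by (simp add: e'_def)
    finally show "cmod (gegenbauer_coeff lam f k) \<le> M * P + e" by simp
  qed
  also have "M * P \<le> M * poly_ellipse_length r / (pi ^ CARD('d) * (h + sqrt (1 + h\<^sup>2)) powr index_norm k)
     * (\<Prod>i | k $ i = 0. D_bar lam (r $ i)) * (\<Prod>j | k $ j \<noteq> 0. real (k $ j) powr (1 - lam) * D_const lam (r $ j))"
  proof -
    define W where "W = (\<Prod>i\<in>UNIV. if k $ i = 0 then D_bar lam (r $ i) else real (k $ i) powr (1 - lam) * D_const lam (r $ i))"
    define p where "p = (h + sqrt (1 + h\<^sup>2)) powr index_norm k"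
    have W: "W = (\<Prod>i | k $ i = 0. D_bar lam (r $ i)) * (\<Prod>j | k $ j \<noteq> 0. real (k $ j) powr (1 - lam) * D_const lam (r $ j))"
    proof -
      have "- {i. k $ i = 0} = {j. k $ j \<noteq> 0}" by auto
      thus ?thesis unfolding W_def by (subst prod.If_cases) simp_all
    qed
    have W0: "W \<ge> 0"
      unfolding W_def using lam r0
      by (intro prod_nonneg) (auto simp: D_bar_def D_const_def intro!: mult_nonneg_nonneg divide_nonneg_nonneg Gamma_real_nonneg intro: less_imp_le)
    have L0: "poly_ellipse_length r \<ge> 0"
      unfolding poly_ellipse_length_def by (intro prod_nonneg ellipse_length_nonneg r0)
    have "h + sqrt (1 + h\<^sup>2) > 0" using h by (intro add_pos_nonneg) auto
    hence p: "p > 0" unfolding p_def by simp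
    \<comment> \<open>Only here are the separate powers of the radii traded for one power of rho.
      They stand in the denominator, so a lower bound on their product suffices.\<close>
    have "P = poly_ellipse_length r / (pi ^ CARD('d) * (\<Prod>i\<in>UNIV. (r $ i) ^ (k $ i))) * W"
      unfolding P_def coeff_factor_def W_def poly_ellipse_length_def prod.distrib prod_dividef by simp
    also have "\<dots> \<le> poly_ellipse_length r / (pi ^ CARD('d) * p) * W"
      using powr_index_norm_le_prod_rho_hat[OF h eps0, of k] L0 W0 p r0
      by (intro mult_right_mono divide_left_mono mult_left_mono mult_pos_pos prod_pos) (auto simp: p_def r_def)
    finally have "M * P \<le> M * (poly_ellipse_length r / (pi ^ CARD('d) * p) * W)"
      using M0 by (rule mult_left_mono)
    thus ?thesis by (simp add: W p_def mult.assoc)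
  qed
  finally show ?thesis by (simp only: r_def M_def)
qed

end
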